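(* Let $c_n$ be an intermediate time-scale with parameter $\varepsilon$. (i) For all $0<\varepsilon\le1$ and all $0<\beta<\infty$ such that $\alpha(\varepsilon)=1$ the following holds: for all $T>0$ and all $\epsilon>0$, $\mathbb P$-almost surely if $\sum_na_n/2^n<\infty$ and in $\mathbb P$-probability if $\sum_na_n/2^n=\infty$, $$\lim_{n\to\infty}\mathcal P\Big(\sup_{t\in[0,T]}\Big|\frac{M_n(t)}{\mathbb E(E(M_n(1)))}-t\Big|>\epsilon\Big)=0 \quad\text{and}\quad \lim_{n\to\infty}\mathcal P\Big(\sup_{t\in[0,T]}\Big|\frac{S_n(t)}{\mathbb E(E(M_n(1)))}-t\Big|>\epsilon\Big)=0.$$ (ii) For all $0<\varepsilon\le1$ and all $0<\beta<\infty$ such that $\alpha(\varepsilon)>1$, for all $T>0$ and all $\epsilon>0$, $\mathbb P$-almost surely, $$\lim_{n\to\infty}\mathcal P\Big(\sup_{t\in[0,T]}\Big|\frac{S_n(t)}{a_ne^{n\beta^2/2}/c_n}-t\Big|>\epsilon\Big)=0.$$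
   Context: For $n\ge 1$ let $\mathcal V_n=\{-1,1\}^n$ be the discrete cube, with edges between vertices that differ in exactly one coordinate. Let $(\mathcal H_n(x))_{x\in\mathcal V_n}$ be independent centered Gaussian random variables of variance $n$ (for all $n$ defined on a common probability space with law $\mathbb P$ and expectation $\mathbb E$, called the random environment). For $\beta>0$ set $\tau_n(x)=\exp\{-\beta\mathcal H_n(x)\}$. "In $\mathbb P$-probability" refers to the randomness of the environment. Given a diverging sequence $c_n$ (time-scale), $a_n$ is defined by $a_n\mathbb P(\tau_n(x)\ge c_n)=1$. $c_n$ is an intermediate time-scale (with parameter $0<\varepsilon\le1$) if $\lim_n\frac{\log a_n}{n\log 2}=\varepsilon$ and $\lim_n a_n/2^n=0$. Set $\beta_c(\varepsilon)=\sqrt{2\varepsilon\log2}$, $\alpha(\varepsilon)=\beta_c(\varepsilon)/\beta$ and $\gamma_n(x)=c_n^{-1}\tau_n(x)$. $(J_n(k))_{k\in\mathbb N}$ is the simple random walk on $\mathcal V_n$ (one-step transition probabilities $p_n(x,y)=1/n$ if $(x,y)$ is an edge, $0$ otherwise), independent of the environment and started from the uniform distribution on $\mathcal V_n$; $(e_{n,i})$ are i.i.d. mean one exponential random variables independent of $J_n$ and of the environment. The rescaled clock process is $S_n(t)=c_n^{-1}\sum_{i=0}^{\lfloor a_nt\rfloor}\tau_n(J_n(i))e_{n,i}$, $t\ge0$, and $$M_n(t)=\sum_{i=1}^{\lfloor a_nt\rfloor}\sum_{x\in\mathcal V_n}p_n(J_n(i-1),x)\,\gamma_n(x)\big(1-e^{-1/\gamma_n(x)}\big).$$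 $\mathcal P$ denotes the joint law of $J_n$ and $(e_{n,i})$ for fixed environment; $E$ is the expectation with respect to the law of $J_n$ for fixed environment. *)

theory Defs
  imports "HOL-Probability.Probability"
begin

type_synonym vertex = "nat \<Rightarrow> int"

definition cube :: "nat \<Rightarrow> vertex set" where
  "cube n = {..<n} \<rightarrow>\<^sub>E {-1, 1}"

definition cube_edge :: "nat \<Rightarrow> vertex \<Rightarrow> vertex \<Rightarrow> bool" where
  "cube_edge n x y \<longleftrightarrow> x \<in> cube n \<and> y \<in> cube n \<and> card {i \<in> {..<n}. x i \<noteq> y i} = 1"

definition trans_prob :: "nat \<Rightarrow> vertex \<Rightarrow> vertex \<Rightarrow> real" where
  "trans_prob n x y = (if cube_edge n x y then 1 / real n else 0)"

(* H n x is the random variable H_n(x). All levels n live on the single space P;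
   nothing is assumed about the joint law of different levels. *)
locale random_environment = prob_space P
  for P :: "'w measure" +
  fixes H :: "nat \<Rightarrow> vertex \<Rightarrow> 'w \<Rightarrow> real"
  assumes indep_H: "n \<ge> 1 \<Longrightarrow> indep_vars (\<lambda>_. borel) (H n) (cube n)"
    and gaussian_H: "n \<ge> 1 \<Longrightarrow> x \<in> cube n \<Longrightarrow>
      distributed P lborel (H n x) (normal_density 0 (sqrt (real n)))"

(* The dynamics at level n: the walk J and the exponential variables e on a space Q that carries
   no environment. Independence of the environment is expressed by the product structure:
   joint quantities are functions on P x Q, and fixing the environment means fixing the first
   coordinate, so that Q plays the role of the law of (J, e) for fixed environment.
   Since J and e take values in different types, their independence is stated through the
   generated sigma-algebras, which is what indep_var unfolds to. *)
locale walk_and_clocks = prob_space Q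
  for n :: nat and Q :: "'v measure" +
  fixes J :: "nat \<Rightarrow> 'v \<Rightarrow> vertex" and e :: "nat \<Rightarrow> 'v \<Rightarrow> real"
  assumes measurable_J: "J k \<in> measurable Q (count_space (cube n))"
    and uniform_start: "x \<in> cube n \<Longrightarrow> prob {\<omega> \<in> space Q. J 0 \<omega> = x} = 1 / 2 ^ n"
    and markov: "(\<And>i. i \<le> Suc k \<Longrightarrow> y i \<in> cube n) \<Longrightarrow>
      prob {\<omega> \<in> space Q. \<forall>i\<le>Suc k. J i \<omega> = y i} =
      prob {\<omega> \<in> space Q. \<forall>i\<le>k. J i \<omega> = y i} * trans_prob n (y k) (y (Suc k))"
    and indep_e: "indep_vars (\<lambda>_. borel) e UNIV"
    and exponential_e: "distributed Q lborel (e i) (exponential_density 1)"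
    and indep_J_e: "indep_set
      (sets (vimage_algebra (space Q) (\<lambda>\<omega> k. J k \<omega>) (PiM UNIV (\<lambda>_. count_space (cube n)))))
      (sets (vimage_algebra (space Q) (\<lambda>\<omega> i. e i \<omega>) (PiM UNIV (\<lambda>_. borel))))"

(* Below, h :: vertex => real is a realisation of the environment at level n (h = H_n),
   j and s are realisations of the walk and of the exponential variables, and the reals a and c
   are the values a_n and c_n. *)

definition tau :: "real \<Rightarrow> (vertex \<Rightarrow> real) \<Rightarrow> vertex \<Rightarrow> real" where
  "tau \<beta> h x = exp (- \<beta> * h x)"

definition gam :: "real \<Rightarrow> real \<Rightarrow> (vertex \<Rightarrow> real) \<Rightarrow> vertex \<Rightarrow> real" where
  "gam \<beta> c h x = tau \<beta> h x / c"

definition clock :: "real \<Rightarrow> real \<Rightarrow> real \<Rightarrow> (vertex \<Rightarrow> real) \<Rightarrow> (nat \<Rightarrow> vertex) \<Rightarrow> (nat \<Rightarrow> real)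
    \<Rightarrow> real \<Rightarrow> real" where
  "clock \<beta> a c h j s t = (\<Sum>i=0..nat \<lfloor>a * t\<rfloor>. tau \<beta> h (j i) * s i) / c"

definition mean_clock :: "nat \<Rightarrow> real \<Rightarrow> real \<Rightarrow> real \<Rightarrow> (vertex \<Rightarrow> real) \<Rightarrow> (nat \<Rightarrow> vertex)
    \<Rightarrow> real \<Rightarrow> real" where
  "mean_clock n \<beta> a c h j t =
    (\<Sum>i=1..nat \<lfloor>a * t\<rfloor>. \<Sum>x\<in>cube n.
       trans_prob n (j (i - 1)) x * gam \<beta> c h x * (1 - exp (- 1 / gam \<beta> c h x)))"

definition is_scale :: "'w measure \<Rightarrow> (nat \<Rightarrow> vertex \<Rightarrow> 'w \<Rightarrow> real) \<Rightarrow> real \<Rightarrow> (nat \<Rightarrow> real)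
    \<Rightarrow> (nat \<Rightarrow> real) \<Rightarrow> bool" where
  "is_scale P H \<beta> c a \<longleftrightarrow>
    (\<forall>n\<ge>1. \<forall>x\<in>cube n. a n * measure P {\<omega> \<in> space P. tau \<beta> (\<lambda>y. H n y \<omega>) x \<ge> c n} = 1)"

definition intermediate_time_scale :: "'w measure \<Rightarrow> (nat \<Rightarrow> vertex \<Rightarrow> 'w \<Rightarrow> real) \<Rightarrow> real
    \<Rightarrow> (nat \<Rightarrow> real) \<Rightarrow> (nat \<Rightarrow> real) \<Rightarrow> real \<Rightarrow> bool" where
  "intermediate_time_scale P H \<beta> c a \<epsilon> \<longleftrightarrow>
    filterlim c at_top sequentially \<and> is_scale P H \<beta> c a \<and> 0 < \<epsilon> \<and> \<epsilon> \<le> 1 \<and>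
    (\<lambda>n. ln (a n) / (real n * ln 2)) \<longlonglongrightarrow> \<epsilon> \<and> (\<lambda>n. a n / 2 ^ n) \<longlonglongrightarrow> 0"

definition beta_c :: "real \<Rightarrow> real" where
  "beta_c \<epsilon> = sqrt (2 * \<epsilon> * ln 2)"

definition alpha :: "real \<Rightarrow> real \<Rightarrow> real" where
  "alpha \<beta> \<epsilon> = beta_c \<epsilon> / \<beta>"

(* Probability that X(t)/d deviates from t by more than \<delta>, uniformly over t in [0,T].
   The real-valued SUP is used only for X bounded on [0,T]. *)
definition dev_prob :: "'v measure \<Rightarrow> ('v \<Rightarrow> real \<Rightarrow> real) \<Rightarrow> real \<Rightarrow> real \<Rightarrow> real \<Rightarrow> real" where
  "dev_prob Q X d T \<delta> =
    measure Q {\<omega> \<in> space Q. (SUP t\<in>{0..T}. \<bar>X \<omega> t / d - t\<bar>) > \<delta>}"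

definition tendsto_in_prob :: "'w measure \<Rightarrow> (nat \<Rightarrow> 'w \<Rightarrow> real) \<Rightarrow> real \<Rightarrow> bool" where
  "tendsto_in_prob P X l \<longleftrightarrow>
    (\<forall>\<eta>>0. (\<lambda>n. measure P {\<omega> \<in> space P. \<bar>X n \<omega> - l\<bar> > \<eta>}) \<longlonglongrightarrow> 0)"

end

(* For a fixed environment the walk is stationary and diagonalised by the Walsh characters, so the
   variance of the sum of f (J i) over i < m is at most m times the quadratic form
   asymp_var n f = sum over A \<noteq> {} of (2 n / |A|) * (Walsh coefficient of f at A)^2.  Hence the clock,
   with the waiting times gam truncated at a level b, is within o(d) of its mean t * d as soon as four
   averages over the cube are under control: the proportion of vertices beyond b (times a), the mean
   of the truncated gam (times a / d), and its second moment and asymp_var (times a / d^2).  Under the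
   environment these are averages and one quadratic form of i.i.d. bounded variables.  The diagonal
   of the form is again a second moment, its off-diagonal part has variance of order
   2^-n (E gam^2)^2, so the exceptional environments have probability O(a / 2^n), or exponentially
   small when alpha > 1.  Uniformity in t is free: the processes are monotone and the limit is
   continuous.

   For alpha = 1 the truncation level is the square root of the normalisation d; d diverges because
   a E[gam; gam \<le> 1] does, whereas a E[gam^2; gam \<le> 1] stays bounded.  For alpha > 1 an exponential
   moment of order p > 1 with p beta^2 < 2 eps ln 2 allows truncation at exp (- eta n) d. *)

theory Submission
  imports Defs "HOL-Real_Asymp.Real_Asymp"
begin

section \<open>Walsh analysis of the walk on the cube\<close>

text \<open>The obstacle is the slow mixing of the walk. The spectral gap alone bounds
  \<open>asymp_var n f\<close> by 2 n times the mean square of f. At alpha = 1 that factor n cannot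
  be afforded: the scaled second moment after division by the square of d tends to 0 only because d
  diverges, and no rate of divergence is available. The way out is that the weight 2 n / |A| is of
  order n only for small sets A, and these are few: its average over all subsets of the coordinates
  is bounded, and so is the average of its square. A centred i.i.d. environment has Walsh
  coefficients of equal variance, so a typical quadratic form is a constant times the second moment.
  The first average controls the diagonal of the form, the second one its off-diagonal fluctuations.

  Truncation has a second use besides making second moments finite in scale: a function bounded by d
  has a fourth moment of at most the square of d times its second moment, which is what Chebyshev's
  inequality needs for the empirical second moment. The numerical constants (48, 96, 800, 10^6) are
  crude; only their independence of n matters.\<close>

lemma finite_cube [simp]: "finite (cube n)"
  unfolding cube_def by (intro finite_PiE) auto

lemma card_cube [simp]: "card (cube n) = 2 ^ n"
  by (simp add: cube_def card_PiE numeral_2_eq_2)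

lemma cube_nonempty: "\<exists>x. x \<in> cube n"
proof -
  have "card (cube n) \<noteq> 0" by simp
  then show ?thesis by (metis card.empty ex_in_conv)
qed

definition cube_avg :: "nat \<Rightarrow> (vertex \<Rightarrow> real) \<Rightarrow> real" where
  "cube_avg n f = (\<Sum>x\<in>cube n. f x) / 2 ^ n"

definition walsh :: "nat set \<Rightarrow> vertex \<Rightarrow> real" where
  "walsh A x = (\<Prod>i\<in>A. real_of_int (x i))"

definition step_mean :: "nat \<Rightarrow> (vertex \<Rightarrow> real) \<Rightarrow> vertex \<Rightarrow> real" where
  "step_mean n f y = (\<Sum>x\<in>cube n. trans_prob n y x * f x)"

definition walsh_coeff :: "nat \<Rightarrow> (vertex \<Rightarrow> real) \<Rightarrow> nat set \<Rightarrow> real" where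
  "walsh_coeff n f A = cube_avg n (\<lambda>x. f x * walsh A x)"

definition walsh_eigenvalue :: "nat \<Rightarrow> nat set \<Rightarrow> real" where
  "walsh_eigenvalue n A = 1 - 2 * real (card A) / real n"

definition nontrivial :: "nat \<Rightarrow> nat set set" where
  "nontrivial n = Pow {..<n} - {{}}"

text \<open>This is \<open>4 / (1 - \<lambda>)\<close> for the eigenvalue \<open>\<lambda> = 1 - 2 |A| / n\<close>; it also covers the eigenvalue \<open>-1\<close>
  coming from the periodicity of the walk.\<close>

definition spectral_weight :: "nat \<Rightarrow> nat set \<Rightarrow> real" where
  "spectral_weight n A = 2 * real n / real (card A)"

text \<open>A majorant of the limiting variance per step of an additive functional of the walk,
  whose exact spectral density would be (1 + \<lambda>) / (1 - \<lambda>). The trivial character is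
  left out because it carries the mean.\<close>

definition asymp_var :: "nat \<Rightarrow> (vertex \<Rightarrow> real) \<Rightarrow> real" where
  "asymp_var n f = (\<Sum>A\<in>nontrivial n. spectral_weight n A * (walsh_coeff n f A)\<^sup>2)"

lemma cube_coord: "x \<in> cube n \<Longrightarrow> i < n \<Longrightarrow> x i = -1 \<or> x i = 1"
  by (auto simp: cube_def PiE_iff)

lemma cube_coord_sq: "x \<in> cube n \<Longrightarrow> i < n \<Longrightarrow> real_of_int (x i) * real_of_int (x i) = 1"
  using cube_coord[of x n i] by auto

lemma cube_eqI: "x \<in> cube n \<Longrightarrow> y \<in> cube n \<Longrightarrow> (\<And>i. i < n \<Longrightarrow> x i = y i) \<Longrightarrow> x = y"
  unfolding cube_def by (rule PiE_ext) auto

lemma flip_in_cube: "y \<in> cube n \<Longrightarrow> i < n \<Longrightarrow> y(i := - y i) \<in> cube n"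
  by (auto simp: cube_def PiE_iff extensional_def)

lemma neighbours_eq:
  assumes y: "y \<in> cube n"
  shows "{x \<in> cube n. cube_edge n y x} = (\<lambda>i. y(i := - y i)) ` {..<n}"
proof (intro equalityI subsetI)
  fix x assume "x \<in> {x \<in> cube n. cube_edge n y x}"
  then have x: "x \<in> cube n" and "card {i \<in> {..<n}. y i \<noteq> x i} = 1"
    by (auto simp: cube_edge_def)
  then obtain i where i: "{i \<in> {..<n}. y i \<noteq> x i} = {i}"
    by (auto simp: card_1_singleton_iff)
  then have "i < n" "y i \<noteq> x i" and eq: "\<And>j. j < n \<Longrightarrow> j \<noteq> i \<Longrightarrow> y j = x j" by auto
  have "x = y(i := - y i)"
  proof (rule cube_eqI[OF x flip_in_cube[OF y \<open>i < n\<close>]])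
    fix j assume "j < n"
    then show "x j = (y(i := - y i)) j"
      using eq[of j] \<open>y i \<noteq> x i\<close> cube_coord[OF x, of i] cube_coord[OF y, of i] \<open>i < n\<close>
      by (cases "j = i") auto
  qed
  then show "x \<in> (\<lambda>i. y(i := - y i)) ` {..<n}" using \<open>i < n\<close> by auto
next
  fix x assume "x \<in> (\<lambda>i. y(i := - y i)) ` {..<n}"
  then obtain i where i: "i < n" "x = y(i := - y i)" by auto
  have "{j \<in> {..<n}. y j \<noteq> x j} = {i}"
    using i cube_coord[OF y, of i] by (auto split: if_splits)
  then show "x \<in> {x \<in> cube n. cube_edge n y x}"
    using i y flip_in_cube[OF y i(1)] by (simp add: cube_edge_def)
qed

lemma step_mean_flip:
  assumes y: "y \<in> cube n"
  shows "step_mean n f y = (\<Sum>i<n. f (y(i := - y i))) / n"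
proof -
  have inj: "inj_on (\<lambda>i. y(i := - y i)) {..<n}"
  proof (rule inj_onI)
    fix i j assume ij: "i \<in> {..<n}" "j \<in> {..<n}" "y(i := - y i) = y(j := - y j)"
    show "i = j"
    proof (rule ccontr)
      assume "i \<noteq> j"
      then have "- y i = y i" using fun_cong[OF ij(3), of i] by simp
      then show False using cube_coord[OF y, of i] ij by auto
    qed
  qed
  have "step_mean n f y = (\<Sum>x\<in>cube n. if cube_edge n y x then f x / n else 0)"
    unfolding step_mean_def trans_prob_def by (intro sum.cong) auto
  also have "\<dots> = (\<Sum>x\<in>{x \<in> cube n. cube_edge n y x}. f x / n)"
    by (rule sum.inter_filter[symmetric]) simp
  also have "\<dots> = (\<Sum>i<n. f (y(i := - y i)) / n)"
    unfolding neighbours_eq[OF y] by (subst sum.reindex[OF inj]) simp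
  finally show ?thesis by (simp add: sum_divide_distrib)
qed

text \<open>Flipping coordinate i changes the sign of the character exactly when i belongs to A.
  Hence card A of the n neighbours contribute with a minus sign and the others with a plus
  sign.\<close>

lemma step_mean_walsh:
  assumes y: "y \<in> cube n" and A: "A \<subseteq> {..<n}" and n: "n \<ge> 1"
  shows "step_mean n (walsh A) y = walsh_eigenvalue n A * walsh A y"
proof -
  have fin: "finite A" using A finite_subset by blast
  have flip: "walsh A (y(i := - y i)) = (if i \<in> A then - walsh A y else walsh A y)" for i
  proof (cases "i \<in> A")
    case True
    have "walsh A (y(i := - y i)) = - real_of_int (y i) * (\<Prod>j\<in>A - {i}. real_of_int (y j))"
      unfolding walsh_def by (subst prod.remove[OF fin True]) (auto intro!: arg_cong2[where f="(*)"] prod.cong)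
    also have "\<dots> = - walsh A y"
      unfolding walsh_def using prod.remove[OF fin True, of "\<lambda>j. real_of_int (y j)"] by simp
    finally show ?thesis using True by simp
  next
    case False
    then show ?thesis unfolding walsh_def by (auto intro!: prod.cong)
  qed
  have "(\<Sum>i<n. walsh A (y(i := - y i))) = (\<Sum>i<n. walsh A y - (if i \<in> A then 2 * walsh A y else 0))"
    unfolding flip by (intro sum.cong) auto
  also have "\<dots> = n * walsh A y - (\<Sum>i\<in>{..<n} \<inter> A. 2 * walsh A y)"
    by (simp add: sum_subtractf sum.If_cases)
  also have "\<dots> = n * walsh A y - card A * (2 * walsh A y)"
    using A by (simp add: Int_absorb1)
  finally have "(\<Sum>i<n. walsh A (y(i := - y i))) = n * walsh A y - card A * (2 * walsh A y)" .
  then show ?thesis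
    unfolding step_mean_flip[OF y] walsh_eigenvalue_def using n by (simp add: field_simps del: fun_upd_apply)
qed

lemma trans_prob_sym: "trans_prob n x y = trans_prob n y x"
  by (simp add: trans_prob_def cube_edge_def conj_ac eq_commute)

text \<open>Reversibility: the transition matrix is symmetric, hence self-adjoint for the uniform
  measure. Paired with the constant 1 this is stationarity.\<close>

lemma cube_avg_step_mean_adjoint:
  "cube_avg n (\<lambda>x. step_mean n f x * g x) = cube_avg n (\<lambda>x. f x * step_mean n g x)"
proof -
  have "(\<Sum>x\<in>cube n. step_mean n f x * g x) = (\<Sum>x\<in>cube n. \<Sum>y\<in>cube n. trans_prob n x y * f y * g x)"
    by (simp add: step_mean_def sum_distrib_right)
  also have "\<dots> = (\<Sum>y\<in>cube n. \<Sum>x\<in>cube n. trans_prob n x y * f y * g x)" by (rule sum.swap)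
  also have "\<dots> = (\<Sum>y\<in>cube n. f y * step_mean n g y)"
    unfolding step_mean_def sum_distrib_left
    by (intro sum.cong refl) (simp add: trans_prob_sym mult_ac)
  finally show ?thesis by (simp add: cube_avg_def)
qed

lemma cube_avg_cong: "(\<And>x. x \<in> cube n \<Longrightarrow> f x = g x) \<Longrightarrow> cube_avg n f = cube_avg n g"
  by (simp add: cube_avg_def)

lemma walsh_empty [simp]: "walsh {} = (\<lambda>_. 1)"
  by (simp add: walsh_def fun_eq_iff)

lemma cube_avg_const [simp]: "cube_avg n (\<lambda>_. k) = k"
  by (simp add: cube_avg_def)

lemma cube_avg_mult_left: "cube_avg n (\<lambda>x. k * f x) = k * cube_avg n f"
  by (simp add: cube_avg_def sum_distrib_left)

lemma cube_avg_nonneg: "(\<And>x. x \<in> cube n \<Longrightarrow> f x \<ge> 0) \<Longrightarrow> cube_avg n f \<ge> 0"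
  by (simp add: cube_avg_def sum_nonneg)

lemma cube_avg_mono: "(\<And>x. x \<in> cube n \<Longrightarrow> f x \<le> g x) \<Longrightarrow> cube_avg n f \<le> cube_avg n g"
  by (simp add: cube_avg_def sum_mono divide_right_mono)

lemma step_mean_one: "n \<ge> 1 \<Longrightarrow> y \<in> cube n \<Longrightarrow> step_mean n (\<lambda>_. 1) y = 1"
  using step_mean_walsh[of y n "{}"] by (simp add: walsh_eigenvalue_def)

lemma cube_avg_step_mean: "n \<ge> 1 \<Longrightarrow> cube_avg n (step_mean n f) = cube_avg n f"
  using cube_avg_step_mean_adjoint[of n f "\<lambda>_. 1"]
  by (simp add: step_mean_one cong: cube_avg_cong)

lemma walsh_coeff_step_mean:
  assumes "n \<ge> 1" "A \<subseteq> {..<n}"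
  shows "walsh_coeff n (step_mean n f) A = walsh_eigenvalue n A * walsh_coeff n f A"
proof -
  have "walsh_coeff n (step_mean n f) A = cube_avg n (\<lambda>x. walsh_eigenvalue n A * (f x * walsh A x))"
    unfolding walsh_coeff_def cube_avg_step_mean_adjoint
    by (rule cube_avg_cong) (simp only: step_mean_walsh[OF _ assms(2,1)] mult.left_commute)
  then show ?thesis by (simp add: cube_avg_mult_left walsh_coeff_def)
qed

lemma nontrivialD:
  assumes "A \<in> nontrivial n"
  shows "A \<subseteq> {..<n}" "A \<noteq> {}" "finite A" "card A \<ge> 1" "card A \<le> n" "n \<ge> 1"
proof -
  show 1: "A \<subseteq> {..<n}" "A \<noteq> {}" using assms by (auto simp: nontrivial_def)
  show fin: "finite A" using 1 finite_subset by blast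
  then show "card A \<ge> 1" using 1 by (simp add: Suc_le_eq card_gt_0_iff)
  show "card A \<le> n" using card_mono[OF _ 1(1)] by simp
  with \<open>card A \<ge> 1\<close> show "n \<ge> 1" by linarith
qed

lemma finite_nontrivial [simp]: "finite (nontrivial n)"
  by (simp add: nontrivial_def)

lemma walsh_eigenvalue_bounds:
  assumes "A \<in> nontrivial n"
  shows "-1 \<le> walsh_eigenvalue n A" "walsh_eigenvalue n A < 1"
  using nontrivialD(4-6)[OF assms] by (auto simp: walsh_eigenvalue_def field_simps)

text \<open>The constant 1 and \<open>walsh A\<close> are eigenfunctions of a self-adjoint operator
  with different eigenvalues, namely 1 and a number below 1, so they are orthogonal.\<close>

lemma cube_avg_walsh:
  assumes "A \<in> nontrivial n"
  shows "cube_avg n (walsh A) = 0"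
proof -
  have "walsh_coeff n (step_mean n (\<lambda>_. 1)) A = walsh_coeff n (\<lambda>_. 1) A"
    unfolding walsh_coeff_def using nontrivialD(6)[OF assms]
    by (intro cube_avg_cong) (simp add: step_mean_one)
  then have "walsh_eigenvalue n A * walsh_coeff n (\<lambda>_. 1) A = walsh_coeff n (\<lambda>_. 1) A"
    by (simp only: walsh_coeff_step_mean[OF nontrivialD(6,1)[OF assms]])
  then have "walsh_coeff n (\<lambda>_. 1) A = 0"
    using less_imp_neq[OF walsh_eigenvalue_bounds(2)[OF assms]] by (metis mult_cancel_right1)
  then show ?thesis by (simp add: walsh_coeff_def)
qed

lemma walsh_coeff_diff_const:
  assumes "A \<in> nontrivial n"
  shows "walsh_coeff n (\<lambda>x. f x - k) A = walsh_coeff n f A"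
proof -
  have "walsh_coeff n (\<lambda>x. f x - k) A = walsh_coeff n f A - k * cube_avg n (walsh A)"
    by (simp add: walsh_coeff_def cube_avg_def sum_subtractf diff_divide_distrib
        left_diff_distrib sum_distrib_left)
  then show ?thesis by (simp add: cube_avg_walsh[OF assms])
qed

text \<open>A sum over all subsets of products over the subset is the product of the factors x_i y_i
  + 1. Each factor is 2 where the points agree, and a single disagreement makes one vanish.\<close>

lemma sum_walsh_walsh:
  assumes x: "x \<in> cube n" and y: "y \<in> cube n"
  shows "(\<Sum>A\<in>Pow {..<n}. walsh A x * walsh A y) = (if x = y then 2 ^ n else 0)"
proof -
  have "(\<Sum>A\<in>Pow {..<n}. walsh A x * walsh A y)
      = (\<Sum>A\<in>Pow {..<n}. \<Prod>i\<in>A. real_of_int (x i) * real_of_int (y i))"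
    by (simp add: walsh_def prod.distrib)
  also have "\<dots> = (\<Prod>i<n. real_of_int (x i) * real_of_int (y i) + 1)"
    by (subst prod_add) simp_all
  also have "\<dots> = (if x = y then 2 ^ n else 0)"
  proof (cases "x = y")
    case True
    then show ?thesis using cube_coord_sq[OF y] by simp
  next
    case False
    then obtain i where i: "i < n" "x i \<noteq> y i" using cube_eqI[OF x y] by blast
    then have "real_of_int (x i) * real_of_int (y i) + 1 = 0"
      using cube_coord[OF x i(1)] cube_coord[OF y i(1)] by auto
    then show ?thesis using i False by (auto intro!: prod_zero)
  qed
  finally show ?thesis .
qed

lemma walsh_expansion:
  assumes x: "x \<in> cube n"
  shows "f x = (\<Sum>A\<in>Pow {..<n}. walsh_coeff n f A * walsh A x)"
proof -
  have "(\<Sum>A\<in>Pow {..<n}. walsh_coeff n f A * walsh A x)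
      = (\<Sum>A\<in>Pow {..<n}. \<Sum>y\<in>cube n. f y * (walsh A y * walsh A x)) / 2 ^ n"
    by (simp add: walsh_coeff_def cube_avg_def sum_distrib_right sum_divide_distrib mult.assoc)
  also have "\<dots> = (\<Sum>y\<in>cube n. f y * (\<Sum>A\<in>Pow {..<n}. walsh A y * walsh A x)) / 2 ^ n"
    by (subst sum.swap) (simp add: sum_distrib_left)
  also have "\<dots> = (\<Sum>y\<in>cube n. if y = x then f y * 2 ^ n else 0) / 2 ^ n"
    using x by (intro arg_cong2[where f="(/)"] sum.cong refl) (simp add: sum_walsh_walsh)
  also have "\<dots> = f x" using x by (simp add: sum.delta)
  finally show ?thesis ..
qed

lemma walsh_sq: "x \<in> cube n \<Longrightarrow> A \<subseteq> {..<n} \<Longrightarrow> walsh A x * walsh A x = 1"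
  unfolding walsh_def prod.distrib[symmetric] by (intro prod.neutral) (auto simp: cube_coord_sq)

lemma walsh_mult:
  assumes x: "x \<in> cube n" and A: "A \<subseteq> {..<n}" and B: "B \<subseteq> {..<n}"
  shows "walsh A x * walsh B x = walsh (sym_diff A B) x"
proof -
  have fin: "finite A" "finite B" using A B finite_subset by blast+
  have "walsh A x = walsh (A - B) x * walsh (A \<inter> B) x"
    unfolding walsh_def using fin by (subst prod.union_disjoint[symmetric]) (auto intro!: prod.cong)
  moreover have "walsh B x = walsh (B - A) x * walsh (A \<inter> B) x"
    unfolding walsh_def using fin
    by (subst prod.union_disjoint[symmetric]) (auto intro!: prod.cong)
  moreover have "walsh (sym_diff A B) x = walsh (A - B) x * walsh (B - A) x"
    unfolding walsh_def using fin by (subst prod.union_disjoint) auto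
  ultimately show ?thesis
    using walsh_sq[OF x, of "A \<inter> B"] A by (simp add: le_infI1 mult_ac)
qed

text \<open>The product of two characters is the character of the symmetric difference, which has
  mean zero unless that set is empty.\<close>

lemma walsh_orthogonal:
  assumes A: "A \<in> Pow {..<n}" and B: "B \<in> Pow {..<n}"
  shows "(\<Sum>x\<in>cube n. walsh A x * walsh B x) = (if A = B then 2 ^ n else 0)"
proof -
  have "(\<Sum>x\<in>cube n. walsh A x * walsh B x) = 2 ^ n * cube_avg n (walsh (sym_diff A B))"
    using A B by (simp add: cube_avg_def walsh_mult)
  also have "\<dots> = (if A = B then 2 ^ n else 0)"
  proof (cases "A = B")
    case False
    then have "sym_diff A B \<in> nontrivial n" using A B by (auto simp: nontrivial_def)
    then show ?thesis using False by (simp add: cube_avg_walsh)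
  qed simp
  finally show ?thesis .
qed

lemma spectral_weight_ge_2:
  assumes "A \<in> nontrivial n" shows "2 \<le> spectral_weight n A"
  using nontrivialD[OF assms] by (simp add: spectral_weight_def field_simps)

text \<open>Eigenvalues lie in [-1, 1], so one step of averaging shrinks every coefficient. This
  lets the mean clock, which sums \<open>step_mean\<close> of the trap means, inherit the estimate
  for the trap means themselves.\<close>

lemma asymp_var_step_mean_le:
  assumes "n \<ge> 1"
  shows "asymp_var n (step_mean n f) \<le> asymp_var n f"
  unfolding asymp_var_def
proof (rule sum_mono)
  fix A assume A: "A \<in> nontrivial n"
  have "(walsh_eigenvalue n A)\<^sup>2 \<le> 1"
    using walsh_eigenvalue_bounds[OF A] by (simp add: abs_square_le_1 abs_le_iff)
  then have "(walsh_coeff n (step_mean n f) A)\<^sup>2 \<le> (walsh_coeff n f A)\<^sup>2"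
    using walsh_coeff_step_mean[OF assms nontrivialD(1)[OF A], of f]
    by (simp add: power_mult_distrib mult_left_le_one_le)
  then show "spectral_weight n A * (walsh_coeff n (step_mean n f) A)\<^sup>2
      \<le> spectral_weight n A * (walsh_coeff n f A)\<^sup>2"
    using spectral_weight_ge_2[OF A] by (intro mult_left_mono) auto
qed

lemma asymp_var_nonneg: "asymp_var n f \<ge> 0"
  unfolding asymp_var_def
  by (intro sum_nonneg mult_nonneg_nonneg) (auto simp: spectral_weight_def)

lemma inverse_square_le: "1 \<le> k \<Longrightarrow> 1 / (real k)\<^sup>2 \<le> 6 / (real (k + 1) * real (k + 2))"
proof -
  assume k: "1 \<le> k"
  have "real k \<le> real k * real k" using k by (simp add: mult_le_cancel_left1)
  moreover have "1 \<le> real k * real k" using k calculation by linarith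
  ultimately have "real (k + 1) * real (k + 2) \<le> 6 * (real k)\<^sup>2"
    by (simp add: power2_eq_square algebra_simps)
  then show ?thesis using k by (simp add: divide_simps)
qed

text \<open>\<open>1 / k\<^sup>2 \<le> 6 / ((k + 1) (k + 2))\<close> turns the sum over sets of size \<open>k\<close> into a binomial sum for \<open>n + 2\<close>.\<close>

lemma sum_spectral_weight_sq_le: "(\<Sum>A\<in>nontrivial n. (spectral_weight n A)\<^sup>2) \<le> 96 * 2 ^ n"
proof (cases "n = 0")
  case True then show ?thesis by (simp add: nontrivial_def)
next
  case False
  \<comment> \<open>The absorption identity, used twice, turns the denominators k + 1 and k + 2 into
    a shift of both arguments of the binomial coefficient.\<close>
  have binom: "real (n choose k) / (real (k + 1) * real (k + 2))
      = real ((n + 2) choose (k + 2)) / (real (n + 1) * real (n + 2))" for k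
  proof -
    have "Suc (Suc k) * (Suc (Suc n) choose Suc (Suc k)) = Suc (Suc n) * (Suc n choose Suc k)"
      and "Suc k * (Suc n choose Suc k) = Suc n * (n choose k)"
      using Suc_times_binomial_eq[of n k] Suc_times_binomial_eq[of "Suc n" "Suc k"] by (auto simp: mult_ac)
    then have "(k+1) * (k+2) * (Suc (Suc n) choose Suc (Suc k)) = (n+1) * (n+2) * (n choose k)"
      by (metis Suc_eq_plus1 add_2_eq_Suc' mult.assoc mult.left_commute)
    then have "real ((k+1) * (k+2) * (Suc (Suc n) choose Suc (Suc k))) = real ((n+1) * (n+2) * (n choose k))"
      by (rule arg_cong)
    then have "real (k+1) * real (k+2) * real ((n + 2) choose (k + 2)) = real (n+1) * real (n+2) * real (n choose k)"
      by (simp only: of_nat_mult add_2_eq_Suc')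
    moreover have "real (k+1) * real (k+2) \<noteq> 0" "real (n+1) * real (n+2) \<noteq> 0"
      by (simp_all only: mult_eq_0_iff of_nat_eq_0_iff) simp_all
    ultimately show ?thesis by (metis frac_eq_eq mult.commute)
  qed
  have "(\<Sum>A\<in>nontrivial n. (spectral_weight n A)\<^sup>2)
      \<le> (\<Sum>A\<in>nontrivial n. 24 * (real n)\<^sup>2 / (real (card A + 1) * real (card A + 2)))"
  proof (rule sum_mono)
    fix A assume A: "A \<in> nontrivial n"
    have "(spectral_weight n A)\<^sup>2 = 4 * (real n)\<^sup>2 * (1 / (real (card A))\<^sup>2)"
      by (simp add: spectral_weight_def power_divide power_mult_distrib)
    also have "\<dots> \<le> 4 * (real n)\<^sup>2 * (6 / (real (card A + 1) * real (card A + 2)))"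
      by (intro mult_left_mono inverse_square_le nontrivialD(4)[OF A]) auto
    finally show "(spectral_weight n A)\<^sup>2 \<le> 24 * (real n)\<^sup>2 / (real (card A + 1) * real (card A + 2))"
      by simp
  qed
  also have "\<dots> \<le> (\<Sum>A\<in>Pow {..<n}. 24 * (real n)\<^sup>2 / (real (card A + 1) * real (card A + 2)))"
    by (rule sum_mono2) (auto simp: nontrivial_def)
  also have "\<dots> = (\<Sum>k\<le>n. \<Sum>A\<in>{A \<in> Pow {..<n}. card A = k}. 24 * (real n)\<^sup>2 / (real (card A + 1) * real (card A + 2)))"
    by (rule sum.group[symmetric]) (auto dest: card_mono[of "{..<n}", rotated])
  also have "\<dots> = (\<Sum>k\<le>n. 24 * (real n)\<^sup>2 * (real (n choose k) / (real (k + 1) * real (k + 2))))"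
    using n_subsets[of "{..<n}"] by (intro sum.cong refl) (simp add: Pow_def)
  also have "\<dots> = 24 * (real n)\<^sup>2 / (real (n + 1) * real (n + 2)) * (\<Sum>k\<le>n. real ((n + 2) choose (k + 2)))"
    unfolding binom sum_distrib_left by (intro sum.cong refl) (simp add: field_simps del: of_nat_add binomial_Suc_Suc add_2_eq_Suc')
  \<comment> \<open>The factor 24 is 4 from the squared weight times 6 from
    \<open>inverse_square_le\<close>; a full row sum for n + 2 contributes four more copies of 2 ^
    n, hence 96.\<close>
  also have "\<dots> \<le> 24 * (2 ^ (n + 2))"
  proof (rule mult_mono)
    have "(real n)\<^sup>2 \<le> real (n + 1) * real (n + 2)" by (simp add: power2_eq_square algebra_simps)
    then show "24 * (real n)\<^sup>2 / (real (n + 1) * real (n + 2)) \<le> 24"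
      by (simp add: divide_le_eq)
    have "(\<Sum>k\<le>n. (n + 2) choose (k + 2)) = (\<Sum>k\<in>(\<lambda>k. k + 2) ` {..n}. (n + 2) choose k)"
      by (subst sum.reindex) (auto simp: inj_on_def)
    also have "\<dots> \<le> (\<Sum>k\<le>n + 2. (n + 2) choose k)"
      by (rule sum_mono2) auto
    also have "\<dots> = 2 ^ (n + 2)" by (rule choose_row_sum)
    finally have "real (\<Sum>k\<le>n. (n + 2) choose (k + 2)) \<le> real (2 ^ (n + 2))" by (rule of_nat_mono)
    then show "(\<Sum>k\<le>n. real ((n + 2) choose (k + 2))) \<le> 2 ^ (n + 2)"
      by (simp only: of_nat_sum of_nat_power of_nat_numeral)
  qed (auto intro: sum_nonneg)
  finally show ?thesis by simp
qed

text \<open>Weights are at least 2, so each is at most half its square; this halves 96.\<close>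

lemma sum_spectral_weight_le: "(\<Sum>A\<in>nontrivial n. spectral_weight n A) \<le> 48 * 2 ^ n"
proof -
  have "(\<Sum>A\<in>nontrivial n. spectral_weight n A) \<le> (\<Sum>A\<in>nontrivial n. (spectral_weight n A)\<^sup>2 / 2)"
  proof (rule sum_mono)
    fix A assume "A \<in> nontrivial n"
    then have "2 \<le> spectral_weight n A" by (rule spectral_weight_ge_2)
    then show "spectral_weight n A \<le> (spectral_weight n A)\<^sup>2 / 2"
      by (simp add: power2_eq_square)
  qed
  then show ?thesis using sum_spectral_weight_sq_le[of n] by (simp add: sum_divide_distrib[symmetric])
qed

section \<open>Second moments along the walk\<close>

text \<open>For fixed i the inner sum consists of two one-sided geometric sums. Each is at most 2 /
  (1 - r), because the closed form has numerator 1 - r^k, which is at most 2 even at r = -1.\<close>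

lemma sum_abs_diff_power_le:
  fixes r :: real
  assumes r: "-1 \<le> r" "r < 1"
  shows "(\<Sum>i<m. \<Sum>j<m. r ^ (if i \<le> j then j - i else i - j)) \<le> real m * (4 / (1 - r))"
proof -
  have geom: "(\<Sum>d<k. r ^ d) \<le> 2 / (1 - r)" for k
  proof -
    have "\<bar>r ^ k\<bar> \<le> 1" using r by (simp add: power_abs power_le_one abs_le_iff)
    then have "1 - r ^ k \<le> 2" by linarith
    then show ?thesis using r by (simp add: sum_gp_strict divide_right_mono)
  qed
  have "(\<Sum>j<m. r ^ (if i \<le> j then j - i else i - j)) \<le> 4 / (1 - r)" if i: "i < m" for i
  proof -
    have "(\<Sum>j<m. r ^ (if i \<le> j then j - i else i - j))
        = (\<Sum>j<i. r ^ (if i \<le> j then j - i else i - j)) + (\<Sum>j=i..<m. r ^ (if i \<le> j then j - i else i - j))"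
      using i sum.atLeastLessThan_concat[of 0 i m "\<lambda>j. r ^ (if i \<le> j then j - i else i - j)"]
      by (simp add: atLeast0LessThan)
    also have "(\<Sum>j=i..<m. r ^ (if i \<le> j then j - i else i - j)) = (\<Sum>d<m - i. r ^ d)"
      by (rule sum.reindex_bij_witness[of _ "\<lambda>d. d + i" "\<lambda>j. j - i"]) auto
    also have "(\<Sum>j<i. r ^ (if i \<le> j then j - i else i - j)) = (\<Sum>d\<in>{1..<Suc i}. r ^ d)"
      by (rule sum.reindex_bij_witness[of _ "\<lambda>d. i - d" "\<lambda>j. i - j"]) auto
    also have "\<dots> = (\<Sum>d<Suc i. r ^ d) - 1"
      by (simp add: sum.atLeast_Suc_lessThan flip: atLeast0LessThan)
    finally show ?thesis using geom[of "Suc i"] geom[of "m - i"] by linarith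
  qed
  then have "(\<Sum>i<m. \<Sum>j<m. r ^ (if i \<le> j then j - i else i - j)) \<le> (\<Sum>i<m. 4 / (1 - r))"
    by (intro sum_mono) auto
  then show ?thesis by simp
qed

context walk_and_clocks
begin

lemma J_in_cube: "\<omega> \<in> space Q \<Longrightarrow> J k \<omega> \<in> cube n"
  using measurable_space[OF measurable_J, of \<omega> k] by simp

lemma measurable_fun_J [measurable]: "(\<lambda>\<omega>. f (J k \<omega>) :: real) \<in> borel_measurable Q"
  by (rule measurable_compose[OF measurable_J]) simp

lemma measurable_J_eq [measurable]: "(\<lambda>\<omega>. J k \<omega> = x) \<in> measurable Q (count_space UNIV)"
  by (rule measurable_compose[OF measurable_J]) simp

lemma pred_J_mem [measurable]: "(\<lambda>\<omega>. J k \<omega> \<in> B) \<in> measurable Q (count_space UNIV)"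
  by (rule measurable_compose[OF measurable_J]) simp

lemma integrable_fun_J: "integrable Q (\<lambda>\<omega>. f (J i \<omega>) * g (J j \<omega>) :: real)"
proof (rule integrable_const_bound)
  show "AE \<omega> in Q. norm (f (J i \<omega>) * g (J j \<omega>)) \<le> (\<Sum>x\<in>cube n. \<bar>f x\<bar>) * (\<Sum>x\<in>cube n. \<bar>g x\<bar>)"
    by (intro AE_I2, unfold real_norm_def abs_mult, intro mult_mono member_le_sum)
       (auto intro: J_in_cube sum_nonneg)
qed measurable

lemma integrable_fun_J1: "integrable Q (\<lambda>\<omega>. f (J i \<omega>) :: real)"
  using integrable_fun_J[of f i "\<lambda>_. 1" 0] by simp

lemma expectation_pair:
  fixes f g :: "vertex \<Rightarrow> real"
  shows "expectation (\<lambda>\<omega>. f (J i \<omega>) * g (J j \<omega>))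
    = (\<Sum>x\<in>cube n. \<Sum>y\<in>cube n. f x * g y * prob {\<omega> \<in> space Q. J i \<omega> = x \<and> J j \<omega> = y})"
proof -
  have "expectation (\<lambda>\<omega>. f (J i \<omega>) * g (J j \<omega>)) = expectation (\<lambda>\<omega>. \<Sum>x\<in>cube n. \<Sum>y\<in>cube n.
      f x * g y * indicator {\<omega> \<in> space Q. J i \<omega> = x \<and> J j \<omega> = y} \<omega>)"
  proof (rule Bochner_Integration.integral_cong[OF refl])
    fix \<omega> assume \<omega>: "\<omega> \<in> space Q"
    have "(\<Sum>x\<in>cube n. \<Sum>y\<in>cube n. f x * g y * indicator {\<omega> \<in> space Q. J i \<omega> = x \<and> J j \<omega> = y} \<omega>)
      = (\<Sum>x\<in>cube n. if x = J i \<omega> then (\<Sum>y\<in>cube n. if y = J j \<omega> then f x * g y else 0) else 0)"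
      using \<omega> by (intro sum.cong refl) (auto intro!: sum.cong sum.neutral simp: indicator_def)
    also have "\<dots> = f (J i \<omega>) * g (J j \<omega>)"
      using J_in_cube[OF \<omega>] by (simp add: sum.delta)
    finally show "f (J i \<omega>) * g (J j \<omega>)
      = (\<Sum>x\<in>cube n. \<Sum>y\<in>cube n. f x * g y * indicator {\<omega> \<in> space Q. J i \<omega> = x \<and> J j \<omega> = y} \<omega>)" ..
  qed
  also have "\<dots> = (\<Sum>x\<in>cube n. \<Sum>y\<in>cube n. f x * g y * prob {\<omega> \<in> space Q. J i \<omega> = x \<and> J j \<omega> = y})"
    by (subst Bochner_Integration.integral_sum, (intro Bochner_Integration.integrable_sum)?, simp add: emeasure_eq_measure)+
       (simp add: Int_absorb1)
  finally show ?thesis .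
qed

text \<open>The Markov assumption speaks only of complete paths from time 0. A transition from the
  pair of positions at times i and k is obtained by summing over all paths up to time k with these
  two positions.\<close>

lemma prob_path_step:
  assumes ik: "i \<le> k" and x: "x \<in> cube n" and y: "y \<in> cube n" and z: "z \<in> cube n"
  shows "prob {\<omega> \<in> space Q. J i \<omega> = x \<and> J k \<omega> = y \<and> J (Suc k) \<omega> = z}
    = prob {\<omega> \<in> space Q. J i \<omega> = x \<and> J k \<omega> = y} * trans_prob n y z"
proof -
  \<comment> \<open>Paths are extensional on {..k}: there are finitely many, and each is determined
    by its values there, so distinct paths give disjoint events.\<close>
  define Y where "Y = {p \<in> {..k} \<rightarrow>\<^sub>E cube n. p i = x \<and> p k = y}"
  have finY: "finite Y" unfolding Y_def by (rule finite_subset[OF _ finite_PiE[of "{..k}" "\<lambda>_. cube n"]]) auto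
  have restr: "restrict (\<lambda>j. J j \<omega>) {..k} \<in> {..k} \<rightarrow>\<^sub>E cube n" if "\<omega> \<in> space Q" for \<omega>
    using J_in_cube[OF that] by auto
  have eq1: "{\<omega> \<in> space Q. J i \<omega> = x \<and> J k \<omega> = y} = (\<Union>p\<in>Y. {\<omega> \<in> space Q. \<forall>j\<le>k. J j \<omega> = p j})"
  proof (intro equalityI subsetI)
    fix \<omega> assume "\<omega> \<in> {\<omega> \<in> space Q. J i \<omega> = x \<and> J k \<omega> = y}"
    then show "\<omega> \<in> (\<Union>p\<in>Y. {\<omega> \<in> space Q. \<forall>j\<le>k. J j \<omega> = p j})"
      using restr[of \<omega>] ik by (intro UN_I[of "restrict (\<lambda>j. J j \<omega>) {..k}"]) (auto simp: Y_def)
  qed (use ik in \<open>auto simp: Y_def\<close>)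
  have eq2: "{\<omega> \<in> space Q. J i \<omega> = x \<and> J k \<omega> = y \<and> J (Suc k) \<omega> = z}
      = (\<Union>p\<in>Y. {\<omega> \<in> space Q. \<forall>j\<le>Suc k. J j \<omega> = (p(Suc k := z)) j})"
  proof (intro equalityI subsetI)
    fix \<omega> assume "\<omega> \<in> {\<omega> \<in> space Q. J i \<omega> = x \<and> J k \<omega> = y \<and> J (Suc k) \<omega> = z}"
    then show "\<omega> \<in> (\<Union>p\<in>Y. {\<omega> \<in> space Q. \<forall>j\<le>Suc k. J j \<omega> = (p(Suc k := z)) j})"
      using restr[of \<omega>] ik by (intro UN_I[of "restrict (\<lambda>j. J j \<omega>) {..k}"]) (auto simp: Y_def le_Suc_eq)
  next
    fix \<omega> assume "\<omega> \<in> (\<Union>p\<in>Y. {\<omega> \<in> space Q. \<forall>j\<le>Suc k. J j \<omega> = (p(Suc k := z)) j})"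
    then obtain p where p: "p \<in> Y" "\<omega> \<in> space Q" and *: "\<And>j. j \<le> Suc k \<Longrightarrow> J j \<omega> = (p(Suc k := z)) j" by auto
    then show "\<omega> \<in> {\<omega> \<in> space Q. J i \<omega> = x \<and> J k \<omega> = y \<and> J (Suc k) \<omega> = z}"
      using *[of i] *[of k] *[of "Suc k"] ik by (auto simp: Y_def)
  qed
  have disj: "p = q" if "p \<in> Y" "q \<in> Y" "\<And>j. j \<le> k \<Longrightarrow> p j = q j" for p q
    using that unfolding Y_def by (intro PiE_ext[of p "{..k}" "\<lambda>_. cube n" q]) auto
  have "prob {\<omega> \<in> space Q. J i \<omega> = x \<and> J k \<omega> = y \<and> J (Suc k) \<omega> = z}
      = (\<Sum>p\<in>Y. prob {\<omega> \<in> space Q. \<forall>j\<le>Suc k. J j \<omega> = (p(Suc k := z)) j})"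
    unfolding eq2
  proof (rule finite_measure_finite_Union[OF finY])
    show "(\<lambda>p. {\<omega> \<in> space Q. \<forall>j\<le>Suc k. J j \<omega> = (p(Suc k := z)) j}) ` Y \<subseteq> events" by auto
    have False if pq: "p \<in> Y" "q \<in> Y" "p \<noteq> q" and p: "\<forall>j\<le>Suc k. J j \<omega> = (p(Suc k := z)) j"
       and q: "\<forall>j\<le>Suc k. J j \<omega> = (q(Suc k := z)) j" for p q \<omega>
    proof -
      have "p j = q j" if "j \<le> k" for j
      proof -
        have "j \<noteq> Suc k" "j \<le> Suc k" using that by auto
        then show ?thesis using p q by (metis fun_upd_other)
      qed
      then show False using disj pq by blast
    qed
    then show "disjoint_family_on (\<lambda>p. {\<omega> \<in> space Q. \<forall>j\<le>Suc k. J j \<omega> = (p(Suc k := z)) j}) Y"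
      by (auto simp: disjoint_family_on_def simp del: fun_upd_apply)
  qed
  also have "\<dots> = (\<Sum>p\<in>Y. prob {\<omega> \<in> space Q. \<forall>j\<le>k. J j \<omega> = p j} * trans_prob n y z)"
  proof (rule sum.cong[OF refl])
    fix p assume p: "p \<in> Y"
    have "prob {\<omega> \<in> space Q. \<forall>j\<le>Suc k. J j \<omega> = (p(Suc k := z)) j}
      = prob {\<omega> \<in> space Q. \<forall>j\<le>k. J j \<omega> = (p(Suc k := z)) j}
        * trans_prob n ((p(Suc k := z)) k) ((p(Suc k := z)) (Suc k))"
      using p z by (intro markov) (auto simp: Y_def PiE_iff)
    moreover have "{\<omega> \<in> space Q. \<forall>j\<le>k. J j \<omega> = (p(Suc k := z)) j} = {\<omega> \<in> space Q. \<forall>j\<le>k. J j \<omega> = p j}"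
      by auto
    moreover have "p k = y" using p by (simp add: Y_def)
    ultimately show "prob {\<omega> \<in> space Q. \<forall>j\<le>Suc k. J j \<omega> = (p(Suc k := z)) j}
      = prob {\<omega> \<in> space Q. \<forall>j\<le>k. J j \<omega> = p j} * trans_prob n y z" by simp
  qed
  also have "\<dots> = prob {\<omega> \<in> space Q. J i \<omega> = x \<and> J k \<omega> = y} * trans_prob n y z"
    unfolding eq1 sum_distrib_right[symmetric]
  proof (rule arg_cong2[where f="(*)", OF finite_measure_finite_Union[OF finY, symmetric] refl])
    show "(\<lambda>p. {\<omega> \<in> space Q. \<forall>j\<le>k. J j \<omega> = p j}) ` Y \<subseteq> events" by auto
    have False if pq: "p \<in> Y" "q \<in> Y" "p \<noteq> q" and p: "\<forall>j\<le>k. J j \<omega> = p j" and q: "\<forall>j\<le>k. J j \<omega> = q j" for p q \<omega>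
      using disj[OF pq(1,2)] p q pq(3) by auto
    then show "disjoint_family_on (\<lambda>p. {\<omega> \<in> space Q. \<forall>j\<le>k. J j \<omega> = p j}) Y"
      by (auto simp: disjoint_family_on_def)
  qed
  finally show ?thesis .
qed

text \<open>The Markov property in the only form that second moments require: the later of two times
  moves back by one step at the price of applying \<open>step_mean\<close>.\<close>

lemma expectation_step:
  assumes ik: "i \<le> k"
  shows "expectation (\<lambda>\<omega>. f (J i \<omega>) * g (J (Suc k) \<omega>))
    = expectation (\<lambda>\<omega>. f (J i \<omega>) * step_mean n g (J k \<omega>))"
proof -
  have pair: "prob {\<omega> \<in> space Q. J i \<omega> = x \<and> J (Suc k) \<omega> = z}
    = (\<Sum>y\<in>cube n. prob {\<omega> \<in> space Q. J i \<omega> = x \<and> J k \<omega> = y} * trans_prob n y z)"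
    if x: "x \<in> cube n" and z: "z \<in> cube n" for x z
  proof -
    have "{\<omega> \<in> space Q. J i \<omega> = x \<and> J (Suc k) \<omega> = z}
       = (\<Union>y\<in>cube n. {\<omega> \<in> space Q. J i \<omega> = x \<and> J k \<omega> = y \<and> J (Suc k) \<omega> = z})"
      using J_in_cube by auto
    then have "prob {\<omega> \<in> space Q. J i \<omega> = x \<and> J (Suc k) \<omega> = z}
      = (\<Sum>y\<in>cube n. prob {\<omega> \<in> space Q. J i \<omega> = x \<and> J k \<omega> = y \<and> J (Suc k) \<omega> = z})"
      by (simp only:, intro finite_measure_finite_Union) (auto simp: disjoint_family_on_def)
    then show ?thesis by (simp add: prob_path_step[OF ik x _ z])
  qed
  have "expectation (\<lambda>\<omega>. f (J i \<omega>) * g (J (Suc k) \<omega>))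
    = (\<Sum>x\<in>cube n. \<Sum>z\<in>cube n. \<Sum>y\<in>cube n. f x * g z * (prob {\<omega> \<in> space Q. J i \<omega> = x \<and> J k \<omega> = y} * trans_prob n y z))"
    unfolding expectation_pair by (intro sum.cong refl) (simp add: pair sum_distrib_left)
  also have "\<dots> = (\<Sum>x\<in>cube n. \<Sum>y\<in>cube n. \<Sum>z\<in>cube n. f x * g z * (prob {\<omega> \<in> space Q. J i \<omega> = x \<and> J k \<omega> = y} * trans_prob n y z))"
    by (intro sum.cong refl sum.swap)
  also have "\<dots> = expectation (\<lambda>\<omega>. f (J i \<omega>) * step_mean n g (J k \<omega>))"
    unfolding expectation_pair[of f i "step_mean n g" k]
    by (intro sum.cong refl) (simp add: step_mean_def sum_distrib_left sum_distrib_right mult_ac)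
  finally show ?thesis .
qed

context
  assumes n: "n \<ge> 1"
begin

lemma expectation_J: "expectation (\<lambda>\<omega>. f (J k \<omega>)) = cube_avg n f"
proof (induction k arbitrary: f)
  case 0
  have "expectation (\<lambda>\<omega>. f (J 0 \<omega>) * 1)
      = (\<Sum>x\<in>cube n. \<Sum>y\<in>cube n. if y = x then f x * (1 / 2 ^ n) else 0)"
    unfolding expectation_pair[of f 0 "\<lambda>_. 1" 0]
  proof (intro sum.cong refl)
    fix x y assume x: "x \<in> cube n"
    show "f x * 1 * prob {\<omega> \<in> space Q. J 0 \<omega> = x \<and> J 0 \<omega> = y} = (if y = x then f x * (1 / 2 ^ n) else 0)"
    proof (cases "y = x")
      case False
      then have "{\<omega> \<in> space Q. J 0 \<omega> = x \<and> J 0 \<omega> = y} = {}" by auto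
      then show ?thesis using False by (simp only: measure_empty) simp
    qed (simp add: uniform_start[OF x])
  qed
  also have "\<dots> = cube_avg n f" by (simp add: cube_avg_def sum_divide_distrib)
  finally show ?case by simp
next
  case (Suc k)
  have "expectation (\<lambda>\<omega>. f (J (Suc k) \<omega>)) = expectation (\<lambda>\<omega>. step_mean n f (J k \<omega>))"
    using expectation_step[of 0 k "\<lambda>_. 1" f] by simp
  then show ?case by (simp add: Suc cube_avg_step_mean[OF n])
qed

text \<open>Moving the later time back to i one step at a time extracts one eigenvalue per step; at
  equal times stationarity leaves the Walsh coefficient.\<close>

lemma expectation_J_walsh:
  assumes A: "A \<subseteq> {..<n}"
  shows "expectation (\<lambda>\<omega>. f (J i \<omega>) * walsh A (J (i + d) \<omega>)) = walsh_eigenvalue n A ^ d * walsh_coeff n f A"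
proof (induction d)
  case 0
  then show ?case using expectation_J[of "\<lambda>x. f x * walsh A x" i] by (simp add: walsh_coeff_def)
next
  case (Suc d)
  have "expectation (\<lambda>\<omega>. f (J i \<omega>) * walsh A (J (i + Suc d) \<omega>))
      = expectation (\<lambda>\<omega>. f (J i \<omega>) * step_mean n (walsh A) (J (i + d) \<omega>))"
    using expectation_step[of i "i + d" f "walsh A"] by simp
  also have "\<dots> = expectation (\<lambda>\<omega>. walsh_eigenvalue n A * (f (J i \<omega>) * walsh A (J (i + d) \<omega>)))"
    by (intro Bochner_Integration.integral_cong refl) (simp add: step_mean_walsh[OF J_in_cube A n])
  finally show ?case by (simp add: Suc)
qed

lemma expectation_J_product:
  "expectation (\<lambda>\<omega>. f (J i \<omega>) * f (J (i + d) \<omega>))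
    = (\<Sum>A\<in>Pow {..<n}. walsh_eigenvalue n A ^ d * (walsh_coeff n f A)\<^sup>2)"
proof -
  have "expectation (\<lambda>\<omega>. f (J i \<omega>) * f (J (i + d) \<omega>))
    = expectation (\<lambda>\<omega>. \<Sum>A\<in>Pow {..<n}. walsh_coeff n f A * (f (J i \<omega>) * walsh A (J (i + d) \<omega>)))"
    by (intro Bochner_Integration.integral_cong refl)
       (subst (2) walsh_expansion[OF J_in_cube], auto simp: sum_distrib_left mult_ac)
  also have "\<dots> = (\<Sum>A\<in>Pow {..<n}. walsh_coeff n f A * expectation (\<lambda>\<omega>. f (J i \<omega>) * walsh A (J (i + d) \<omega>)))"
    by (subst Bochner_Integration.integral_sum) (auto intro!: integrable_mult_right integrable_fun_J)
  also have "\<dots> = (\<Sum>A\<in>Pow {..<n}. walsh_eigenvalue n A ^ d * (walsh_coeff n f A)\<^sup>2)"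
    by (intro sum.cong refl) (simp add: expectation_J_walsh power2_eq_square)
  finally show ?thesis .
qed

text \<open>Centring kills the coefficient at the empty set and no other. The correlations are then
  combinations of powers of eigenvalues below 1 with exponent |i - j|, and their double sums grow
  linearly in m at the rate \<open>spectral_weight\<close>.\<close>

lemma second_moment_sum_J:
  "expectation (\<lambda>\<omega>. ((\<Sum>i<m. f (J i \<omega>)) - m * cube_avg n f)\<^sup>2) \<le> m * asymp_var n f"
proof -
  define f0 where "f0 x = f x - cube_avg n f" for x
  have coeff0: "walsh_coeff n f0 {} = 0"
    by (simp add: walsh_coeff_def f0_def cube_avg_def sum_subtractf diff_divide_distrib)
  have coeff: "walsh_coeff n f0 A = walsh_coeff n f A" if "A \<in> nontrivial n" for A
    unfolding f0_def by (rule walsh_coeff_diff_const[OF that])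
  have corr: "expectation (\<lambda>\<omega>. f0 (J i \<omega>) * f0 (J j \<omega>))
     = (\<Sum>A\<in>nontrivial n. walsh_eigenvalue n A ^ (if i \<le> j then j - i else i - j) * (walsh_coeff n f A)\<^sup>2)" for i j
  proof -
    have *: "(\<Sum>A\<in>Pow {..<n}. walsh_eigenvalue n A ^ d * (walsh_coeff n f0 A)\<^sup>2)
       = (\<Sum>A\<in>nontrivial n. walsh_eigenvalue n A ^ d * (walsh_coeff n f A)\<^sup>2)" for d
      unfolding nontrivial_def
      by (subst sum.remove[of _ "{}"]) (auto simp: coeff0 coeff nontrivial_def intro!: sum.cong)
    show ?thesis
    proof (cases "i \<le> j")
      case True
      then show ?thesis using expectation_J_product[of f0 i "j - i"] by (simp add: *)
    next
      case False
      then show ?thesis using expectation_J_product[of f0 j "i - j"] by (simp add: * mult.commute)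
    qed
  qed
  have "expectation (\<lambda>\<omega>. ((\<Sum>i<m. f (J i \<omega>)) - m * cube_avg n f)\<^sup>2)
     = expectation (\<lambda>\<omega>. \<Sum>i<m. \<Sum>j<m. f0 (J i \<omega>) * f0 (J j \<omega>))"
    by (simp add: f0_def sum_subtractf power2_eq_square sum_product flip: sum_product)
  also have "\<dots> = (\<Sum>i<m. \<Sum>j<m. expectation (\<lambda>\<omega>. f0 (J i \<omega>) * f0 (J j \<omega>)))"
    by (simp add: Bochner_Integration.integral_sum Bochner_Integration.integrable_sum integrable_fun_J)
  also have "\<dots> = (\<Sum>A\<in>nontrivial n. (\<Sum>i<m. \<Sum>j<m. walsh_eigenvalue n A ^ (if i \<le> j then j - i else i - j))
      * (walsh_coeff n f A)\<^sup>2)"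
    unfolding corr sum_distrib_right
    by (simp only: sum.swap[of _ "{..<m}" "nontrivial n"])
  also have "\<dots> \<le> (\<Sum>A\<in>nontrivial n. (real m * spectral_weight n A) * (walsh_coeff n f A)\<^sup>2)"
  proof (intro sum_mono mult_right_mono)
    fix A assume A: "A \<in> nontrivial n"
    have "4 / (1 - walsh_eigenvalue n A) = spectral_weight n A"
      using nontrivialD[OF A] by (simp add: walsh_eigenvalue_def spectral_weight_def)
    then show "(\<Sum>i<m. \<Sum>j<m. walsh_eigenvalue n A ^ (if i \<le> j then j - i else i - j)) \<le> real m * spectral_weight n A"
      using sum_abs_diff_power_le[OF walsh_eigenvalue_bounds[OF A], of m] by simp
  qed auto
  finally show ?thesis by (simp add: asymp_var_def sum_distrib_left mult.assoc)
qed

lemma integrable_sum_J_sq: "integrable Q (\<lambda>\<omega>. ((\<Sum>i<m. f (J i \<omega>)) - k)\<^sup>2 :: real)"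
proof (rule integrable_const_bound[of _ "(m * (\<Sum>x\<in>cube n. \<bar>f x\<bar>) + \<bar>k\<bar>)\<^sup>2"])
  show "AE \<omega> in Q. norm (((\<Sum>i<m. f (J i \<omega>)) - k)\<^sup>2) \<le> (m * (\<Sum>x\<in>cube n. \<bar>f x\<bar>) + \<bar>k\<bar>)\<^sup>2"
  proof (intro AE_I2)
    fix \<omega> assume \<omega>: "\<omega> \<in> space Q"
    have "\<bar>\<Sum>i<m. f (J i \<omega>)\<bar> \<le> (\<Sum>i<m. \<Sum>x\<in>cube n. \<bar>f x\<bar>)"
      by (rule order_trans[OF sum_abs], rule sum_mono, rule member_le_sum) (auto intro: J_in_cube[OF \<omega>])
    then have "\<bar>(\<Sum>i<m. f (J i \<omega>)) - k\<bar> \<le> \<bar>m * (\<Sum>x\<in>cube n. \<bar>f x\<bar>) + \<bar>k\<bar>\<bar>" by simp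
    then have "((\<Sum>i<m. f (J i \<omega>)) - k)\<^sup>2 \<le> (m * (\<Sum>x\<in>cube n. \<bar>f x\<bar>) + \<bar>k\<bar>)\<^sup>2"
      by (simp only: abs_le_square_iff)
    then show "norm (((\<Sum>i<m. f (J i \<omega>)) - k)\<^sup>2) \<le> (m * (\<Sum>x\<in>cube n. \<bar>f x\<bar>) + \<bar>k\<bar>)\<^sup>2"
      by simp
  qed
qed measurable

end

end

section \<open>Fluctuations caused by the exponential waiting times\<close>

context walk_and_clocks
begin

lemma e_moments:
  "integrable Q (\<lambda>\<omega>. e i \<omega> - 1)" "expectation (\<lambda>\<omega>. e i \<omega> - 1) = 0"
  "integrable Q (\<lambda>\<omega>. (e i \<omega> - 1)\<^sup>2)" "expectation (\<lambda>\<omega>. (e i \<omega> - 1)\<^sup>2) = 1"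
proof -
  have 1: "integrable Q (e i)" and 2: "integrable Q (\<lambda>\<omega>. (e i \<omega>)\<^sup>2)"
    using erlang_ith_moment_integrable[OF _ exponential_e, of i 1] erlang_ith_moment_integrable[OF _ exponential_e, of i 2]
    by auto
  have exp: "expectation (e i) = 1"
    using exponential_distributed_expectation[OF _ exponential_e] by simp
  show "integrable Q (\<lambda>\<omega>. e i \<omega> - 1)" "expectation (\<lambda>\<omega>. e i \<omega> - 1) = 0"
    using 1 exp by (auto simp: prob_space)
  have "(\<lambda>\<omega>. (e i \<omega> - 1)\<^sup>2) = (\<lambda>\<omega>. (e i \<omega>)\<^sup>2 - 2 * e i \<omega> + 1)"
    by (auto simp: power2_eq_square algebra_simps)
  then show "integrable Q (\<lambda>\<omega>. (e i \<omega> - 1)\<^sup>2)" using 1 2 by simp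
  show "expectation (\<lambda>\<omega>. (e i \<omega> - 1)\<^sup>2) = 1"
    using exponential_distributed_variance[OF _ exponential_e, of i] exp by simp
qed

lemma measurable_e [measurable]: "e i \<in> borel_measurable Q"
  using indep_e by (auto simp: indep_vars_def)

lemma AE_e_nonneg: "AE \<omega> in Q. 0 \<le> e i \<omega>"
  by (subst distributed_AE2[OF exponential_e]) (auto simp: erlang_density_def)

lemma e_product:
  "integrable Q (\<lambda>\<omega>. (e i \<omega> - 1) * (e j \<omega> - 1))"
  "expectation (\<lambda>\<omega>. (e i \<omega> - 1) * (e j \<omega> - 1)) = (if i = j then 1 else 0)"
proof -
  have "integrable Q (\<lambda>\<omega>. (e i \<omega> - 1) * (e j \<omega> - 1)) \<and>
    expectation (\<lambda>\<omega>. (e i \<omega> - 1) * (e j \<omega> - 1)) = (if i = j then 1 else 0)"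
  proof (cases "i = j")
    case True
    then show ?thesis using e_moments(3,4)[of j] by (simp add: power2_eq_square)
  next
    case False
    have "indep_vars (\<lambda>_. borel) (\<lambda>i \<omega>. e i \<omega> - 1) {i, j}"
      by (rule indep_vars_compose2[OF indep_vars_subset[OF indep_e]]) auto
    then have ind: "indep_var borel (\<lambda>\<omega>. e i \<omega> - 1) borel (\<lambda>\<omega>. e j \<omega> - 1)"
      using indep_vars_sum[of "{j}" i "\<lambda>i \<omega>. e i \<omega> - 1"] False by (simp add: insert_commute)
    show ?thesis
      using indep_var_lebesgue_integral[OF ind e_moments(1,1)] indep_var_integrable[OF ind e_moments(1,1)]
        False e_moments(2) by simp
  qed
  then show "integrable Q (\<lambda>\<omega>. (e i \<omega> - 1) * (e j \<omega> - 1))"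
    "expectation (\<lambda>\<omega>. (e i \<omega> - 1) * (e j \<omega> - 1)) = (if i = j then 1 else 0)" by auto
qed

text \<open>Independence of walk and clocks is assumed for the sigma-algebras of the whole
  sequences. Measurable functionals of these sequences generate smaller sigma-algebras, so they
  inherit it.\<close>

lemma indep_walk_clocks:
  fixes u v :: "'v \<Rightarrow> real"
  assumes u: "u = (\<lambda>\<omega>. u' (\<lambda>k. J k \<omega>))" "u' \<in> borel_measurable (PiM UNIV (\<lambda>_. count_space (cube n)))"
    and v: "v = (\<lambda>\<omega>. v' (\<lambda>i. e i \<omega>))" "v' \<in> borel_measurable (PiM UNIV (\<lambda>_. borel))"
  shows "indep_var borel u borel v"
proof -
  let ?J = "vimage_algebra (space Q) (\<lambda>\<omega> k. J k \<omega>) (PiM UNIV (\<lambda>_. count_space (cube n)))"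
  let ?e = "vimage_algebra (space Q) (\<lambda>\<omega> i. e i \<omega>) (PiM UNIV (\<lambda>_. borel))"
  have mJ: "(\<lambda>\<omega> k. J k \<omega>) \<in> measurable Q (PiM UNIV (\<lambda>_. count_space (cube n)))"
    by (rule measurable_PiM_single') (auto simp: J_in_cube measurable_J)
  have me: "(\<lambda>\<omega> i. e i \<omega>) \<in> measurable Q (PiM UNIV (\<lambda>_. borel))"
    by (rule measurable_PiM_single') auto
  have uJ: "u \<in> borel_measurable ?J" unfolding u(1)
    by (rule measurable_compose[OF measurable_vimage_algebra1 u(2)])
       (use measurable_space[OF mJ] in auto)
  have ve: "v \<in> borel_measurable ?e" unfolding v(1)
    by (rule measurable_compose[OF measurable_vimage_algebra1 v(2)])
       (use measurable_space[OF me] in auto)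
  have "u \<in> borel_measurable Q" unfolding u(1) by (rule measurable_compose[OF mJ u(2)])
  moreover have "v \<in> borel_measurable Q" unfolding v(1) by (rule measurable_compose[OF me v(2)])
  moreover have "sigma_sets (space Q) {u -` A \<inter> space Q |A. A \<in> sets borel} \<subseteq> sets ?J"
    using sets.sigma_sets_subset[of "{u -` A \<inter> space Q |A. A \<in> sets borel}" ?J] measurable_sets[OF uJ] by auto
  moreover have "sigma_sets (space Q) {v -` A \<inter> space Q |A. A \<in> sets borel} \<subseteq> sets ?e"
    using sets.sigma_sets_subset[of "{v -` A \<inter> space Q |A. A \<in> sets borel}" ?e] measurable_sets[OF ve] by auto
  ultimately show ?thesis
    unfolding indep_var_eq indep_set_def
    by (intro conjI indep_sets_mono_sets[OF indep_J_e[unfolded indep_set_def]]) (simp_all split: bool.split)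
qed

text \<open>The walk factor and the clock factor separate by independence; the clock factor has mean
  zero off the diagonal and mean 1, the variance of the exponential law, on it. The noise terms are
  therefore orthogonal whatever the correlations of the walk.\<close>

lemma clock_noise_product:
  "integrable Q (\<lambda>\<omega>. (f (J i \<omega>) * (e i \<omega> - 1)) * (f (J j \<omega>) * (e j \<omega> - 1)))"
  "expectation (\<lambda>\<omega>. (f (J i \<omega>) * (e i \<omega> - 1)) * (f (J j \<omega>) * (e j \<omega> - 1)))
    = (if i = j then expectation (\<lambda>\<omega>. (f (J i \<omega>))\<^sup>2) else 0)"
proof -
  have "indep_var borel (\<lambda>\<omega>. f (J i \<omega>) * f (J j \<omega>)) borel (\<lambda>\<omega>. (e i \<omega> - 1) * (e j \<omega> - 1))"
    by (rule indep_walk_clocks[of _ "\<lambda>p. f (p i) * f (p j)" _ "\<lambda>s. (s i - 1) * (s j - 1)"])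
       (auto intro!: borel_measurable_times measurable_compose[OF measurable_component_singleton])
  note ind = this integrable_fun_J e_product(1)
  show "integrable Q (\<lambda>\<omega>. (f (J i \<omega>) * (e i \<omega> - 1)) * (f (J j \<omega>) * (e j \<omega> - 1)))"
    using indep_var_integrable[OF ind] by (simp add: mult_ac)
  show "expectation (\<lambda>\<omega>. (f (J i \<omega>) * (e i \<omega> - 1)) * (f (J j \<omega>) * (e j \<omega> - 1)))
    = (if i = j then expectation (\<lambda>\<omega>. (f (J i \<omega>))\<^sup>2) else 0)"
    using indep_var_lebesgue_integral[OF ind] by (simp add: mult_ac e_product(2) power2_eq_square)
qed

context
  assumes n: "n \<ge> 1"
begin

lemma second_moment_clock_noise:
  "integrable Q (\<lambda>\<omega>. (\<Sum>i<m. f (J i \<omega>) * (e i \<omega> - 1))\<^sup>2)"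
  "expectation (\<lambda>\<omega>. (\<Sum>i<m. f (J i \<omega>) * (e i \<omega> - 1))\<^sup>2) = m * cube_avg n (\<lambda>x. (f x)\<^sup>2)"
proof -
  have eq: "(\<lambda>\<omega>. (\<Sum>i<m. f (J i \<omega>) * (e i \<omega> - 1))\<^sup>2) =
      (\<lambda>\<omega>. \<Sum>i<m. \<Sum>j<m. (f (J i \<omega>) * (e i \<omega> - 1)) * (f (J j \<omega>) * (e j \<omega> - 1)))"
    by (simp add: power2_eq_square sum_product)
  show "integrable Q (\<lambda>\<omega>. (\<Sum>i<m. f (J i \<omega>) * (e i \<omega> - 1))\<^sup>2)"
    unfolding eq by (intro Bochner_Integration.integrable_sum clock_noise_product)
  show "expectation (\<lambda>\<omega>. (\<Sum>i<m. f (J i \<omega>) * (e i \<omega> - 1))\<^sup>2) = m * cube_avg n (\<lambda>x. (f x)\<^sup>2)"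
    unfolding eq
    by (simp add: Bochner_Integration.integral_sum Bochner_Integration.integrable_sum clock_noise_product
        expectation_J[OF n, of "\<lambda>x. (f x)\<^sup>2"])
qed

text \<open>A union bound over time together with stationarity; it excludes visits to vertices
  beyond the truncation level.\<close>

lemma prob_visit_le:
  fixes B :: "vertex set" and m :: nat
  shows "prob {\<omega> \<in> space Q. \<exists>i<m. J i \<omega> \<in> B} \<le> m * cube_avg n (indicator B)"
proof -
  have single: "prob {\<omega> \<in> space Q. J i \<omega> \<in> B} = cube_avg n (indicator B)" for i
  proof -
    have ev: "{\<omega> \<in> space Q. J i \<omega> \<in> B} \<in> events" by measurable
    have "expectation (indicator {\<omega> \<in> space Q. J i \<omega> \<in> B}) = expectation (\<lambda>\<omega>. indicator B (J i \<omega>) :: real)"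
      by (intro Bochner_Integration.integral_cong refl) (auto simp: indicator_def)
    also have "\<dots> = cube_avg n (indicator B)" by (rule expectation_J[OF n])
    finally show ?thesis using ev by (simp add: Int_absorb2 sets.sets_into_space)
  qed
  have "prob {\<omega> \<in> space Q. \<exists>i<m. J i \<omega> \<in> B} = prob (\<Union>i<m. {\<omega> \<in> space Q. J i \<omega> \<in> B})"
    by (intro arg_cong[where f=prob]) auto
  also have "\<dots> \<le> (\<Sum>i<m. prob {\<omega> \<in> space Q. J i \<omega> \<in> B})"
    by (rule finite_measure_subadditive_finite) auto
  also have "\<dots> = m * cube_avg n (indicator B)" by (simp add: single)
  finally show ?thesis .
qed

lemma prob_sum_J_deviation:
  assumes "\<delta> > 0"
  shows "prob {\<omega> \<in> space Q. \<delta> \<le> \<bar>(\<Sum>i<m. f (J i \<omega>)) - m * cube_avg n f\<bar>} \<le> m * asymp_var n f / \<delta>\<^sup>2"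
proof (rule order_trans)
  show "prob {\<omega> \<in> space Q. \<delta> \<le> \<bar>(\<Sum>i<m. f (J i \<omega>)) - m * cube_avg n f\<bar>}
     \<le> expectation (\<lambda>\<omega>. ((\<Sum>i<m. f (J i \<omega>)) - m * cube_avg n f)\<^sup>2) / \<delta>\<^sup>2"
    by (intro second_moment_method integrable_sum_J_sq n assms) measurable
  show "expectation (\<lambda>\<omega>. ((\<Sum>i<m. f (J i \<omega>)) - m * cube_avg n f)\<^sup>2) / \<delta>\<^sup>2 \<le> m * asymp_var n f / \<delta>\<^sup>2"
    by (intro divide_right_mono second_moment_sum_J n) simp
qed

lemma prob_clock_noise_deviation:
  assumes "\<delta> > 0"
  shows "prob {\<omega> \<in> space Q. \<delta> \<le> \<bar>\<Sum>i<m. f (J i \<omega>) * (e i \<omega> - 1)\<bar>} \<le> m * cube_avg n (\<lambda>x. (f x)\<^sup>2) / \<delta>\<^sup>2"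
  unfolding second_moment_clock_noise(2)[symmetric]
  by (intro second_moment_method second_moment_clock_noise assms) measurable

end

end

section \<open>Quadratic forms of independent variables\<close>

lemma asymp_var_diff_const: "asymp_var n (\<lambda>x. f x - k) = asymp_var n f"
  by (simp add: asymp_var_def walsh_coeff_diff_const)

text \<open>The matrix of \<open>asymp_var\<close> in terms of point values, where the environment
  has independent entries. The factor 4 ^ n collects the two normalisations 2 ^ n of the
  coefficients.\<close>

definition asymp_kernel :: "nat \<Rightarrow> vertex \<Rightarrow> vertex \<Rightarrow> real" where
  "asymp_kernel n x y = (\<Sum>A\<in>nontrivial n. spectral_weight n A / 4 ^ n * (walsh A x * walsh A y))"

lemma asymp_kernel_sym: "asymp_kernel n x y = asymp_kernel n y x"
  by (simp add: asymp_kernel_def mult_ac)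

lemma asymp_var_kernel:
  "asymp_var n f = (\<Sum>x\<in>cube n. \<Sum>y\<in>cube n. asymp_kernel n x y * f x * f y)"
proof -
  have "asymp_var n f = (\<Sum>A\<in>nontrivial n. \<Sum>x\<in>cube n. \<Sum>y\<in>cube n.
      spectral_weight n A / 4 ^ n * (walsh A x * walsh A y) * f x * f y)"
    unfolding asymp_var_def
  proof (rule sum.cong[OF refl])
    fix A
    have "(4::real) ^ n = 2 ^ n * 2 ^ n" by (simp flip: power_mult_distrib)
    then have "(walsh_coeff n f A)\<^sup>2 = (\<Sum>x\<in>cube n. f x * walsh A x) * (\<Sum>y\<in>cube n. f y * walsh A y) / 4 ^ n"
      by (simp add: walsh_coeff_def cube_avg_def power2_eq_square)
    then show "spectral_weight n A * (walsh_coeff n f A)\<^sup>2 = (\<Sum>x\<in>cube n. \<Sum>y\<in>cube n.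
      spectral_weight n A / 4 ^ n * (walsh A x * walsh A y) * f x * f y)"
      by (simp add: sum_product sum_distrib_left sum_divide_distrib mult_ac)
  qed
  also have "\<dots> = (\<Sum>x\<in>cube n. \<Sum>y\<in>cube n. \<Sum>A\<in>nontrivial n.
      spectral_weight n A / 4 ^ n * (walsh A x * walsh A y) * f x * f y)"
    by (simp only: sum.swap[of _ "cube n" "nontrivial n"])
  finally show ?thesis by (simp add: asymp_kernel_def sum_distrib_right)
qed

text \<open>Characters square to 1, so the diagonal is constant and equals the total weight divided
  by 4 ^ n.\<close>

lemma asymp_kernel_diag: "x \<in> cube n \<Longrightarrow> asymp_kernel n x x \<le> 48 / 2 ^ n"
proof -
  assume x: "x \<in> cube n"
  have "asymp_kernel n x x = (\<Sum>A\<in>nontrivial n. spectral_weight n A) / 4 ^ n"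
    by (simp add: asymp_kernel_def sum_divide_distrib walsh_sq[OF x nontrivialD(1)])
  also have "\<dots> \<le> 48 * 2 ^ n / 4 ^ n" by (intro divide_right_mono sum_spectral_weight_le) simp
  also have "\<dots> = 48 / 2 ^ n"
  proof -
    have "(4::real) ^ n = 2 ^ n * 2 ^ n" by (simp flip: power_mult_distrib)
    then show ?thesis by simp
  qed
  finally show ?thesis .
qed

text \<open>The squared Hilbert-Schmidt norm of the kernel. By orthogonality of the characters it is
  the sum of the squared weights divided by 4 ^ n.\<close>

lemma asymp_kernel_sq_sum: "(\<Sum>x\<in>cube n. \<Sum>y\<in>cube n. (asymp_kernel n x y)\<^sup>2) \<le> 96 / 2 ^ n"
proof -
  define u where "u A = spectral_weight n A / 4 ^ n" for A
  have four: "(4::real) ^ n = 2 ^ n * 2 ^ n" by (simp flip: power_mult_distrib)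
  have "(\<Sum>x\<in>cube n. \<Sum>y\<in>cube n. (asymp_kernel n x y)\<^sup>2) = (\<Sum>x\<in>cube n. \<Sum>y\<in>cube n.
      \<Sum>A\<in>nontrivial n. \<Sum>B\<in>nontrivial n. u A * u B * (walsh A x * walsh B x) * (walsh A y * walsh B y))"
    unfolding asymp_kernel_def power2_eq_square sum_product u_def by (simp add: mult_ac)
  also have "\<dots> = (\<Sum>A\<in>nontrivial n. \<Sum>B\<in>nontrivial n. \<Sum>x\<in>cube n. \<Sum>y\<in>cube n.
      u A * u B * (walsh A x * walsh B x) * (walsh A y * walsh B y))"
    by (simp only: sum.swap[of _ "nontrivial n" "cube n"])
  also have "\<dots> = (\<Sum>A\<in>nontrivial n. \<Sum>B\<in>nontrivial n.
      u A * u B * (\<Sum>x\<in>cube n. walsh A x * walsh B x) * (\<Sum>y\<in>cube n. walsh A y * walsh B y))"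
    by (simp add: sum_product sum_distrib_left sum_distrib_right mult_ac)
  also have "\<dots> = (\<Sum>A\<in>nontrivial n. \<Sum>B\<in>nontrivial n. if B = A then (u A)\<^sup>2 * 4 ^ n else 0)"
    by (intro sum.cong refl)
       (auto simp: walsh_orthogonal nontrivial_def power2_eq_square four)
  also have "\<dots> = (\<Sum>A\<in>nontrivial n. (spectral_weight n A)\<^sup>2) / 4 ^ n"
    by (simp add: u_def power_divide sum_divide_distrib power2_eq_square)
  also have "\<dots> \<le> 96 * 2 ^ n / 4 ^ n" by (intro divide_right_mono sum_spectral_weight_sq_le) simp
  also have "\<dots> = 96 / 2 ^ n" by (simp add: four)
  finally show ?thesis .
qed

text \<open>The diagonal is controlled for every f by the mean square. Only the off-diagonal part
  needs randomness: it has mean zero when the values are independent and centred.\<close>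

lemma asymp_var_le_offdiag:
  "asymp_var n f \<le> 48 * cube_avg n (\<lambda>x. (f x)\<^sup>2)
    + (\<Sum>x\<in>cube n. \<Sum>y\<in>cube n - {x}. asymp_kernel n x y * f x * f y)"
proof -
  have "asymp_var n f = (\<Sum>x\<in>cube n. asymp_kernel n x x * (f x)\<^sup>2)
    + (\<Sum>x\<in>cube n. \<Sum>y\<in>cube n - {x}. asymp_kernel n x y * f x * f y)"
    unfolding asymp_var_kernel sum.distrib[symmetric]
    by (intro sum.cong refl) (simp add: sum.remove[of "cube n"] power2_eq_square mult.assoc)
  moreover have "(\<Sum>x\<in>cube n. asymp_kernel n x x * (f x)\<^sup>2) \<le> (\<Sum>x\<in>cube n. 48 / 2 ^ n * (f x)\<^sup>2)"
    by (intro sum_mono mult_right_mono asymp_kernel_diag) auto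
  moreover have "(\<Sum>x\<in>cube n. 48 / 2 ^ n * (f x)\<^sup>2) = 48 * cube_avg n (\<lambda>x. (f x)\<^sup>2)"
    by (simp add: cube_avg_def sum_distrib_left sum_divide_distrib)
  ultimately show ?thesis by linarith
qed

text \<open>Boundedness passes to sums and products, so integrability of all the polynomials in the
  environment below comes for free, which it would not for integrable or square integrable
  variables.\<close>

definition bounded_rv :: "'a measure \<Rightarrow> ('a \<Rightarrow> real) \<Rightarrow> bool" where
  "bounded_rv M X \<longleftrightarrow> X \<in> borel_measurable M \<and> (\<exists>K. \<forall>\<omega>\<in>space M. \<bar>X \<omega>\<bar> \<le> K)"

lemma bounded_rv_const [intro, simp]: "bounded_rv M (\<lambda>_. k)"
  by (auto simp: bounded_rv_def)

lemma bounded_rv_add [intro]: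
  assumes "bounded_rv M X" "bounded_rv M Y" shows "bounded_rv M (\<lambda>\<omega>. X \<omega> + Y \<omega>)"
proof -
  obtain K L where "\<forall>\<omega>\<in>space M. \<bar>X \<omega>\<bar> \<le> K" "\<forall>\<omega>\<in>space M. \<bar>Y \<omega>\<bar> \<le> L"
    using assms by (auto simp: bounded_rv_def)
  then have "\<forall>\<omega>\<in>space M. \<bar>X \<omega> + Y \<omega>\<bar> \<le> K + L" by (meson abs_triangle_ineq add_mono order_trans)
  then show ?thesis using assms by (auto simp: bounded_rv_def)
qed

lemma bounded_rv_mult [intro]:
  assumes "bounded_rv M X" "bounded_rv M Y" shows "bounded_rv M (\<lambda>\<omega>. X \<omega> * Y \<omega>)"
proof -
  obtain K L where KL: "\<forall>\<omega>\<in>space M. \<bar>X \<omega>\<bar> \<le> K" "\<forall>\<omega>\<in>space M. \<bar>Y \<omega>\<bar> \<le> L"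
    using assms by (auto simp: bounded_rv_def)
  have "\<bar>X \<omega> * Y \<omega>\<bar> \<le> K * L" if "\<omega> \<in> space M" for \<omega>
    unfolding abs_mult using KL that by (intro mult_mono) (auto intro: order_trans[OF abs_ge_zero])
  then show ?thesis using assms by (auto simp: bounded_rv_def)
qed

lemma bounded_rv_power2 [intro]: "bounded_rv M X \<Longrightarrow> bounded_rv M (\<lambda>\<omega>. (X \<omega>)\<^sup>2)"
  unfolding power2_eq_square by (rule bounded_rv_mult)

lemma bounded_rv_sum [intro]:
  "(\<And>i. i \<in> S \<Longrightarrow> bounded_rv M (X i)) \<Longrightarrow> bounded_rv M (\<lambda>\<omega>. \<Sum>i\<in>S. X i \<omega>)"
  by (induction S rule: infinite_finite_induct) auto

lemma bounded_rv_measurable: "bounded_rv M X \<Longrightarrow> X \<in> borel_measurable M"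
  by (simp add: bounded_rv_def)

section \<open>Sums and quadratic forms of centred independent variables\<close>

context prob_space
begin

lemma bounded_rv_integrable: "bounded_rv M X \<Longrightarrow> integrable M X"
  unfolding bounded_rv_def by (metis AE_I2 integrable_const_bound real_norm_def)

text \<open>The induction step of an exposure argument: the newly exposed variable is independent of
  any function of the variables exposed before.\<close>

lemma indep_one_rest:
  fixes \<phi> :: "real \<Rightarrow> real" and Y :: "'i \<Rightarrow> 'a \<Rightarrow> real"
  assumes z: "z \<notin> S" and ind: "indep_vars (\<lambda>_. borel) Y (insert z S)"
    and \<phi>: "\<phi> \<in> borel_measurable borel" and \<psi>: "\<psi> \<in> borel_measurable (PiM S (\<lambda>_. borel))"
  shows "indep_var borel (\<lambda>\<omega>. \<phi> (Y z \<omega>)) borel (\<lambda>\<omega>. \<psi> (\<lambda>i\<in>S. Y i \<omega>) :: real)"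
proof -
  have "indep_var borel ((\<lambda>p. \<phi> (p z)) \<circ> (\<lambda>\<omega>. \<lambda>i\<in>{z}. Y i \<omega>)) borel (\<psi> \<circ> (\<lambda>\<omega>. \<lambda>i\<in>S. Y i \<omega>))"
    using z by (intro indep_var_compose[OF indep_var_restrict[OF ind]] \<psi> measurable_compose[OF _ \<phi>]) auto
  then show ?thesis by (simp add: comp_def)
qed

lemma expectation_sum_centered_sq:
  fixes Z :: "'i \<Rightarrow> 'a \<Rightarrow> real"
  assumes "finite S" "indep_vars (\<lambda>_. borel) Z S"
    and "\<And>x. x \<in> S \<Longrightarrow> bounded_rv M (Z x)" "\<And>x. x \<in> S \<Longrightarrow> expectation (Z x) = 0"
  shows "expectation (\<lambda>\<omega>. (\<Sum>x\<in>S. Z x \<omega>)\<^sup>2) = (\<Sum>x\<in>S. expectation (\<lambda>\<omega>. (Z x \<omega>)\<^sup>2))"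
  using assms
proof (induction S rule: finite_induct)
  case (insert z S)
  let ?R = "\<lambda>\<omega>. \<Sum>x\<in>S. Z x \<omega>"
  have IH: "expectation (\<lambda>\<omega>. (?R \<omega>)\<^sup>2) = (\<Sum>x\<in>S. expectation (\<lambda>\<omega>. (Z x \<omega>)\<^sup>2))"
    using insert.prems by (intro insert.IH indep_vars_subset[OF insert.prems(1)]) auto
  have bR: "bounded_rv M ?R" and bz: "bounded_rv M (Z z)" using insert.prems by auto
  have "expectation (\<lambda>\<omega>. Z z \<omega> * ?R \<omega>) = expectation (Z z) * expectation ?R"
    by (intro indep_var_lebesgue_integral indep_vars_sum insert bounded_rv_integrable bR bz)
  then have cross: "expectation (\<lambda>\<omega>. Z z \<omega> * ?R \<omega>) = 0" using insert.prems(3) by simp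
  have "expectation (\<lambda>\<omega>. (\<Sum>x\<in>insert z S. Z x \<omega>)\<^sup>2)
      = expectation (\<lambda>\<omega>. (Z z \<omega>)\<^sup>2 + (?R \<omega>)\<^sup>2 + 2 * (Z z \<omega> * ?R \<omega>))"
    using insert.hyps by (simp add: power2_sum mult.assoc)
  also have "\<dots> = expectation (\<lambda>\<omega>. (Z z \<omega>)\<^sup>2) + expectation (\<lambda>\<omega>. (?R \<omega>)\<^sup>2) + 2 * expectation (\<lambda>\<omega>. Z z \<omega> * ?R \<omega>)"
    using bounded_rv_integrable[OF bounded_rv_power2[OF bz]] bounded_rv_integrable[OF bounded_rv_power2[OF bR]]
      bounded_rv_integrable[OF bounded_rv_mult[OF bz bR]] by simp
  finally show ?case using insert.hyps by (simp add: IH cross)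
qed simp

text \<open>Exposing the variables one at a time turns an off-diagonal quadratic form into a sum of
  orthogonal increments.\<close>

lemma expectation_offdiag_form_sq:
  fixes Y :: "'i \<Rightarrow> 'a \<Rightarrow> real" and L :: "'i \<Rightarrow> 'i \<Rightarrow> real"
  assumes "finite S" "indep_vars (\<lambda>_. borel) Y S"
    and "\<And>x. x \<in> S \<Longrightarrow> bounded_rv M (Y x)" "\<And>x. x \<in> S \<Longrightarrow> expectation (Y x) = 0"
    and "\<And>x. x \<in> S \<Longrightarrow> expectation (\<lambda>\<omega>. (Y x \<omega>)\<^sup>2) \<le> v" and L: "\<And>x y. L x y = L y x" and v: "v \<ge> 0"
  shows "expectation (\<lambda>\<omega>. (\<Sum>x\<in>S. \<Sum>y\<in>S - {x}. L x y * Y x \<omega> * Y y \<omega>)\<^sup>2)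
    \<le> 2 * v\<^sup>2 * (\<Sum>x\<in>S. \<Sum>y\<in>S. (L x y)\<^sup>2)"
  using assms(1-5)
proof (induction S rule: finite_induct)
  case (insert z S)
  let ?O = "\<lambda>\<omega>. \<Sum>x\<in>S. \<Sum>y\<in>S - {x}. L x y * Y x \<omega> * Y y \<omega>"
  let ?R = "\<lambda>\<omega>. \<Sum>x\<in>S. L z x * Y x \<omega>"
  have IH: "expectation (\<lambda>\<omega>. (?O \<omega>)\<^sup>2) \<le> 2 * v\<^sup>2 * (\<Sum>x\<in>S. \<Sum>y\<in>S. (L x y)\<^sup>2)"
    using insert.prems by (intro insert.IH indep_vars_subset[OF insert.prems(1)]) auto
  have bY: "bounded_rv M (Y x)" if "x \<in> insert z S" for x using insert.prems that by auto
  have bO: "bounded_rv M ?O" and bR: "bounded_rv M ?R" and bz: "bounded_rv M (Y z)"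
    by (intro bounded_rv_sum bounded_rv_mult bounded_rv_const bY; auto)+
  have form: "(\<Sum>x\<in>insert z S. \<Sum>y\<in>insert z S - {x}. L x y * Y x \<omega> * Y y \<omega>)
     = ?O \<omega> + 2 * (Y z \<omega> * ?R \<omega>)" for \<omega>
  proof -
    have 1: "(\<Sum>y\<in>insert z S - {z}. L z y * Y z \<omega> * Y y \<omega>) = Y z \<omega> * ?R \<omega>"
      unfolding Diff_insert_absorb[OF insert.hyps(2)] sum_distrib_left by (intro sum.cong refl) simp
    have 2: "(\<Sum>y\<in>insert z S - {x}. L x y * Y x \<omega> * Y y \<omega>)
       = L z x * Y x \<omega> * Y z \<omega> + (\<Sum>y\<in>S - {x}. L x y * Y x \<omega> * Y y \<omega>)" if "x \<in> S" for x
    proof -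
      have "insert z S - {x} = insert z (S - {x})" using that insert.hyps by auto
      then show ?thesis using insert.hyps by (simp add: L[of x z])
    qed
    have "(\<Sum>x\<in>insert z S. \<Sum>y\<in>insert z S - {x}. L x y * Y x \<omega> * Y y \<omega>)
      = Y z \<omega> * ?R \<omega> + (\<Sum>x\<in>S. L z x * Y x \<omega> * Y z \<omega> + (\<Sum>y\<in>S - {x}. L x y * Y x \<omega> * Y y \<omega>))"
      unfolding sum.insert[OF insert.hyps(1,2)] 1 by (intro arg_cong2[where f="(+)"] refl sum.cong 2)
    also have "\<dots> = ?O \<omega> + 2 * (Y z \<omega> * ?R \<omega>)"
      by (simp add: sum.distrib sum_distrib_left mult_ac)
    finally show ?thesis .
  qed
  \<comment> \<open>The old form and the row sum depend only on the variables in S. Since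
    \<open>Y z\<close> is centred and independent of them, the cross term has expectation
    zero.\<close>
  have "indep_var borel (\<lambda>\<omega>. Y z \<omega>) borel (\<lambda>\<omega>. (\<lambda>p. (\<Sum>x\<in>S. \<Sum>y\<in>S - {x}. L x y * p x * p y) * (\<Sum>x\<in>S. L z x * p x)) (\<lambda>i\<in>S. Y i \<omega>))"
    by (rule indep_one_rest[OF insert.hyps(2) insert.prems(1), of "\<lambda>x. x"])
       (auto intro!: borel_measurable_times borel_measurable_sum measurable_component_singleton)
  also have "(\<lambda>\<omega>. (\<lambda>p. (\<Sum>x\<in>S. \<Sum>y\<in>S - {x}. L x y * p x * p y) * (\<Sum>x\<in>S. L z x * p x)) (\<lambda>i\<in>S. Y i \<omega>))
      = (\<lambda>\<omega>. ?O \<omega> * ?R \<omega>)"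
    by (auto intro!: ext arg_cong2[where f="(*)"] sum.cong)
  finally have "indep_var borel (Y z) borel (\<lambda>\<omega>. ?O \<omega> * ?R \<omega>)" .
  then have "expectation (\<lambda>\<omega>. Y z \<omega> * (?O \<omega> * ?R \<omega>)) = expectation (Y z) * expectation (\<lambda>\<omega>. ?O \<omega> * ?R \<omega>)"
    by (rule indep_var_lebesgue_integral) (intro bounded_rv_integrable bounded_rv_mult bO bR bz)+
  then have cross: "expectation (\<lambda>\<omega>. Y z \<omega> * (?O \<omega> * ?R \<omega>)) = 0" using insert.prems(3) by simp
  have "indep_var borel (\<lambda>\<omega>. (Y z \<omega>)\<^sup>2) borel (\<lambda>\<omega>. (\<lambda>p. (\<Sum>x\<in>S. L z x * p x)\<^sup>2) (\<lambda>i\<in>S. Y i \<omega>))"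
    by (rule indep_one_rest[OF insert.hyps(2) insert.prems(1)])
       (auto intro!: borel_measurable_times borel_measurable_sum borel_measurable_power measurable_component_singleton)
  then have "indep_var borel (\<lambda>\<omega>. (Y z \<omega>)\<^sup>2) borel (\<lambda>\<omega>. (?R \<omega>)\<^sup>2)" by (simp cong: sum.cong)
  then have sq: "expectation (\<lambda>\<omega>. (Y z \<omega>)\<^sup>2 * (?R \<omega>)\<^sup>2) = expectation (\<lambda>\<omega>. (Y z \<omega>)\<^sup>2) * expectation (\<lambda>\<omega>. (?R \<omega>)\<^sup>2)"
    by (rule indep_var_lebesgue_integral) (intro bounded_rv_integrable bounded_rv_power2 bO bR bz)+
  have "expectation (\<lambda>\<omega>. (?R \<omega>)\<^sup>2) = (\<Sum>x\<in>S. expectation (\<lambda>\<omega>. (L z x * Y x \<omega>)\<^sup>2))"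
  proof (rule expectation_sum_centered_sq)
    show "indep_vars (\<lambda>_. borel) (\<lambda>x \<omega>. L z x * Y x \<omega>) S"
      by (rule indep_vars_compose2[OF indep_vars_subset[OF insert.prems(1)]]) auto
  qed (use insert in auto)
  also have "\<dots> = (\<Sum>x\<in>S. (L z x)\<^sup>2 * expectation (\<lambda>\<omega>. (Y x \<omega>)\<^sup>2))"
    by (simp add: power_mult_distrib)
  also have "\<dots> \<le> (\<Sum>x\<in>S. (L z x)\<^sup>2 * v)"
    using insert.prems by (intro sum_mono mult_left_mono) auto
  finally have R: "expectation (\<lambda>\<omega>. (?R \<omega>)\<^sup>2) \<le> v * (\<Sum>x\<in>S. (L z x)\<^sup>2)" by (simp add: sum_distrib_left mult.commute)
  have "expectation (\<lambda>\<omega>. (\<Sum>x\<in>insert z S. \<Sum>y\<in>insert z S - {x}. L x y * Y x \<omega> * Y y \<omega>)\<^sup>2)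
     = expectation (\<lambda>\<omega>. (?O \<omega>)\<^sup>2 + 4 * (Y z \<omega> * (?O \<omega> * ?R \<omega>)) + 4 * ((Y z \<omega>)\<^sup>2 * (?R \<omega>)\<^sup>2))"
    unfolding form by (intro Bochner_Integration.integral_cong refl) (simp add: power2_eq_square algebra_simps)
  also have "\<dots> = expectation (\<lambda>\<omega>. (?O \<omega>)\<^sup>2) + 4 * (expectation (\<lambda>\<omega>. (Y z \<omega>)\<^sup>2) * expectation (\<lambda>\<omega>. (?R \<omega>)\<^sup>2))"
    using bounded_rv_integrable[OF bounded_rv_power2[OF bO]]
      bounded_rv_integrable[OF bounded_rv_mult[OF bz bounded_rv_mult[OF bO bR]]]
      bounded_rv_integrable[OF bounded_rv_mult[OF bounded_rv_power2[OF bz] bounded_rv_power2[OF bR]]]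
    by (simp add: cross sq)
  also have "\<dots> \<le> 2 * v\<^sup>2 * (\<Sum>x\<in>S. \<Sum>y\<in>S. (L x y)\<^sup>2) + 4 * (v * (v * (\<Sum>x\<in>S. (L z x)\<^sup>2)))"
    using insert.prems(4) v by (intro add_mono IH mult_left_mono mult_mono R) (auto intro!: integral_nonneg)
  \<comment> \<open>The new index adds a row and a column of L. By symmetry they contribute two
    equal sums of squares, which match the coefficient 4 = 2 * 2 of the new increment.\<close>
  also have "\<dots> \<le> 2 * v\<^sup>2 * (\<Sum>x\<in>insert z S. \<Sum>y\<in>insert z S. (L x y)\<^sup>2)"
  proof -
    have "(\<Sum>x\<in>insert z S. \<Sum>y\<in>insert z S. (L x y)\<^sup>2)
      = (L z z)\<^sup>2 + 2 * (\<Sum>x\<in>S. (L z x)\<^sup>2) + (\<Sum>x\<in>S. \<Sum>y\<in>S. (L x y)\<^sup>2)"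
    proof -
      have "(\<Sum>x\<in>S. (L x z)\<^sup>2) = (\<Sum>x\<in>S. (L z x)\<^sup>2)" by (simp only: L[of z])
      then show ?thesis using insert.hyps by (simp add: sum.distrib)
    qed
    then have "2 * (\<Sum>x\<in>S. (L z x)\<^sup>2) + (\<Sum>x\<in>S. \<Sum>y\<in>S. (L x y)\<^sup>2) \<le> (\<Sum>x\<in>insert z S. \<Sum>y\<in>insert z S. (L x y)\<^sup>2)"
      by simp
    then have "2 * v\<^sup>2 * (2 * (\<Sum>x\<in>S. (L z x)\<^sup>2) + (\<Sum>x\<in>S. \<Sum>y\<in>S. (L x y)\<^sup>2))
        \<le> 2 * v\<^sup>2 * (\<Sum>x\<in>insert z S. \<Sum>y\<in>insert z S. (L x y)\<^sup>2)"
      by (rule mult_left_mono) simp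
    then show ?thesis by (simp add: algebra_simps power2_eq_square)
  qed
  finally show ?case .
qed simp

end

text \<open>Written as a Lebesgue integral rather than as an expectation over the environment, so
  that it depends on no vertex and the asymptotic estimates can be made without a probability
  space.\<close>

definition gauss_mean :: "nat \<Rightarrow> (real \<Rightarrow> real) \<Rightarrow> real" where
  "gauss_mean n F = (\<integral>h. normal_density 0 (sqrt n) h * F h \<partial>lborel)"

section \<open>Averages and quadratic forms of the environment\<close>

context random_environment
begin

context
  fixes n :: nat
  assumes n: "n \<ge> 1"
begin

lemma measurable_H: "x \<in> cube n \<Longrightarrow> H n x \<in> borel_measurable P"
  using distributed_measurable[OF gaussian_H[OF n]] by simp

lemma expectation_fun_H:
  assumes "x \<in> cube n" "F \<in> borel_measurable borel"
  shows "expectation (\<lambda>w. F (H n x w)) = gauss_mean n F"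
  unfolding gauss_mean_def
  using distributed_integral[OF gaussian_H[OF n assms(1)], of F] assms(2) by simp

lemma indep_fun_H:
  assumes "F \<in> borel_measurable borel"
  shows "indep_vars (\<lambda>_. borel) (\<lambda>x w. F (H n x w)) (cube n)"
  using indep_vars_compose2[OF indep_H[OF n], of "\<lambda>_. F" "\<lambda>_. borel"] assms by simp

context
  fixes F :: "real \<Rightarrow> real" and K :: real
  assumes F: "F \<in> borel_measurable borel" and K: "\<And>h. \<bar>F h\<bar> \<le> K"
begin

lemma measurable_avg_F: "(\<lambda>w. cube_avg n (\<lambda>x. F (H n x w))) \<in> borel_measurable P"
  unfolding cube_avg_def
  by (intro borel_measurable_divide borel_measurable_sum measurable_compose[OF measurable_H F]) auto

lemma measurable_asymp_var_F: "(\<lambda>w. asymp_var n (\<lambda>x. F (H n x w))) \<in> borel_measurable P"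
  unfolding asymp_var_kernel
  by (intro borel_measurable_sum borel_measurable_times measurable_compose[OF measurable_H F]) auto

lemma bounded_rv_F: "x \<in> cube n \<Longrightarrow> bounded_rv P (\<lambda>w. F (H n x w))"
  using K unfolding bounded_rv_def by (blast intro: measurable_compose[OF measurable_H F])

lemma expectation_F: "x \<in> cube n \<Longrightarrow> expectation (\<lambda>w. F (H n x w)) = gauss_mean n F"
  by (rule expectation_fun_H[OF _ F])

lemma expectation_avg_F: "expectation (\<lambda>w. cube_avg n (\<lambda>x. F (H n x w))) = gauss_mean n F"
  unfolding cube_avg_def
  by (simp add: Bochner_Integration.integral_sum bounded_rv_integrable[OF bounded_rv_F] expectation_F)

lemma centered_F:
  assumes x: "x \<in> cube n"
  shows "bounded_rv P (\<lambda>w. F (H n x w) - gauss_mean n F)"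
    "expectation (\<lambda>w. F (H n x w) - gauss_mean n F) = 0"
    "expectation (\<lambda>w. (F (H n x w) - gauss_mean n F)\<^sup>2) = gauss_mean n (\<lambda>h. (F h)\<^sup>2) - (gauss_mean n F)\<^sup>2"
proof -
  show "bounded_rv P (\<lambda>w. F (H n x w) - gauss_mean n F)"
    using bounded_rv_add[OF bounded_rv_F[OF x] bounded_rv_const[of P "- gauss_mean n F"]] by simp
  note int = bounded_rv_integrable[OF bounded_rv_F[OF x]]
    bounded_rv_integrable[OF bounded_rv_power2[OF bounded_rv_F[OF x]]]
  show "expectation (\<lambda>w. F (H n x w) - gauss_mean n F) = 0"
    using int(1) by (simp add: expectation_F[OF x] prob_space)
  have "expectation (\<lambda>w. (F (H n x w))\<^sup>2) = gauss_mean n (\<lambda>h. (F h)\<^sup>2)"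
    by (rule expectation_fun_H[OF x]) (use F in measurable)
  then show "expectation (\<lambda>w. (F (H n x w) - gauss_mean n F)\<^sup>2) = gauss_mean n (\<lambda>h. (F h)\<^sup>2) - (gauss_mean n F)\<^sup>2"
    using variance_eq[OF int] by (simp add: expectation_F[OF x])
qed

lemma gauss_mean_sq_le: "(gauss_mean n F)\<^sup>2 \<le> gauss_mean n (\<lambda>h. (F h)\<^sup>2)"
proof -
  obtain x where "x \<in> cube n" using cube_nonempty by blast
  moreover have "0 \<le> expectation (\<lambda>w. (F (H n x w) - gauss_mean n F)\<^sup>2)"
    by (intro Bochner_Integration.integral_nonneg) simp
  ultimately show ?thesis using centered_F(3)[of x] by simp
qed

lemma second_moment_avg_F:
  "expectation (\<lambda>w. (cube_avg n (\<lambda>x. F (H n x w)) - gauss_mean n F)\<^sup>2) \<le> gauss_mean n (\<lambda>h. (F h)\<^sup>2) / 2 ^ n"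
proof -
  let ?Y = "\<lambda>x w. F (H n x w) - gauss_mean n F"
  have "expectation (\<lambda>w. (\<Sum>x\<in>cube n. ?Y x w)\<^sup>2) = (\<Sum>x\<in>cube n. expectation (\<lambda>w. (?Y x w)\<^sup>2))"
    by (intro expectation_sum_centered_sq finite_cube indep_fun_H[of "\<lambda>h. F h - gauss_mean n F"] centered_F)
       (use F in measurable)
  also have "\<dots> = 2 ^ n * (gauss_mean n (\<lambda>h. (F h)\<^sup>2) - (gauss_mean n F)\<^sup>2)" by (simp add: centered_F)
  also have "\<dots> \<le> 2 ^ n * gauss_mean n (\<lambda>h. (F h)\<^sup>2)" by simp
  finally have le: "expectation (\<lambda>w. (\<Sum>x\<in>cube n. ?Y x w)\<^sup>2) \<le> 2 ^ n * gauss_mean n (\<lambda>h. (F h)\<^sup>2)" .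
  have "(\<lambda>w. (cube_avg n (\<lambda>x. F (H n x w)) - gauss_mean n F)\<^sup>2) = (\<lambda>w. (\<Sum>x\<in>cube n. ?Y x w)\<^sup>2 / (2 ^ n)\<^sup>2)"
    by (simp add: cube_avg_def sum_subtractf power_divide[symmetric] diff_divide_distrib)
  then have "expectation (\<lambda>w. (cube_avg n (\<lambda>x. F (H n x w)) - gauss_mean n F)\<^sup>2)
      = expectation (\<lambda>w. (\<Sum>x\<in>cube n. ?Y x w)\<^sup>2) / (2 ^ n)\<^sup>2" by simp
  also have "\<dots> \<le> 2 ^ n * gauss_mean n (\<lambda>h. (F h)\<^sup>2) / (2 ^ n)\<^sup>2" by (intro divide_right_mono le) simp
  finally show ?thesis by (simp add: power2_eq_square)
qed

lemma prob_avg_deviation: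
  assumes \<rho>: "\<rho> > 0"
  shows "prob {w \<in> space P. \<rho> \<le> \<bar>cube_avg n (\<lambda>x. F (H n x w)) - gauss_mean n F\<bar>}
    \<le> gauss_mean n (\<lambda>h. (F h)\<^sup>2) / 2 ^ n / \<rho>\<^sup>2"
proof -
  let ?A = "\<lambda>w. cube_avg n (\<lambda>x. F (H n x w))"
  have b: "bounded_rv P ?A"
  proof -
    have "bounded_rv P (\<lambda>w. (1 / 2 ^ n) * (\<Sum>x\<in>cube n. F (H n x w)))"
      by (intro bounded_rv_mult bounded_rv_sum bounded_rv_F) auto
    then show ?thesis by (simp add: cube_avg_def)
  qed
  have "prob {w \<in> space P. \<rho> \<le> \<bar>?A w - expectation ?A\<bar>} \<le> expectation (\<lambda>w. (?A w - expectation ?A)\<^sup>2) / \<rho>\<^sup>2"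
    by (intro Chebyshev_inequality measurable_avg_F bounded_rv_integrable bounded_rv_power2 b \<rho>)
  also have "\<dots> \<le> gauss_mean n (\<lambda>h. (F h)\<^sup>2) / 2 ^ n / \<rho>\<^sup>2"
    unfolding expectation_avg_F by (intro divide_right_mono second_moment_avg_F) simp
  finally show ?thesis by (simp add: expectation_avg_F)
qed

text \<open>The form ignores constants, so the variables may be centred. The price is
  \<open>(F - m)\<^sup>2 \<le> 2 * F\<^sup>2 + 2 * m\<^sup>2\<close>, which doubles 48 to 96. The
  remaining off-diagonal form has second moment at most 2 times 96 times the squared second moment
  of F over 2 ^ n, which gives 192.\<close>

lemma prob_asymp_var_deviation:
  assumes \<rho>: "\<rho> > 0"
  shows "prob {w \<in> space P. 96 * cube_avg n (\<lambda>x. (F (H n x w))\<^sup>2) + 96 * gauss_mean n (\<lambda>h. (F h)\<^sup>2) + \<rho>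
      \<le> asymp_var n (\<lambda>x. F (H n x w))} \<le> 192 * (gauss_mean n (\<lambda>h. (F h)\<^sup>2))\<^sup>2 / 2 ^ n / \<rho>\<^sup>2"
proof -
  define v where "v = gauss_mean n (\<lambda>h. (F h)\<^sup>2)"
  let ?Y = "\<lambda>x w. F (H n x w) - gauss_mean n F"
  let ?O = "\<lambda>w. \<Sum>x\<in>cube n. \<Sum>y\<in>cube n - {x}. asymp_kernel n x y * ?Y x w * ?Y y w"
  have v0: "v \<ge> 0" using gauss_mean_sq_le by (auto simp: v_def intro: order_trans[OF zero_le_power2])
  have bO: "bounded_rv P ?O"
    by (intro bounded_rv_sum bounded_rv_mult bounded_rv_const centered_F) auto
  have upper: "asymp_var n (\<lambda>x. F (H n x w)) \<le> 96 * cube_avg n (\<lambda>x. (F (H n x w))\<^sup>2) + 96 * v + ?O w" for w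
  proof -
    have "asymp_var n (\<lambda>x. F (H n x w)) = asymp_var n (\<lambda>x. ?Y x w)" by (rule asymp_var_diff_const[symmetric])
    also have "\<dots> \<le> 48 * cube_avg n (\<lambda>x. (?Y x w)\<^sup>2) + ?O w" by (rule asymp_var_le_offdiag)
    also have "cube_avg n (\<lambda>x. (?Y x w)\<^sup>2) \<le> cube_avg n (\<lambda>x. 2 * (F (H n x w))\<^sup>2 + 2 * v)"
    proof (rule cube_avg_mono)
      fix x
      have "(F (H n x w) - gauss_mean n F)\<^sup>2 \<le> 2 * (F (H n x w))\<^sup>2 + 2 * (gauss_mean n F)\<^sup>2"
        using zero_le_power2[of "F (H n x w) + gauss_mean n F"] by (simp add: power2_eq_square algebra_simps)
      then show "(?Y x w)\<^sup>2 \<le> 2 * (F (H n x w))\<^sup>2 + 2 * v" using gauss_mean_sq_le by (simp add: v_def)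
    qed
    also have "\<dots> = 2 * cube_avg n (\<lambda>x. (F (H n x w))\<^sup>2) + 2 * v"
      by (simp add: cube_avg_def sum.distrib add_divide_distrib sum_distrib_left)
    finally show ?thesis by simp
  qed
  have sq: "expectation (\<lambda>w. (?O w)\<^sup>2) \<le> 2 * v\<^sup>2 * (\<Sum>x\<in>cube n. \<Sum>y\<in>cube n. (asymp_kernel n x y)\<^sup>2)"
  proof (rule expectation_offdiag_form_sq)
    show "indep_vars (\<lambda>_. borel) ?Y (cube n)"
      by (rule indep_fun_H[of "\<lambda>h. F h - gauss_mean n F"]) (use F in measurable)
  qed (use v0 in \<open>auto simp: centered_F asymp_kernel_sym v_def\<close>)
  have "prob {w \<in> space P. 96 * cube_avg n (\<lambda>x. (F (H n x w))\<^sup>2) + 96 * v + \<rho> \<le> asymp_var n (\<lambda>x. F (H n x w))}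
     \<le> prob {w \<in> space P. \<rho>\<^sup>2 \<le> (?O w)\<^sup>2}"
  proof (rule finite_measure_mono)
    show "{w \<in> space P. 96 * cube_avg n (\<lambda>x. (F (H n x w))\<^sup>2) + 96 * v + \<rho> \<le> asymp_var n (\<lambda>x. F (H n x w))}
      \<subseteq> {w \<in> space P. \<rho>\<^sup>2 \<le> (?O w)\<^sup>2}"
    proof safe
      fix w assume "96 * cube_avg n (\<lambda>x. (F (H n x w))\<^sup>2) + 96 * v + \<rho> \<le> asymp_var n (\<lambda>x. F (H n x w))"
      then have "\<rho> \<le> ?O w" using upper[of w] by linarith
      then show "\<rho>\<^sup>2 \<le> (?O w)\<^sup>2" using \<rho> by (intro power_mono) auto
    qed
    show "{w \<in> space P. \<rho>\<^sup>2 \<le> (?O w)\<^sup>2} \<in> events"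
      using bounded_rv_measurable[OF bO] by measurable
  qed
  also have "\<dots> \<le> expectation (\<lambda>w. (?O w)\<^sup>2) / \<rho>\<^sup>2"
    using \<rho> by (intro integral_Markov_inequality_measure[where A="{}"] bounded_rv_integrable bounded_rv_power2 bO) auto
  also have "\<dots> \<le> 2 * v\<^sup>2 * (96 / 2 ^ n) / \<rho>\<^sup>2"
    using asymp_kernel_sq_sum[of n]
    by (intro divide_right_mono order_trans[OF sq] mult_left_mono) auto
  finally show ?thesis by (simp add: v_def)
qed

end

end

end

section \<open>Deviation probabilities in a fixed environment\<close>

text \<open>Monotonicity reduces the supremum to finitely many times. The event under the supremum need
  not be measurable, so the events at the grid points are only covered by measurable ones.\<close>

lemma (in prob_space) dev_prob_le_grid:
  fixes X :: "'a \<Rightarrow> real \<Rightarrow> real"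
  assumes mono: "AE \<omega> in M. \<forall>s t. 0 \<le> s \<longrightarrow> s \<le> t \<longrightarrow> X \<omega> s \<le> X \<omega> t"
    and pos: "d > 0" "T > 0" "\<delta> > 0"
    and point: "\<And>t. 0 \<le> t \<Longrightarrow> t \<le> T + \<delta> \<Longrightarrow>
      \<exists>E\<in>events. {\<omega> \<in> space M. \<delta> / 4 < \<bar>X \<omega> t / d - t\<bar>} \<subseteq> E \<and> prob E \<le> \<kappa>"
  shows "dev_prob M X d T \<delta> \<le> real (nat \<lceil>4 * T / \<delta>\<rceil> + 1) * \<kappa>"
proof -
  define N where "N = nat \<lceil>4 * T / \<delta>\<rceil>"
  \<comment> \<open>The mesh equals the tolerance allowed at grid points. Between grid points the
    error is at most tolerance plus mesh, that is \<delta> / 2. The last grid point may pass T by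
    one mesh width, hence the range T + \<delta> in the assumption.\<close>
  define u where "u = \<delta> / 4"
  have u: "u > 0" using pos by (simp add: u_def)
  have "T / u = 4 * T / \<delta>" "T / u > 0" using pos by (auto simp: u_def)
  then have Tu: "T / u \<le> N" and N_le: "real N \<le> T / u + 1" unfolding N_def by linarith+
  have grid: "real k * u \<le> T + \<delta>" if "k \<le> N" for k
  proof -
    have "real k * u \<le> (T / u + 1) * u" using that N_le u by (intro mult_right_mono) auto
    also have "\<dots> = T + u" using u by (simp add: field_simps)
    finally show ?thesis using pos by (simp add: u_def)
  qed
  have "\<forall>k\<in>{..N}. \<exists>E. E \<in> events \<and> {\<omega> \<in> space M. u < \<bar>X \<omega> (k * u) / d - k * u\<bar>} \<subseteq> E \<and> prob E \<le> \<kappa>"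
  proof
    fix k assume k: "k \<in> {..N}"
    have "0 \<le> real k * u" using u by simp
    moreover have "real k * u \<le> T + \<delta>" using grid k by simp
    ultimately have "\<exists>E\<in>events. {\<omega> \<in> space M. u < \<bar>X \<omega> (k * u) / d - k * u\<bar>} \<subseteq> E \<and> prob E \<le> \<kappa>"
      by (rule point[folded u_def])
    then show "\<exists>E. E \<in> events \<and> {\<omega> \<in> space M. u < \<bar>X \<omega> (k * u) / d - k * u\<bar>} \<subseteq> E \<and> prob E \<le> \<kappa>"
      by (simp only: Bex_def)
  qed
  from bchoice[OF this] obtain E :: "nat \<Rightarrow> 'a set" where choice: "\<forall>k\<in>{..N}. E k \<in> events \<and>
      {\<omega> \<in> space M. u < \<bar>X \<omega> (k * u) / d - k * u\<bar>} \<subseteq> E k \<and> prob (E k) \<le> \<kappa>" ..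
  have E: "E k \<in> events" "prob (E k) \<le> \<kappa>" and sub: "{\<omega> \<in> space M. u < \<bar>X \<omega> (k * u) / d - k * u\<bar>} \<subseteq> E k"
    if "k \<le> N" for k
    using bspec[OF choice atMost_iff[THEN iffD2, OF that]] by simp_all
  obtain Z where Z: "Z \<in> null_sets M" "{\<omega> \<in> space M. \<not> (\<forall>s t. 0 \<le> s \<longrightarrow> s \<le> t \<longrightarrow> X \<omega> s \<le> X \<omega> t)} \<subseteq> Z"
    using mono by (auto elim!: AE_E intro: null_setsI)
  have "{\<omega> \<in> space M. (SUP t\<in>{0..T}. \<bar>X \<omega> t / d - t\<bar>) > \<delta>} \<subseteq> (\<Union>k\<le>N. E k) \<union> Z"
  proof (rule subsetI, rule ccontr)
    fix \<omega> assume \<omega>: "\<omega> \<in> {\<omega> \<in> space M. (SUP t\<in>{0..T}. \<bar>X \<omega> t / d - t\<bar>) > \<delta>}" and no: "\<omega> \<notin> (\<Union>k\<le>N. E k) \<union> Z"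
    then have in_space: "\<omega> \<in> space M" by auto
    have "\<omega> \<notin> {\<omega> \<in> space M. \<not> (\<forall>s t. 0 \<le> s \<longrightarrow> s \<le> t \<longrightarrow> X \<omega> s \<le> X \<omega> t)}" using Z(2) no by auto
    then have mon: "X \<omega> s \<le> X \<omega> t" if "0 \<le> s" "s \<le> t" for s t using in_space that by simp
    have close: "\<bar>X \<omega> (k * u) / d - k * u\<bar> \<le> u" if "k \<le> N" for k
      using sub[OF that] no in_space that by force
    have "\<bar>X \<omega> t / d - t\<bar> \<le> \<delta>" if t: "t \<in> {0..T}" for t
    proof -
      \<comment> \<open>The grid point just to the right of t; with k - 1 on the left, monotonicity
        encloses the process at t. The case k = 0 means t = 0 and is separated because k - 1 is a
        subtraction of naturals.\<close>
      define k where "k = nat \<lceil>t / u\<rceil>"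
      have t_le: "t \<le> k * u"
        using u t unfolding k_def by (simp add: pos_divide_le_eq[symmetric] real_nat_ceiling_ge)
      have "t / u \<le> T / u" using t u by (simp add: divide_right_mono)
      then have "t / u \<le> N" using Tu by linarith
      then have kN: "k \<le> N" unfolding k_def by (simp add: nat_le_iff ceiling_le_iff)
      show ?thesis
      proof (cases "k = 0")
        case True
        then have "t = 0" using t_le t by simp
        then have "\<bar>X \<omega> t / d - t\<bar> \<le> u" using close[OF kN] True by simp
        also have "u \<le> \<delta>" using pos by (simp add: u_def)
        finally show ?thesis .
      next
        case False
        have "real k < t / u + 1" using t u False unfolding k_def by linarith
        then have "(real k - 1) * u \<le> t" using u by (simp add: field_simps)
        then have ge: "real (k - 1) * u \<le> t" using False by (simp add: of_nat_diff)
        have 1: "X \<omega> t / d \<le> X \<omega> (k * u) / d" using mon[of t "k * u"] t t_le pos by (simp add: divide_right_mono)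
        have 2: "X \<omega> (real (k - 1) * u) / d \<le> X \<omega> t / d" using mon[of "real (k - 1) * u" t] ge u pos by (simp add: divide_right_mono)
        have 3: "real k * u = real (k - 1) * u + u" using False by (simp add: of_nat_diff algebra_simps)
        have 4: "X \<omega> (k * u) / d \<le> k * u + u" using abs_le_D1[OF close[OF kN]] by linarith
        have "k - 1 \<le> N" using kN by simp
        from abs_le_D2[OF close[OF this]]
        have 5: "real (k - 1) * u - u \<le> X \<omega> (real (k - 1) * u) / d" by linarith
        have "X \<omega> t / d - t \<le> 2 * u" "- (X \<omega> t / d - t) \<le> 2 * u"
          using 1 2 3 4 5 ge t_le by linarith+
        then have "\<bar>X \<omega> t / d - t\<bar> \<le> 2 * u" by (rule abs_leI)
        also have "2 * u \<le> \<delta>" using pos by (simp add: u_def)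
        finally show ?thesis .
      qed
    qed
    then have "(SUP t\<in>{0..T}. \<bar>X \<omega> t / d - t\<bar>) \<le> \<delta>" using pos by (intro cSUP_least) auto
    then show False using \<omega> by auto
  qed
  then have "dev_prob M X d T \<delta> \<le> prob ((\<Union>k\<le>N. E k) \<union> Z)"
    unfolding dev_prob_def using E Z by (intro finite_measure_mono) auto
  also have "\<dots> \<le> prob (\<Union>k\<le>N. E k) + prob Z" using E Z by (intro measure_Un_le) auto
  also have "prob Z = 0" using Z(1) by (simp add: null_sets_def measure_def)
  also have "prob (\<Union>k\<le>N. E k) \<le> (\<Sum>k\<le>N. prob (E k))" using E by (intro finite_measure_subadditive_finite) auto
  also have "(\<Sum>k\<le>N. prob (E k)) \<le> (\<Sum>k\<le>N. \<kappa>)" using E by (intro sum_mono) auto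
  finally show ?thesis by (simp add: N_def)
qed

text \<open>B collects the vertices where f may differ from the summand of the process. The
  conditions make unlikely or small, in this order: a visit to B, the error of the mean, the
  fluctuation of the walk, and the fluctuation of the clocks.\<close>

definition good_env :: "nat \<Rightarrow> real \<Rightarrow> real \<Rightarrow> real \<Rightarrow> (vertex \<Rightarrow> real) \<Rightarrow> vertex set \<Rightarrow> bool" where
  "good_env n a d \<rho> f B \<longleftrightarrow> a * cube_avg n (indicator B) \<le> \<rho> \<and> \<bar>a * cube_avg n f / d - 1\<bar> \<le> \<rho> \<and>
    a * asymp_var n f / d\<^sup>2 \<le> \<rho> \<and> a * cube_avg n (\<lambda>x. (f x)\<^sup>2) / d\<^sup>2 \<le> \<rho>"

lemma dev_prob_nonneg [simp]: "dev_prob M X d T \<delta> \<ge> 0"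
  by (simp add: dev_prob_def)

text \<open>The number of grid points times the failure probability at one of them. There 1 stands
  for visiting B and 512 = 2 * 256 for two Chebyshev bounds at threshold \<delta> d / 16.\<close>

definition dev_bound :: "real \<Rightarrow> real \<Rightarrow> real \<Rightarrow> real" where
  "dev_bound T \<delta> \<rho> = real (nat \<lceil>4 * T / \<delta>\<rceil> + 1) * ((1 + 512 / \<delta>\<^sup>2) * ((T + \<delta> + 1) * \<rho>))"

lemma small_tolerance:
  fixes T \<delta> \<eta> :: real
  assumes pos: "T > 0" "\<delta> > 0" "\<eta> > 0"
  obtains \<rho> where "0 < \<rho>" "\<rho> \<le> 1" "\<rho> * (2 + T + \<delta>) \<le> \<delta> / 8" "dev_bound T \<delta> \<rho> \<le> \<eta>"
proof -
  define k where "k = real (nat \<lceil>4 * T / \<delta>\<rceil> + 1) * ((1 + 512 / \<delta>\<^sup>2) * (T + \<delta> + 1))"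
  have "1 + 512 / \<delta>\<^sup>2 > 0" by (simp add: add_pos_nonneg)
  moreover have "real (nat \<lceil>4 * T / \<delta>\<rceil> + 1) > 0" by linarith
  ultimately have k: "k > 0" unfolding k_def using pos by (intro mult_pos_pos) (simp_all only: add_pos_pos zero_less_one)
  let ?\<rho> = "min 1 (min (\<delta> / 8 / (2 + T + \<delta>)) (\<eta> / k))"
  show thesis
  proof (rule that)
    show "0 < ?\<rho>" "?\<rho> \<le> 1" using pos k by auto
    have "?\<rho> * (2 + T + \<delta>) \<le> \<delta> / 8 / (2 + T + \<delta>) * (2 + T + \<delta>)"
      using pos by (intro mult_right_mono) auto
    also have "\<dots> = \<delta> / 8"
      using pos nonzero_divide_eq_eq[of "2 + T + \<delta>" "\<delta> / 8" "\<delta> / 8 / (2 + T + \<delta>)"] by auto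
    finally show "?\<rho> * (2 + T + \<delta>) \<le> \<delta> / 8" .
    have "k * ?\<rho> \<le> k * (\<eta> / k)" using k by (intro mult_left_mono) auto
    also have "\<dots> = \<eta>" using k by simp
    finally show "dev_bound T \<delta> ?\<rho> \<le> \<eta>" by (simp only: dev_bound_def k_def mult_ac)
  qed
qed

text \<open>Here m is a number of steps, known up to rounding. Two errors add up: rounding costs at
  most 1 / a \<le> \<rho>, multiplied by a ratio of at most 1 + \<rho> \<le> 2, and the ratio itself
  is off by \<rho>, multiplied by t.\<close>

lemma mean_close:
  fixes a t \<rho> p d :: real and m :: nat
  assumes a: "1 / \<rho> \<le> a" and \<rho>: "0 < \<rho>" "\<rho> \<le> 1" and p: "\<bar>a * p / d - 1\<bar> \<le> \<rho>"
    and m: "\<bar>m - a * t\<bar> \<le> 1" and t: "0 \<le> t"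
  shows "\<bar>m * p / d - t\<bar> \<le> \<rho> * (2 + t)" "m \<le> a * (t + 1)"
proof -
  have a0: "a > 0" using a \<rho> by (smt (verit) divide_pos_pos)
  then have inv: "1 / a \<le> \<rho>" using a \<rho> by (simp add: field_simps)
  have "m / a - t = (m - a * t) / a" using a0 by (simp add: field_simps)
  then have "\<bar>m / a - t\<bar> = \<bar>m - a * t\<bar> / a" using a0 by simp
  also have "\<dots> \<le> 1 / a" using m a0 by (simp add: divide_right_mono)
  finally have 1: "\<bar>m / a - t\<bar> \<le> \<rho>" using inv by linarith
  have "m * p / d = (m / a) * (a * p / d)" using a0 by simp
  then have "m * p / d - t = (m / a - t) * (a * p / d) + t * (a * p / d - 1)"
    by (simp add: algebra_simps)
  moreover have "\<bar>(m / a - t) * (a * p / d)\<bar> \<le> \<rho> * 2"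
    unfolding abs_mult using 1 p \<rho> by (intro mult_mono) auto
  moreover have "\<bar>t * (a * p / d - 1)\<bar> \<le> t * \<rho>"
    unfolding abs_mult using t p by (intro mult_mono) auto
  ultimately have "\<bar>m * p / d - t\<bar> \<le> \<rho> * 2 + t * \<rho>"
    by (simp only:) (rule order_trans[OF abs_triangle_ineq add_mono])
  then show "\<bar>m * p / d - t\<bar> \<le> \<rho> * (2 + t)" by (simp add: algebra_simps)
  have "1 \<le> a" using a \<rho> by (smt (verit) le_divide_eq_1_pos)
  then show "m \<le> a * (t + 1)" using m by (simp add: algebra_simps)
qed

section \<open>Deviation at a single time\<close>

context walk_and_clocks
begin

context
  fixes m :: nat and a \<rho> T \<delta> d t :: real and f :: "vertex \<Rightarrow> real"
  assumes n: "n \<ge> 1" and a: "1 / \<rho> \<le> a" and \<rho>: "0 < \<rho>" "\<rho> \<le> 1" "\<rho> * (2 + T + \<delta>) \<le> \<delta> / 8"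
    and d: "d > 0" and mean: "\<bar>a * cube_avg n f / d - 1\<bar> \<le> \<rho>" and var: "a * asymp_var n f / d\<^sup>2 \<le> \<rho>"
    and m: "\<bar>m - a * t\<bar> \<le> 1" and t: "0 \<le> t" "t \<le> T + \<delta>" and \<delta>: "\<delta> > 0"
begin

lemma step_count_scale:
  fixes k :: real
  assumes "a * k \<le> \<rho>" "k \<ge> 0"
  shows "m * k \<le> (T + \<delta> + 1) * \<rho>"
proof -
  have a0: "a > 0" using a \<rho> by (smt (verit) divide_pos_pos)
  have "m \<le> a * (t + 1)" using mean_close(2)[OF a \<rho>(1,2) mean m t(1)] .
  also have "\<dots> \<le> a * (T + \<delta> + 1)" using t a0 by (intro mult_left_mono) auto
  finally have "m * k \<le> (a * (T + \<delta> + 1)) * k" using assms(2) by (rule mult_right_mono)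
  then have "m * k \<le> (T + \<delta> + 1) * (a * k)" by (simp add: mult_ac)
  also have "\<dots> \<le> (T + \<delta> + 1) * \<rho>" using assms t by (intro mult_left_mono) auto
  finally show ?thesis .
qed

lemma step_count_scale_sq:
  fixes k :: real
  assumes "a * k / d\<^sup>2 \<le> \<rho>" "k \<ge> 0"
  shows "m * k / (\<delta> * d / 16)\<^sup>2 \<le> 256 / \<delta>\<^sup>2 * ((T + \<delta> + 1) * \<rho>)"
proof -
  have "m * (k / d\<^sup>2) \<le> (T + \<delta> + 1) * \<rho>" using assms by (intro step_count_scale) auto
  then have "256 / \<delta>\<^sup>2 * (m * (k / d\<^sup>2)) \<le> 256 / \<delta>\<^sup>2 * ((T + \<delta> + 1) * \<rho>)" by (rule mult_left_mono) simp
  then show ?thesis by (simp add: power_divide power_mult_distrib mult_ac)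
qed

text \<open>Half of the budget \<delta> / 4 pays for replacing the mean by t d, through the
  smallness condition on \<rho>; the other half is left to the random fluctuations.\<close>

lemma close_to_mean:
  assumes "\<bar>y - m * cube_avg n f\<bar> \<le> \<delta> * d / 8"
  shows "\<bar>y / d - t\<bar> \<le> \<delta> / 4"
proof -
  have "\<rho> * (2 + t) \<le> \<rho> * (2 + T + \<delta>)" using t \<rho> by (intro mult_left_mono) auto
  then have 1: "\<bar>m * cube_avg n f / d - t\<bar> \<le> \<delta> / 8"
    using mean_close(1)[OF a \<rho>(1,2) mean m t(1)] \<rho>(3) by linarith
  have "\<bar>y / d - m * cube_avg n f / d\<bar> = \<bar>y - m * cube_avg n f\<bar> / d"
    using d by (simp add: diff_divide_distrib[symmetric] abs_divide)
  also have "\<dots> \<le> (\<delta> * d / 8) / d" using assms d by (intro divide_right_mono) auto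
  also have "\<dots> = \<delta> / 8" using d by simp
  finally have 2: "\<bar>y / d - m * cube_avg n f / d\<bar> \<le> \<delta> / 8" .
  have "\<bar>y / d - t\<bar> \<le> \<bar>y / d - m * cube_avg n f / d\<bar> + \<bar>m * cube_avg n f / d - t\<bar>"
    using abs_triangle_ineq[of "y / d - m * cube_avg n f / d" "m * cube_avg n f / d - t"] by simp
  also have "\<dots> \<le> \<delta> / 8 + \<delta> / 8" by (intro add_mono 1 2)
  finally show ?thesis by simp
qed

lemma walk_deviation_le:
  "prob {\<omega> \<in> space Q. \<delta> * d / 16 \<le> \<bar>(\<Sum>i<m. f (J i \<omega>)) - m * cube_avg n f\<bar>} \<le> 256 / \<delta>\<^sup>2 * ((T + \<delta> + 1) * \<rho>)"
proof -
  have "\<delta> * d / 16 > 0" using \<delta> d by simp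
  then show ?thesis
    using prob_sum_J_deviation[OF n, of "\<delta> * d / 16" f m] step_count_scale_sq[OF var asymp_var_nonneg] by linarith
qed

lemma walk_point_deviation:
  "\<exists>E\<in>events. {\<omega> \<in> space Q. \<delta> / 4 < \<bar>(\<Sum>i<m. f (J i \<omega>)) / d - t\<bar>} \<subseteq> E \<and>
      prob E \<le> 256 / \<delta>\<^sup>2 * ((T + \<delta> + 1) * \<rho>)"
proof (intro bexI[of _ "{\<omega> \<in> space Q. \<delta> * d / 16 \<le> \<bar>(\<Sum>i<m. f (J i \<omega>)) - m * cube_avg n f\<bar>}"] conjI walk_deviation_le)
  have pos: "\<delta> * d > 0" using \<delta> d by simp
  have "\<delta> * d / 16 \<le> \<bar>(\<Sum>i<m. f (J i \<omega>)) - m * cube_avg n f\<bar>"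
    if "\<delta> / 4 < \<bar>(\<Sum>i<m. f (J i \<omega>)) / d - t\<bar>" for \<omega>
  proof (rule ccontr)
    assume "\<not> ?thesis"
    then have "\<bar>(\<Sum>i<m. f (J i \<omega>)) - m * cube_avg n f\<bar> \<le> \<delta> * d / 8" using pos by linarith
    from close_to_mean[OF this] show False using that by linarith
  qed
  then show "{\<omega> \<in> space Q. \<delta> / 4 < \<bar>(\<Sum>i<m. f (J i \<omega>)) / d - t\<bar>}
      \<subseteq> {\<omega> \<in> space Q. \<delta> * d / 16 \<le> \<bar>(\<Sum>i<m. f (J i \<omega>)) - m * cube_avg n f\<bar>}"
    by blast
qed measurable

text \<open>Off three bad events the walk sees f instead of g, and writing e = 1 + (e - 1) splits
  the clock into a walk sum and orthogonal noise. Each of the two may deviate by \<delta> d /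
  16.\<close>

lemma clock_point_deviation:
  assumes B: "a * cube_avg n (indicator B) \<le> \<rho>" and sq: "a * cube_avg n (\<lambda>x. (f x)\<^sup>2) / d\<^sup>2 \<le> \<rho>"
    and g: "\<And>x. x \<in> cube n \<Longrightarrow> x \<notin> B \<Longrightarrow> g x = f x"
  shows "\<exists>E\<in>events. {\<omega> \<in> space Q. \<delta> / 4 < \<bar>(\<Sum>i<m. g (J i \<omega>) * e i \<omega>) / d - t\<bar>} \<subseteq> E \<and>
      prob E \<le> (1 + 512 / \<delta>\<^sup>2) * ((T + \<delta> + 1) * \<rho>)"
proof -
  define D where "D = {\<omega> \<in> space Q. \<delta> * d / 16 \<le> \<bar>(\<Sum>i<m. f (J i \<omega>)) - m * cube_avg n f\<bar>}"
  define N where "N = {\<omega> \<in> space Q. \<delta> * d / 16 \<le> \<bar>\<Sum>i<m. f (J i \<omega>) * (e i \<omega> - 1)\<bar>}"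
  define V where "V = {\<omega> \<in> space Q. \<exists>i<m. J i \<omega> \<in> B}"
  have ev: "D \<in> events" "N \<in> events" "V \<in> events" unfolding D_def N_def V_def by measurable
  have pos: "\<delta> * d / 16 > 0" using \<delta> d by simp
  have D: "prob D \<le> 256 / \<delta>\<^sup>2 * ((T + \<delta> + 1) * \<rho>)" unfolding D_def by (rule walk_deviation_le)
  have N: "prob N \<le> 256 / \<delta>\<^sup>2 * ((T + \<delta> + 1) * \<rho>)"
    unfolding N_def
    by (rule order_trans[OF prob_clock_noise_deviation[OF n pos] step_count_scale_sq[OF sq cube_avg_nonneg]]) simp
  have V: "prob V \<le> (T + \<delta> + 1) * \<rho>"
    unfolding V_def
    by (rule order_trans[OF prob_visit_le[OF n] step_count_scale[OF B cube_avg_nonneg]]) simp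
  show ?thesis
  proof (intro bexI[of _ "D \<union> N \<union> V"] conjI subsetI)
    fix \<omega> assume \<omega>: "\<omega> \<in> {\<omega> \<in> space Q. \<delta> / 4 < \<bar>(\<Sum>i<m. g (J i \<omega>) * e i \<omega>) / d - t\<bar>}"
    show "\<omega> \<in> D \<union> N \<union> V"
    proof (rule ccontr)
      assume no: "\<omega> \<notin> D \<union> N \<union> V"
      have sp: "\<omega> \<in> space Q" using \<omega> by auto
      have "(\<Sum>i<m. g (J i \<omega>) * e i \<omega>) = (\<Sum>i<m. f (J i \<omega>) * e i \<omega>)"
      proof (intro sum.cong refl arg_cong2[where f="(*)"] g J_in_cube[OF sp])
        fix i assume "i \<in> {..<m}"
        then show "J i \<omega> \<notin> B" using no sp unfolding V_def by auto
      qed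
      also have "\<dots> = (\<Sum>i<m. f (J i \<omega>)) + (\<Sum>i<m. f (J i \<omega>) * (e i \<omega> - 1))"
        by (simp add: sum.distrib[symmetric] algebra_simps)
      finally have split: "(\<Sum>i<m. g (J i \<omega>) * e i \<omega>) = (\<Sum>i<m. f (J i \<omega>)) + (\<Sum>i<m. f (J i \<omega>) * (e i \<omega> - 1))" .
      have "\<bar>(\<Sum>i<m. f (J i \<omega>)) - m * cube_avg n f\<bar> \<le> \<delta> * d / 16"
        "\<bar>\<Sum>i<m. f (J i \<omega>) * (e i \<omega> - 1)\<bar> \<le> \<delta> * d / 16"
        using no sp unfolding D_def N_def by auto
      from order_trans[OF abs_triangle_ineq add_mono[OF this]]
      have "\<bar>(\<Sum>i<m. g (J i \<omega>) * e i \<omega>) - m * cube_avg n f\<bar> \<le> \<delta> * d / 8"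
        unfolding split by (simp add: algebra_simps)
      from close_to_mean[OF this] show False using \<omega> by auto
    qed
  next
    have "prob (D \<union> N \<union> V) \<le> prob D + prob N + prob V"
      using measure_Un_le[of "D \<union> N" Q V] measure_Un_le[of D Q N] ev by auto
    also have "\<dots> \<le> 256 / \<delta>\<^sup>2 * ((T + \<delta> + 1) * \<rho>) + 256 / \<delta>\<^sup>2 * ((T + \<delta> + 1) * \<rho>) + (T + \<delta> + 1) * \<rho>"
      using D N V by linarith
    also have "\<dots> = (1 + 512 / \<delta>\<^sup>2) * ((T + \<delta> + 1) * \<rho>)" by (simp add: distrib_right)
    finally show "prob (D \<union> N \<union> V) \<le> (1 + 512 / \<delta>\<^sup>2) * ((T + \<delta> + 1) * \<rho>)" .
  qed (use ev in auto)
qed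

end

end

lemma nat_floor_close: "0 \<le> (y::real) \<Longrightarrow> \<bar>real (nat \<lfloor>y\<rfloor>) - y\<bar> \<le> 1" "0 \<le> y \<Longrightarrow> \<bar>real (nat \<lfloor>y\<rfloor> + 1) - y\<bar> \<le> 1"
  by linarith+

text \<open>\<open>trap_mean x\<close> is the mean of \<open>min (x e) 1\<close> for a mean one exponential variable \<open>e\<close>.\<close>

abbreviation trap_mean :: "real \<Rightarrow> real" where
  "trap_mean x \<equiv> x * (1 - exp (- 1 / x))"

lemma mean_clock_eq_step_mean_sum:
  "mean_clock n \<beta> a c h j t = (\<Sum>i<nat \<lfloor>a * t\<rfloor>.
     step_mean n (\<lambda>x. trap_mean (gam \<beta> c h x)) (j i))"
  unfolding mean_clock_def step_mean_def
  by (rule sum.reindex_bij_witness[of _ Suc "\<lambda>i. i - 1"]) (auto simp: mult.assoc)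

text \<open>The clock includes the starting vertex and so has one term more than the mean clock; the
  bound by 1 in \<open>nat_floor_close\<close> covers both counts.\<close>

lemma clock_eq_sum: "clock \<beta> a c h j s t = (\<Sum>i<nat \<lfloor>a * t\<rfloor> + 1. gam \<beta> c h (j i) * s i)"
  unfolding clock_def gam_def by (simp add: sum_divide_distrib atLeast0AtMost lessThan_Suc_atMost)

context walk_and_clocks
begin

lemma dev_prob_clock_le:
  assumes n: "n \<ge> 1" and pos: "T > 0" "\<delta> > 0" and a: "1 / \<rho> \<le> a"
    and \<rho>: "0 < \<rho>" "\<rho> \<le> 1" "\<rho> * (2 + T + \<delta>) \<le> \<delta> / 8" and c: "c > 0" and d: "d > 0"
    and good: "good_env n a d \<rho> f B" and fB: "\<And>x. x \<in> cube n \<Longrightarrow> x \<notin> B \<Longrightarrow> gam \<beta> c h x = f x"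
  shows "dev_prob Q (\<lambda>\<omega>. clock \<beta> a c h (\<lambda>k. J k \<omega>) (\<lambda>i. e i \<omega>)) d T \<delta> \<le> dev_bound T \<delta> \<rho>"
  unfolding dev_bound_def clock_eq_sum
proof (rule dev_prob_le_grid)
  have a0: "a > 0" using a \<rho> by (smt (verit) divide_pos_pos)
  have "AE \<omega> in Q. \<forall>i. 0 \<le> e i \<omega>" using AE_e_nonneg by (simp add: AE_all_countable)
  then show "AE \<omega> in Q. \<forall>s t. 0 \<le> s \<longrightarrow> s \<le> t \<longrightarrow> (\<Sum>i<nat \<lfloor>a * s\<rfloor> + 1. gam \<beta> c h (J i \<omega>) * e i \<omega>)
      \<le> (\<Sum>i<nat \<lfloor>a * t\<rfloor> + 1. gam \<beta> c h (J i \<omega>) * e i \<omega>)"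
  proof eventually_elim
    case (elim \<omega>)
    show ?case
    proof (intro allI impI sum_mono2)
      fix s t :: real assume "0 \<le> s" "s \<le> t"
      then have "nat \<lfloor>a * s\<rfloor> \<le> nat \<lfloor>a * t\<rfloor>" using a0 by (intro nat_mono floor_mono mult_left_mono) auto
      then show "{..<nat \<lfloor>a * s\<rfloor> + 1} \<subseteq> {..<nat \<lfloor>a * t\<rfloor> + 1}" by auto
    qed (use elim c in \<open>auto simp: gam_def tau_def\<close>)
  qed
  fix t assume t: "0 \<le> t" "t \<le> T + \<delta>"
  show "\<exists>E\<in>events. {\<omega> \<in> space Q. \<delta> / 4 < \<bar>(\<Sum>i<nat \<lfloor>a * t\<rfloor> + 1. gam \<beta> c h (J i \<omega>) * e i \<omega>) / d - t\<bar>} \<subseteq> E \<and>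
      prob E \<le> (1 + 512 / \<delta>\<^sup>2) * ((T + \<delta> + 1) * \<rho>)"
    by (rule clock_point_deviation[OF n a \<rho> d _ _ nat_floor_close(2) t pos(2), of f B])
       (use good fB t a0 in \<open>auto simp: good_env_def\<close>)
qed (use pos d in auto)

text \<open>The walk sum here is over \<open>step_mean\<close> of the trap means. Stationarity
  preserves its average and \<open>asymp_var_step_mean_le\<close> its variance bound, so goodness of
  the trap means themselves suffices.\<close>

lemma dev_prob_mean_clock_le:
  assumes n: "n \<ge> 1" and pos: "T > 0" "\<delta> > 0" and a: "1 / \<rho> \<le> a"
    and \<rho>: "0 < \<rho>" "\<rho> \<le> 1" "\<rho> * (2 + T + \<delta>) \<le> \<delta> / 8" and c: "c > 0" and d: "d > 0"
    and good: "good_env n a d \<rho> (\<lambda>x. trap_mean (gam \<beta> c h x)) B"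
  shows "dev_prob Q (\<lambda>\<omega>. mean_clock n \<beta> a c h (\<lambda>k. J k \<omega>)) d T \<delta> \<le> dev_bound T \<delta> \<rho>"
  unfolding dev_bound_def mean_clock_eq_step_mean_sum
proof (rule dev_prob_le_grid)
  let ?g = "\<lambda>x. trap_mean (gam \<beta> c h x)"
  have a0: "a > 0" using a \<rho> by (smt (verit) divide_pos_pos)
  have "a * asymp_var n (step_mean n ?g) / d\<^sup>2 \<le> a * asymp_var n ?g / d\<^sup>2"
    using a0 by (intro divide_right_mono mult_left_mono asymp_var_step_mean_le n) auto
  then have var: "a * asymp_var n (step_mean n ?g) / d\<^sup>2 \<le> \<rho>" using good by (auto simp: good_env_def)
  have mean: "\<bar>a * cube_avg n (step_mean n ?g) / d - 1\<bar> \<le> \<rho>"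
    using good by (simp add: good_env_def cube_avg_step_mean[OF n])
  show "AE \<omega> in Q. \<forall>s t. 0 \<le> s \<longrightarrow> s \<le> t \<longrightarrow>
      (\<Sum>i<nat \<lfloor>a * s\<rfloor>. step_mean n ?g (J i \<omega>)) \<le> (\<Sum>i<nat \<lfloor>a * t\<rfloor>. step_mean n ?g (J i \<omega>))"
  proof (intro AE_I2 allI impI sum_mono2)
    fix s t :: real assume "0 \<le> s" "s \<le> t"
    then have "nat \<lfloor>a * s\<rfloor> \<le> nat \<lfloor>a * t\<rfloor>" using a0 by (intro nat_mono floor_mono mult_left_mono) auto
    then show "{..<nat \<lfloor>a * s\<rfloor>} \<subseteq> {..<nat \<lfloor>a * t\<rfloor>}" by auto
    show "0 \<le> step_mean n ?g (J i \<omega>)" for i \<omega>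
      unfolding step_mean_def
      by (intro sum_nonneg mult_nonneg_nonneg) (use c in \<open>auto simp: trans_prob_def gam_def tau_def\<close>)
  qed auto
  fix t assume t: "0 \<le> t" "t \<le> T + \<delta>"
  have "\<bar>real (nat \<lfloor>a * t\<rfloor>) - a * t\<bar> \<le> 1" using a0 t by (intro nat_floor_close) simp
  from walk_point_deviation[OF n a \<rho> d mean var this t pos(2)]
  obtain E where E: "E \<in> events" "{\<omega> \<in> space Q. \<delta> / 4 < \<bar>(\<Sum>i<nat \<lfloor>a * t\<rfloor>. step_mean n ?g (J i \<omega>)) / d - t\<bar>} \<subseteq> E"
    "prob E \<le> 256 / \<delta>\<^sup>2 * ((T + \<delta> + 1) * \<rho>)" by blast
  have "256 / \<delta>\<^sup>2 \<le> 512 / \<delta>\<^sup>2" by (rule divide_right_mono) simp_all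
  then have "256 / \<delta>\<^sup>2 * ((T + \<delta> + 1) * \<rho>) \<le> (1 + 512 / \<delta>\<^sup>2) * ((T + \<delta> + 1) * \<rho>)"
    using pos \<rho> by (intro mult_right_mono) auto
  then show "\<exists>E\<in>events. {\<omega> \<in> space Q. \<delta> / 4 < \<bar>(\<Sum>i<nat \<lfloor>a * t\<rfloor>. step_mean n ?g (J i \<omega>)) / d - t\<bar>} \<subseteq> E \<and>
      prob E \<le> (1 + 512 / \<delta>\<^sup>2) * ((T + \<delta> + 1) * \<rho>)"
    using E by (intro bexI[of _ E]) auto
qed (use pos d in auto)

end

section \<open>Gaussian expectations\<close>

lemma integrable_normal: "\<sigma> > 0 \<Longrightarrow> integrable lborel (normal_density \<mu> \<sigma>)"
  and integral_normal: "\<sigma> > 0 \<Longrightarrow> (\<integral>x. normal_density \<mu> \<sigma> x \<partial>lborel) = 1"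
proof -
  assume "\<sigma> > 0"
  then have "has_bochner_integral lborel (\<lambda>x. normal_density \<mu> \<sigma> x) 1"
    using normal_moment_even[of \<sigma> \<mu> 0] by simp
  then show "integrable lborel (normal_density \<mu> \<sigma>)" "(\<integral>x. normal_density \<mu> \<sigma> x \<partial>lborel) = 1"
    by (auto simp: has_bochner_integral_iff)
qed

definition gauss_integrable :: "nat \<Rightarrow> (real \<Rightarrow> real) \<Rightarrow> bool" where
  "gauss_integrable n F \<longleftrightarrow> integrable lborel (\<lambda>h. normal_density 0 (sqrt n) h * F h)"

lemma gauss_integrable_bound:
  assumes "gauss_integrable n G" "F \<in> borel_measurable borel" "\<And>h. \<bar>F h\<bar> \<le> G h"
  shows "gauss_integrable n F"
  unfolding gauss_integrable_def
proof (rule Bochner_Integration.integrable_bound)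
  show "integrable lborel (\<lambda>h. normal_density 0 (sqrt n) h * G h)" using assms(1) by (simp add: gauss_integrable_def)
  show "AE h in lborel. norm (normal_density 0 (sqrt n) h * F h) \<le> norm (normal_density 0 (sqrt n) h * G h)"
    using assms(3) by (intro AE_I2) (auto simp: abs_mult intro!: mult_left_mono order_trans[OF assms(3)])
qed (use assms(2) in measurable)

lemma gauss_integrable_const: "n \<ge> 1 \<Longrightarrow> gauss_integrable n (\<lambda>_. k)"
  unfolding gauss_integrable_def by (intro integrable_mult_left integrable_normal) simp

lemma gauss_integrable_bounded:
  assumes "n \<ge> 1" "F \<in> borel_measurable borel" "\<And>h. \<bar>F h\<bar> \<le> K"
  shows "gauss_integrable n F"
  by (rule gauss_integrable_bound[OF gauss_integrable_const[OF assms(1)] assms(2,3)])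

lemma gauss_mean_le:
  assumes "gauss_integrable n F" "gauss_integrable n G" "\<And>h. F h \<le> G h"
  shows "gauss_mean n F \<le> gauss_mean n G"
  unfolding gauss_mean_def using assms
  by (intro integral_mono) (auto simp: gauss_integrable_def intro: mult_left_mono)

lemma gauss_mean_diff:
  assumes "gauss_integrable n F" "gauss_integrable n G"
  shows "gauss_mean n (\<lambda>h. F h - G h) = gauss_mean n F - gauss_mean n G"
  using assms unfolding gauss_mean_def gauss_integrable_def by (simp add: right_diff_distrib)

lemma gauss_mean_add:
  assumes "gauss_integrable n F" "gauss_integrable n G"
  shows "gauss_mean n (\<lambda>h. F h + G h) = gauss_mean n F + gauss_mean n G"
  using assms unfolding gauss_mean_def gauss_integrable_def by (simp add: distrib_left)

lemma gauss_integrable_add: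
  "gauss_integrable n F \<Longrightarrow> gauss_integrable n G \<Longrightarrow> gauss_integrable n (\<lambda>h. F h + G h)"
  unfolding gauss_integrable_def by (simp add: distrib_left)

lemma gauss_integrable_cmult: "gauss_integrable n F \<Longrightarrow> gauss_integrable n (\<lambda>h. k * F h)"
  unfolding gauss_integrable_def using integrable_mult_right[of k lborel "\<lambda>h. normal_density 0 (sqrt n) h * F h"]
  by (simp add: mult.left_commute)

lemma gauss_mean_cmult: "gauss_mean n (\<lambda>h. k * F h) = k * gauss_mean n F"
  unfolding gauss_mean_def by (simp add: mult.left_commute)

lemma gauss_mean_nonneg: "(\<And>h. 0 \<le> F h) \<Longrightarrow> 0 \<le> gauss_mean n F"
  unfolding gauss_mean_def by (intro Bochner_Integration.integral_nonneg) simp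



lemma gauss_exp:
  assumes n: "n \<ge> 1"
  shows "gauss_integrable n (\<lambda>h. exp (s * h + k))" "gauss_mean n (\<lambda>h. exp (s * h + k)) = exp (s\<^sup>2 * n / 2 + k)"
proof -
  \<comment> \<open>exponential tilting: the weight only shifts the mean of the density\<close>
  have tilt: "normal_density 0 (sqrt n) h * exp (s * h + k) = exp (s\<^sup>2 * n / 2 + k) * normal_density (s * n) (sqrt n) h" for h
  proof -
    have "- (h\<^sup>2 / (2 * n)) + (s * h + k) = (s\<^sup>2 * n / 2 + k) + - ((h - s * n)\<^sup>2 / (2 * n))"
      using n by (simp add: field_simps power2_eq_square)
    then have "exp (- (h\<^sup>2 / (2 * n))) * exp (s * h + k) = exp (s\<^sup>2 * n / 2 + k) * exp (- ((h - s * n)\<^sup>2 / (2 * n)))"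
      by (simp only: exp_add[symmetric])
    then show ?thesis by (simp add: normal_density_def)
  qed
  have "sqrt n > 0" using n by simp
  note int = integrable_normal[OF this, of "s * n"] integral_normal[OF this, of "s * n"]
  show "gauss_integrable n (\<lambda>h. exp (s * h + k))"
    unfolding gauss_integrable_def tilt using int by simp
  show "gauss_mean n (\<lambda>h. exp (s * h + k)) = exp (s\<^sup>2 * n / 2 + k)"
    unfolding gauss_mean_def tilt using int by simp
qed

lemma exp_half_line_integral:
  fixes k L :: real
  assumes "k > 0"
  shows "has_bochner_integral lborel (\<lambda>y. indicator {L..} y * exp (- k * y)) (exp (- k * L) / k)"
    "has_bochner_integral lborel (\<lambda>y. indicator {..L} y * exp (k * y)) (exp (k * L) / k)"
proof -
  have up: "has_bochner_integral lborel (\<lambda>y. indicator {L..} y * exp (- k * y)) (exp (- k * L) / k)" for L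
  proof (rule has_bochner_integral_nn_integral)
    have "(\<integral>\<^sup>+y. ennreal (exp (- k * y)) * indicator {L..} y \<partial>lborel) = ennreal (0 - (- exp (- k * L) / k))"
    proof (rule nn_integral_FTC_atLeast)
      fix y show "((\<lambda>y. - exp (- k * y) / k) has_real_derivative exp (- k * y)) (at y)"
        using assms by (auto intro!: derivative_eq_intros)
    next
      have "filterlim (\<lambda>y. - k * y) at_bot at_top"
        using assms by (intro filterlim_tendsto_neg_mult_at_bot[OF tendsto_const _ filterlim_ident]) auto
      then have "((\<lambda>y. exp (- k * y)) \<longlongrightarrow> 0) at_top" by (rule filterlim_compose[OF exp_at_bot])
      then show "((\<lambda>y. - exp (- k * y) / k) \<longlongrightarrow> 0) at_top"
        using tendsto_divide[OF tendsto_minus tendsto_const, of "\<lambda>y. exp (- k * y)" 0 at_top k] assms by simp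
    qed auto
    then show "(\<integral>\<^sup>+y. ennreal (indicator {L..} y * exp (- k * y)) \<partial>lborel) = ennreal (exp (- k * L) / k)"
      by (simp add: ennreal_mult'' mult.commute ennreal_indicator)
  qed (use assms in \<open>auto simp: field_simps\<close>)
  then show "has_bochner_integral lborel (\<lambda>y. indicator {L..} y * exp (- k * y)) (exp (- k * L) / k)" .
  \<comment> \<open>The left half-line follows from the right one by the reflection y to -y, which
    preserves Lebesgue measure.\<close>
  have "has_bochner_integral lborel (\<lambda>y. indicator {-L..} (0 + -1 * y) * exp (- k * (0 + -1 * y))) (exp (- k * -L) / k /\<^sub>R \<bar>-1\<bar>)"
    using up[of "-L"] by (subst lborel_has_bochner_integral_real_affine_iff[symmetric]) auto
  then show "has_bochner_integral lborel (\<lambda>y. indicator {..L} y * exp (k * y)) (exp (k * L) / k)"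
    by (simp add: indicator_def)
qed

section \<open>The Gaussian weight on the logarithmic scale\<close>

definition log_density :: "real \<Rightarrow> real \<Rightarrow> real \<Rightarrow> real" where
  "log_density r v y = exp (- r * y - y\<^sup>2 / (2 * v))"

definition log_const :: "real \<Rightarrow> real \<Rightarrow> real" where
  "log_const r v = exp (- r\<^sup>2 * v / 2) / sqrt (2 * pi * v)"

lemma measurable_log_density [measurable]: "log_density r v \<in> borel_measurable borel"
  unfolding log_density_def by measurable

text \<open>In the logarithmic scale \<open>y = ln (exp (-\<beta> h) / c)\<close> the Gaussian weight becomes
  \<open>log_density\<close> with \<open>r = ln c / v\<close> and \<open>v = n \<beta>\<^sup>2\<close>, up to the constant \<open>log_const\<close>.\<close>

lemma gauss_mean_log_scale:
  fixes f :: "real \<Rightarrow> real"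
  assumes n: "n \<ge> 1" and \<beta>: "\<beta> > 0" and c: "c > 0" and v: "v = n * \<beta>\<^sup>2" and r: "r = ln c / v"
  shows "gauss_integrable n (\<lambda>h. f (exp (- \<beta> * h) / c)) \<longleftrightarrow> integrable lborel (\<lambda>y. f (exp y) * log_density r v y)"
    "gauss_mean n (\<lambda>h. f (exp (- \<beta> * h) / c)) = log_const r v * (\<integral>y. f (exp y) * log_density r v y \<partial>lborel)"
proof -
  define G where "G h = normal_density 0 (sqrt n) h * f (exp (- \<beta> * h) / c)" for h
  have v0: "v > 0" using n \<beta> v by simp
  have lnc: "ln c = r * v" using r v0 by simp
  have eq: "G (- ln c / \<beta> + (- 1 / \<beta>) * y) = \<beta> * log_const r v * (f (exp y) * log_density r v y)" for y
  proof -
    have h: "- ln c / \<beta> + (- 1 / \<beta>) * y = - (ln c + y) / \<beta>" by (simp add: diff_divide_distrib)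
    have "exp (- \<beta> * (- (ln c + y) / \<beta>)) / c = exp y" using \<beta> c by (simp add: exp_add)
    moreover have "normal_density 0 (sqrt n) (- (ln c + y) / \<beta>) = \<beta> * log_const r v * log_density r v y"
    proof -
      have "(- (ln c + y) / \<beta>)\<^sup>2 / (2 * n) = (r * v + y)\<^sup>2 / (2 * v)"
        unfolding lnc by (simp only: power_divide power2_minus) (simp add: v mult_ac)
      \<comment> \<open>After expanding the square, the term free of y goes into
        \<open>log_const\<close>. What remains is a pure power law of index r in exp y, corrected by
        a Gaussian factor that flattens as v grows.\<close>
      moreover have "(r * v + y)\<^sup>2 / (2 * v) = r\<^sup>2 * v / 2 + (r * y + y\<^sup>2 / (2 * v))"
        using v0 by (simp add: power2_eq_square field_simps)
      moreover have "1 / sqrt (2 * pi * n) = \<beta> / sqrt (2 * pi * v)"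
        using \<beta> n by (simp add: v real_sqrt_mult)
      ultimately show ?thesis
        by (simp add: normal_density_def log_const_def log_density_def exp_add[symmetric] exp_diff exp_minus field_simps)
    qed
    ultimately show ?thesis unfolding h G_def by simp
  qed
  have L0: "log_const r v > 0" using v0 by (simp add: log_const_def)
  have "gauss_integrable n (\<lambda>h. f (exp (- \<beta> * h) / c)) \<longleftrightarrow> integrable lborel (\<lambda>y. G (- ln c / \<beta> + (- 1 / \<beta>) * y))"
    unfolding gauss_integrable_def G_def using \<beta> by (subst lborel_integrable_real_affine_iff) auto
  also have "\<dots> \<longleftrightarrow> integrable lborel (\<lambda>y. f (exp y) * log_density r v y)"
    unfolding eq using L0 \<beta> by simp
  finally show "gauss_integrable n (\<lambda>h. f (exp (- \<beta> * h) / c)) \<longleftrightarrow> integrable lborel (\<lambda>y. f (exp y) * log_density r v y)" .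
  have "gauss_mean n (\<lambda>h. f (exp (- \<beta> * h) / c)) = \<bar>- 1 / \<beta>\<bar> *\<^sub>R (\<integral>y. G (- ln c / \<beta> + (- 1 / \<beta>) * y) \<partial>lborel)"
    unfolding gauss_mean_def G_def[symmetric] using \<beta> by (intro lborel_integral_real_affine) simp
  also have "\<dots> = log_const r v * (\<integral>y. f (exp y) * log_density r v y \<partial>lborel)"
    unfolding eq using \<beta> by simp
  finally show "gauss_mean n (\<lambda>h. f (exp (- \<beta> * h) / c)) = log_const r v * (\<integral>y. f (exp y) * log_density r v y \<partial>lborel)" .
qed

lemma log_density_le: "v > 0 \<Longrightarrow> log_density r v y \<le> exp (- r * y)"
  by (simp add: log_density_def)

text \<open>The Gaussian factor is at most 1, and without it the integral is an elementary
  exponential tail.\<close>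

lemma log_scale_upper_tail:
  assumes v: "v > 0" and r: "r > 0" and int: "integrable lborel (\<lambda>y. indicator {L..} y * log_density r v y)"
  shows "(\<integral>y. indicator {L..} y * log_density r v y \<partial>lborel) \<le> exp (- r * L) / r"
proof -
  note E = exp_half_line_integral(1)[OF r, of L]
  have "(\<integral>y. indicator {L..} y * log_density r v y \<partial>lborel) \<le> (\<integral>y. indicator {L..} y * exp (- r * y) \<partial>lborel)"
    using int E log_density_le[OF v]
    by (intro integral_mono) (auto simp: has_bochner_integral_iff intro: mult_left_mono)
  then show ?thesis using E by (simp add: has_bochner_integral_iff)
qed

text \<open>The unit interval next to 0 already carries enough mass, since constants are irrelevant
  and both r and 1 / v stay bounded in the application.\<close>

lemma log_scale_mass_lower:
  assumes v: "v > 0" and r: "r \<ge> 0" and int: "integrable lborel (\<lambda>y. indicator {0..} y * log_density r v y)"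
  shows "exp (- r - 1 / (2 * v)) \<le> (\<integral>y. indicator {0..} y * log_density r v y \<partial>lborel)"
proof -
  have "exp (- r - 1 / (2 * v)) = (\<integral>y. indicator {0..1::real} y * exp (- r - 1 / (2 * v)) \<partial>lborel)" by simp
  also have "\<dots> \<le> (\<integral>y. indicator {0..} y * log_density r v y \<partial>lborel)"
  proof (rule integral_mono)
    fix y :: real
    show "indicator {0..1} y * exp (- r - 1 / (2 * v)) \<le> indicator {0..} y * log_density r v y"
    proof (cases "y \<in> {0..1}")
      case True
      then have "r * y \<le> r" "y\<^sup>2 \<le> 1" using r by (auto simp: mult_left_le power_le_one)
      then have "- r - 1 / (2 * v) \<le> - r * y - y\<^sup>2 / (2 * v)" using v by (intro diff_mono divide_right_mono) auto
      then show ?thesis using True by (simp add: log_density_def)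
    qed (simp add: log_density_def)
  qed (use int in auto)
  finally show ?thesis .
qed

lemma log_scale_square_lower_tail:
  assumes v: "v > 0" and r: "r < 2" and int: "integrable lborel (\<lambda>y. indicator {..0} y * exp (2 * y) * log_density r v y)"
  shows "(\<integral>y. indicator {..0} y * exp (2 * y) * log_density r v y \<partial>lborel) \<le> 1 / (2 - r)"
proof -
  have r': "2 - r > 0" using r by simp
  note E = exp_half_line_integral(2)[OF r', of 0]
  have "(\<integral>y. indicator {..0} y * exp (2 * y) * log_density r v y \<partial>lborel) \<le> (\<integral>y. indicator {..0} y * exp ((2 - r) * y) \<partial>lborel)"
  proof (rule integral_mono)
    fix y
    have "exp (2 * y) * log_density r v y \<le> exp (2 * y) * exp (- r * y)" by (intro mult_left_mono log_density_le v) simp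
    also have "\<dots> = exp ((2 - r) * y)" by (simp add: exp_add[symmetric] algebra_simps)
    finally show "indicator {..0} y * exp (2 * y) * log_density r v y \<le> indicator {..0} y * exp ((2 - r) * y)"
      by (simp add: mult.assoc mult_left_mono)
  qed (use E int in \<open>auto simp: has_bochner_integral_iff\<close>)
  then show ?thesis using E by (simp add: has_bochner_integral_iff)
qed

text \<open>For r near 1 the factor exp y cancels the power law and the integrand is almost 1 on a
  window of fixed length L. As L is arbitrary, the mean diverges when r tends to 1 and v to
  infinity.\<close>

lemma log_scale_mean_lower:
  assumes v: "v > 0" and L: "L \<ge> 0" and int: "integrable lborel (\<lambda>y. indicator {..0} y * exp y * log_density r v y)"
  shows "L * exp (- L * \<bar>1 - r\<bar> - L\<^sup>2 / (2 * v)) \<le> (\<integral>y. indicator {..0} y * exp y * log_density r v y \<partial>lborel)"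
proof -
  let ?k = "exp (- L * \<bar>1 - r\<bar> - L\<^sup>2 / (2 * v))"
  have "L * ?k = (\<integral>y. indicator {-L..0} y * ?k \<partial>lborel)" using L by simp
  also have "\<dots> \<le> (\<integral>y. indicator {..0} y * exp y * log_density r v y \<partial>lborel)"
  proof (rule integral_mono)
    fix y :: real
    show "indicator {-L..0} y * ?k \<le> indicator {..0} y * exp y * log_density r v y"
    proof (cases "y \<in> {-L..0}")
      case True
      have "\<bar>(1 - r) * y\<bar> \<le> \<bar>1 - r\<bar> * L" unfolding abs_mult using True by (intro mult_left_mono) auto
      then have "- L * \<bar>1 - r\<bar> \<le> (1 - r) * y" by (simp add: mult.commute abs_le_iff)
      moreover have "y\<^sup>2 \<le> L\<^sup>2" using True by (simp add: abs_le_square_iff[symmetric])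
      then have "y\<^sup>2 / (2 * v) \<le> L\<^sup>2 / (2 * v)" using v by (intro divide_right_mono) auto
      ultimately have "- L * \<bar>1 - r\<bar> - L\<^sup>2 / (2 * v) \<le> y + (- r * y - y\<^sup>2 / (2 * v))"
        by (simp add: algebra_simps)
      then have "?k \<le> exp y * log_density r v y" unfolding log_density_def exp_add[symmetric] by simp
      then show ?thesis using True by simp
    qed (simp add: log_density_def)
  qed (use int L in auto)
  finally show ?thesis .
qed

section \<open>Probability of bad environments\<close>

text \<open>The good event may be non-measurable, because \<open>dev_prob\<close> as a function of the environment may be.\<close>

definition null_rate :: "'w measure \<Rightarrow> (nat \<Rightarrow> real) \<Rightarrow> (nat \<Rightarrow> 'w \<Rightarrow> bool) \<Rightarrow> bool" where
  "null_rate P s good \<longleftrightarrow>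
    (\<exists>C. \<forall>\<^sub>F n in sequentially. \<exists>A\<in>sets P. {w \<in> space P. \<not> good n w} \<subseteq> A \<and> measure P A \<le> C * s n)"

lemma null_rate_mono:
  assumes "null_rate P s good" "\<forall>\<^sub>F n in sequentially. \<forall>w\<in>space P. good n w \<longrightarrow> good' n w"
  shows "null_rate P s good'"
proof -
  obtain C where "\<forall>\<^sub>F n in sequentially. \<exists>A\<in>sets P. {w \<in> space P. \<not> good n w} \<subseteq> A \<and> measure P A \<le> C * s n"
    using assms(1) unfolding null_rate_def by blast
  with assms(2) have "\<forall>\<^sub>F n in sequentially. \<exists>A\<in>sets P. {w \<in> space P. \<not> good' n w} \<subseteq> A \<and> measure P A \<le> C * s n"
  proof eventually_elim
    case (elim n)
    then obtain A where "A \<in> sets P" "{w \<in> space P. \<not> good n w} \<subseteq> A" "measure P A \<le> C * s n" by auto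
    then show ?case using elim(1) by (intro bexI[of _ A]) auto
  qed
  then show ?thesis unfolding null_rate_def by blast
qed

context prob_space
begin

lemma null_rate_AE:
  assumes "null_rate M s good" "summable s"
  shows "AE w in M. \<forall>\<^sub>F n in sequentially. good n w"
proof -
  obtain C where "\<forall>\<^sub>F n in sequentially. \<exists>A\<in>events. {w \<in> space M. \<not> good n w} \<subseteq> A \<and> prob A \<le> C * s n"
    using assms(1) unfolding null_rate_def by blast
  then obtain N where N: "\<And>n. n \<ge> N \<Longrightarrow> \<exists>A\<in>events. {w \<in> space M. \<not> good n w} \<subseteq> A \<and> prob A \<le> C * s n"
    unfolding eventually_sequentially by blast
  \<comment> \<open>Borel-Cantelli needs one measurable cover for every index; the finitely many
    indices without a guaranteed cover get the empty set.\<close>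
  define A where "A n = (if n \<ge> N then SOME A. A \<in> events \<and> {w \<in> space M. \<not> good n w} \<subseteq> A \<and> prob A \<le> C * s n else {})" for n
  have A: "A n \<in> events" "{w \<in> space M. \<not> good n w} \<subseteq> A n" "prob (A n) \<le> C * s n" if "n \<ge> N" for n
    using someI_ex[of "\<lambda>A. A \<in> events \<and> {w \<in> space M. \<not> good n w} \<subseteq> A \<and> prob A \<le> C * s n"] N[OF that] that
    unfolding A_def Bex_def by simp_all
  have ev: "A n \<in> events" for n using A(1)[of n] by (cases "n \<ge> N") (auto simp: A_def)
  have "summable (\<lambda>n. prob (A n))"
  proof (rule summable_comparison_test_ev)
    show "\<forall>\<^sub>F n in sequentially. norm (prob (A n)) \<le> C * s n"
      using A(3) by (auto simp: eventually_sequentially)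
  qed (intro summable_mult assms)
  then have "AE w in M. \<forall>\<^sub>F n in sequentially. w \<in> space M - A n"
    by (intro borel_cantelli_AE1 ev) (auto simp: emeasure_eq_measure)
  then show ?thesis
  proof (rule AE_mp, intro AE_I2 impI)
    fix w assume w: "w \<in> space M" and ev: "\<forall>\<^sub>F n in sequentially. w \<in> space M - A n"
    show "\<forall>\<^sub>F n in sequentially. good n w"
      using ev eventually_ge_at_top[of N] by eventually_elim (use A(2) w in blast)
  qed
qed

text \<open>The exceptional null set depends on the tolerance, so countably many tolerances tending
  to 0 are intersected.\<close>

lemma null_rate_AE_tendsto:
  assumes rate: "\<And>\<eta>. \<eta> > 0 \<Longrightarrow> null_rate M s (\<lambda>n w. \<bar>f n w\<bar> \<le> \<eta>)" and "summable s"
  shows "AE w in M. (\<lambda>n. f n w) \<longlonglongrightarrow> (0 :: real)"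
proof -
  have "AE w in M. \<forall>k. \<forall>\<^sub>F n in sequentially. \<bar>f n w\<bar> \<le> inverse (real (Suc k))"
    unfolding AE_all_countable by (intro allI null_rate_AE[OF rate assms(2)]) simp
  then show ?thesis
  proof eventually_elim
    case (elim w)
    show ?case
    proof (rule tendstoI)
      fix e :: real assume "e > 0"
      then obtain k where k: "inverse (real (Suc k)) < e" using reals_Archimedean by blast
      show "\<forall>\<^sub>F n in sequentially. dist (f n w) 0 < e"
        using elim[rule_format, of k] by eventually_elim (use k in simp)
    qed
  qed
qed

lemma null_rate_in_prob:
  assumes rate: "\<And>\<eta>. \<eta> > 0 \<Longrightarrow> null_rate M s (\<lambda>n w. \<bar>f n w\<bar> \<le> \<eta>)" and "s \<longlonglongrightarrow> 0"
  shows "tendsto_in_prob M f 0"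
  unfolding tendsto_in_prob_def
proof (intro allI impI)
  fix \<eta> :: real assume "\<eta> > 0"
  then obtain C where C: "\<forall>\<^sub>F n in sequentially. \<exists>A\<in>events. {w \<in> space M. \<not> \<bar>f n w\<bar> \<le> \<eta>} \<subseteq> A \<and> prob A \<le> C * s n"
    using rate unfolding null_rate_def by blast
  show "(\<lambda>n. prob {w \<in> space M. \<bar>f n w - 0\<bar> > \<eta>}) \<longlonglongrightarrow> 0"
  proof (rule tendsto_sandwich[of "\<lambda>_. 0"])
    show "\<forall>\<^sub>F n in sequentially. prob {w \<in> space M. \<bar>f n w - 0\<bar> > \<eta>} \<le> C * s n"
      using C
    proof eventually_elim
      case (elim n)
      then obtain A where "A \<in> events" "{w \<in> space M. \<not> \<bar>f n w\<bar> \<le> \<eta>} \<subseteq> A" "prob A \<le> C * s n" by auto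
      \<comment> \<open>Only the cover has to be measurable here; a non-measurable event has measure
        0 by convention, so the bound holds for it as well.\<close>
      then show ?case using finite_measure_mono[of "{w \<in> space M. \<bar>f n w - 0\<bar> > \<eta>}" A] by (auto simp: not_le)
    qed
    show "(\<lambda>n. C * s n) \<longlonglongrightarrow> 0" using tendsto_mult_right_zero[OF assms(2)] .
  qed auto
qed

end

section \<open>Failure probability of the good environment\<close>

context random_environment
begin

lemma gauss_mean_mono:
  assumes n: "n \<ge> 1" and F: "F \<in> borel_measurable borel" "\<And>h. \<bar>F h\<bar> \<le> K"
    and G: "G \<in> borel_measurable borel" "\<And>h. \<bar>G h\<bar> \<le> L" and le: "\<And>h. F h \<le> G h"
  shows "gauss_mean n F \<le> gauss_mean n G"
proof -
  obtain x where x: "x \<in> cube n" using cube_nonempty by blast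
  have "expectation (\<lambda>w. F (H n x w)) \<le> expectation (\<lambda>w. G (H n x w))"
    using bounded_rv_integrable[OF bounded_rv_F[OF n F x]] bounded_rv_integrable[OF bounded_rv_F[OF n G x]] le
    by (intro integral_mono)
  then show ?thesis by (simp add: expectation_fun_H[OF n x] F G)
qed

text \<open>Each condition holds for the Gaussian means with room to spare, and Chebyshev's
  inequality controls the deviation of the empirical quantities. Thresholds scale like 1 / a, so
  each of the first three events costs a / 2 ^ n times a scaled mean; the quadratic form costs only
  1 / 2 ^ n.\<close>

lemma good_env_fail:
  assumes n: "n \<ge> 1" and a: "1 \<le> a" and b: "0 \<le> b" "b \<le> d" and d: "d > 0" and \<rho>: "0 < \<rho>"
    and F: "F \<in> borel_measurable borel" "\<And>h. 0 \<le> F h" "\<And>h. F h \<le> b" and B: "B \<in> sets borel"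
    and r: "a * gauss_mean n (indicator B) \<le> \<rho> / 2"
    and q: "a * gauss_mean n (\<lambda>h. (F h)\<^sup>2) / d\<^sup>2 \<le> min 1 (\<rho> / 800)"
    and mean: "\<bar>a * gauss_mean n F / d - 1\<bar> \<le> \<rho> / 2"
  shows "\<exists>A\<in>events. {w \<in> space P. \<not> good_env n a d \<rho> (\<lambda>x. F (H n x w)) {x. H n x w \<in> B}} \<subseteq> A \<and>
    prob A \<le> (10 ^ 6 / \<rho>\<^sup>2) * (a / 2 ^ n * (a * gauss_mean n (indicator B) + a * gauss_mean n (\<lambda>h. (F h)\<^sup>2) / d\<^sup>2) + 1 / 2 ^ n)"
proof -
  define r' where "r' = a * gauss_mean n (indicator B)"
  define v where "v = gauss_mean n (\<lambda>h. (F h)\<^sup>2)"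
  define q' where "q' = a * v / d\<^sup>2"
  have I: "(indicator B :: real \<Rightarrow> real) \<in> borel_measurable borel" "\<And>h. \<bar>indicator B h :: real\<bar> \<le> 1"
    using B by (auto simp: indicator_def)
  have F': "\<And>h. \<bar>F h\<bar> \<le> b" using F by simp
  have F2: "(\<lambda>h. (F h)\<^sup>2) \<in> borel_measurable borel" using F(1) by measurable
  have F2': "\<bar>(F h)\<^sup>2\<bar> \<le> b\<^sup>2" for h using F by (simp add: power_mono)
  have v0: "v \<ge> 0" using gauss_mean_sq_le[OF n F(1) F'] by (auto simp: v_def intro: order_trans[OF zero_le_power2])
  have q1: "q' \<le> \<rho> / 800" using q by (simp add: q'_def v_def)
  have q0: "q' \<ge> 0" using v0 a by (simp add: q'_def)
  have r0: "r' \<ge> 0" using gauss_mean_mono[OF n, of "\<lambda>_. 0" 0 "indicator B" 1] I a by (simp add: r'_def gauss_mean_def)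
  \<comment> \<open>After multiplication by a, a / d or the squared analogue, the allowed
    fluctuations are \<rho> / 2, \<rho> / 2, \<rho> / 800 and \<rho> / 2. The value 800 is taken so
    that 96 / 400 + 96 / 800 + 1 / 2 stays below 1 when the form is assembled.\<close>
  define A1 where "A1 = {w \<in> space P. \<rho> / (2 * a) \<le> \<bar>cube_avg n (\<lambda>x. indicator B (H n x w)) - gauss_mean n (indicator B)\<bar>}"
  define A2 where "A2 = {w \<in> space P. \<rho> * d / (2 * a) \<le> \<bar>cube_avg n (\<lambda>x. F (H n x w)) - gauss_mean n F\<bar>}"
  define A3 where "A3 = {w \<in> space P. \<rho> * d\<^sup>2 / (800 * a) \<le> \<bar>cube_avg n (\<lambda>x. (F (H n x w))\<^sup>2) - v\<bar>}"
  define A4 where "A4 = {w \<in> space P. 96 * cube_avg n (\<lambda>x. (F (H n x w))\<^sup>2) + 96 * v + \<rho> * d\<^sup>2 / (2 * a)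
      \<le> asymp_var n (\<lambda>x. F (H n x w))}"
  note [measurable] = measurable_avg_F[OF n I] measurable_avg_F[OF n F(1) F'] measurable_avg_F[OF n F2 F2']
    measurable_asymp_var_F[OF n F(1) F']
  have ev: "A1 \<in> events" "A2 \<in> events" "A3 \<in> events" "A4 \<in> events"
    unfolding A1_def A2_def A3_def A4_def by measurable
  have p1: "prob A1 \<le> 4 / \<rho>\<^sup>2 * (a / 2 ^ n * r')"
  proof -
    have "\<rho> / (2 * a) > 0" using a \<rho> by simp
    from prob_avg_deviation[OF n I this]
    have "prob A1 \<le> gauss_mean n (\<lambda>h. (indicator B h)\<^sup>2) / 2 ^ n / (\<rho> / (2 * a))\<^sup>2" unfolding A1_def .
    also have "(\<lambda>h. (indicator B h :: real)\<^sup>2) = indicator B" by (auto simp: indicator_def)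
    finally show ?thesis using a by (simp add: r'_def power_divide power_mult_distrib power2_eq_square mult_ac)
  qed
  have p2: "prob A2 \<le> 4 / \<rho>\<^sup>2 * (a / 2 ^ n * q')"
  proof -
    have "\<rho> * d / (2 * a) > 0" using a \<rho> d by simp
    from prob_avg_deviation[OF n F(1) F' this]
    have "prob A2 \<le> v / 2 ^ n / (\<rho> * d / (2 * a))\<^sup>2" unfolding A2_def v_def .
    then show ?thesis using a by (simp add: q'_def power_divide power_mult_distrib power2_eq_square mult_ac)
  qed
  have p3: "prob A3 \<le> 640000 / \<rho>\<^sup>2 * (a / 2 ^ n * q')"
  proof -
    \<comment> \<open>This is where truncation below d pays: the fourth moment is reduced to the
      second.\<close>
    have "gauss_mean n (\<lambda>h. ((F h)\<^sup>2)\<^sup>2) \<le> gauss_mean n (\<lambda>h. d\<^sup>2 * (F h)\<^sup>2)"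
    proof (rule gauss_mean_mono[OF n])
      fix h
      have Fd: "F h \<le> d" using F(3)[of h] b by linarith
      show le: "((F h)\<^sup>2)\<^sup>2 \<le> d\<^sup>2 * (F h)\<^sup>2"
        unfolding power2_eq_square[of "(F h)\<^sup>2"] using Fd F(2) by (intro mult_right_mono power_mono) auto
      show "\<bar>d\<^sup>2 * (F h)\<^sup>2\<bar> \<le> d\<^sup>2 * b\<^sup>2" using F2'[of h] by (simp add: abs_mult mult_left_mono)
      have "((F h)\<^sup>2)\<^sup>2 \<le> (b\<^sup>2)\<^sup>2" using F2'[of h] by (intro power_mono[of "(F h)\<^sup>2"]) auto
      then show "\<bar>((F h)\<^sup>2)\<^sup>2\<bar> \<le> (b\<^sup>2)\<^sup>2" by simp
    qed (use F(1) in measurable)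
    also have "gauss_mean n (\<lambda>h. d\<^sup>2 * (F h)\<^sup>2) = d\<^sup>2 * v" unfolding gauss_mean_cmult v_def ..
    finally have le: "gauss_mean n (\<lambda>h. ((F h)\<^sup>2)\<^sup>2) \<le> d\<^sup>2 * v" .
    have "\<rho> * d\<^sup>2 / (800 * a) > 0" using a \<rho> d by simp
    from prob_avg_deviation[OF n F2 F2' this]
    have "prob A3 \<le> gauss_mean n (\<lambda>h. ((F h)\<^sup>2)\<^sup>2) / 2 ^ n / (\<rho> * d\<^sup>2 / (800 * a))\<^sup>2" unfolding A3_def v_def .
    also have "\<dots> \<le> d\<^sup>2 * v / 2 ^ n / (\<rho> * d\<^sup>2 / (800 * a))\<^sup>2" by (intro divide_right_mono le) simp_all
    finally show ?thesis
      using a d by (simp add: q'_def power_divide power_mult_distrib power2_eq_square mult_ac)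
  qed
  have p4: "prob A4 \<le> 768 / \<rho>\<^sup>2 * (1 / 2 ^ n)"
  proof -
    have "\<rho> * d\<^sup>2 / (2 * a) > 0" using a \<rho> d by simp
    from prob_asymp_var_deviation[OF n F(1) F' this]
    have "prob A4 \<le> 192 * v\<^sup>2 / 2 ^ n / (\<rho> * d\<^sup>2 / (2 * a))\<^sup>2" unfolding A4_def v_def .
    also have "\<dots> = 768 / \<rho>\<^sup>2 * (q'\<^sup>2 / 2 ^ n)"
      using a d by (simp add: q'_def power_divide power_mult_distrib mult_ac)
    also have "\<dots> \<le> 768 / \<rho>\<^sup>2 * (1 / 2 ^ n)"
      using q q0 by (intro mult_left_mono divide_right_mono power_le_one) (auto simp: q'_def v_def)
    finally show ?thesis .
  qed
  show ?thesis
  proof (intro bexI[of _ "A1 \<union> A2 \<union> A3 \<union> A4"] conjI subsetI)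
    fix w assume w: "w \<in> {w \<in> space P. \<not> good_env n a d \<rho> (\<lambda>x. F (H n x w)) {x. H n x w \<in> B}}"
    show "w \<in> A1 \<union> A2 \<union> A3 \<union> A4"
    proof (rule ccontr)
      assume no: "w \<notin> A1 \<union> A2 \<union> A3 \<union> A4"
      have sp: "w \<in> space P" using w by simp
      have n1: "\<bar>cube_avg n (\<lambda>x. indicator B (H n x w)) - gauss_mean n (indicator B)\<bar> < \<rho> / (2 * a)"
        and n2: "\<bar>cube_avg n (\<lambda>x. F (H n x w)) - gauss_mean n F\<bar> < \<rho> * d / (2 * a)"
        and n3: "\<bar>cube_avg n (\<lambda>x. (F (H n x w))\<^sup>2) - v\<bar> < \<rho> * d\<^sup>2 / (800 * a)"
        and n4: "asymp_var n (\<lambda>x. F (H n x w)) < 96 * cube_avg n (\<lambda>x. (F (H n x w))\<^sup>2) + 96 * v + \<rho> * d\<^sup>2 / (2 * a)"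
        using no sp unfolding A1_def A2_def A3_def A4_def by auto
      have "a * cube_avg n (\<lambda>x. indicator B (H n x w)) \<le> \<rho>"
      proof -
        have "cube_avg n (\<lambda>x. indicator B (H n x w)) \<le> gauss_mean n (indicator B) + \<rho> / (2 * a)" using n1 by linarith
        then have "a * cube_avg n (\<lambda>x. indicator B (H n x w)) \<le> a * (gauss_mean n (indicator B) + \<rho> / (2 * a))"
          using a by (intro mult_left_mono) auto
        also have "\<dots> = r' + \<rho> / 2" using a by (simp add: r'_def distrib_left)
        finally show ?thesis using r by (simp add: r'_def)
      qed
      moreover have "(\<lambda>x. indicator B (H n x w) :: real) = indicator {x. H n x w \<in> B}" by (auto simp: indicator_def)
      ultimately have g1: "a * cube_avg n (indicator {x. H n x w \<in> B}) \<le> \<rho>" by simp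
      have g2: "\<bar>a * cube_avg n (\<lambda>x. F (H n x w)) / d - 1\<bar> \<le> \<rho>"
      proof -
        have "\<bar>a * cube_avg n (\<lambda>x. F (H n x w)) / d - a * gauss_mean n F / d\<bar>
           = a / d * \<bar>cube_avg n (\<lambda>x. F (H n x w)) - gauss_mean n F\<bar>"
        proof -
          have "a * cube_avg n (\<lambda>x. F (H n x w)) / d - a * gauss_mean n F / d
            = a / d * (cube_avg n (\<lambda>x. F (H n x w)) - gauss_mean n F)"
            by (simp add: diff_divide_distrib right_diff_distrib)
          then show ?thesis using a d by (simp add: abs_mult)
        qed
        also have "\<dots> \<le> a / d * (\<rho> * d / (2 * a))" using n2 a d by (intro mult_left_mono) auto
        also have "\<dots> = \<rho> / 2" using a d by simp
        finally show ?thesis using mean by linarith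
      qed
      have g3': "a * cube_avg n (\<lambda>x. (F (H n x w))\<^sup>2) / d\<^sup>2 \<le> \<rho> / 400"
      proof -
        have "a / d\<^sup>2 * cube_avg n (\<lambda>x. (F (H n x w))\<^sup>2) \<le> a / d\<^sup>2 * (v + \<rho> * d\<^sup>2 / (800 * a))"
          using n3 a d by (intro mult_left_mono) auto
        also have "\<dots> = q' + \<rho> / 800" using a d by (simp add: q'_def field_simps)
        also have "\<dots> \<le> \<rho> / 800 + \<rho> / 800" using q1 by linarith
        finally show ?thesis by simp
      qed
      have g4: "a * asymp_var n (\<lambda>x. F (H n x w)) / d\<^sup>2 \<le> \<rho>"
      proof -
        have "a / d\<^sup>2 * asymp_var n (\<lambda>x. F (H n x w))
           \<le> a / d\<^sup>2 * (96 * cube_avg n (\<lambda>x. (F (H n x w))\<^sup>2) + 96 * v + \<rho> * d\<^sup>2 / (2 * a))"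
          using n4 a d by (intro mult_left_mono) auto
        also have "\<dots> = 96 * (a * cube_avg n (\<lambda>x. (F (H n x w))\<^sup>2) / d\<^sup>2) + 96 * q' + \<rho> / 2"
          using a d by (simp add: q'_def field_simps)
        also have "\<dots> \<le> 96 * (\<rho> / 400) + 96 * (\<rho> / 800) + \<rho> / 2"
          using g3' q1 by (intro add_mono mult_left_mono) auto
        also have "\<dots> \<le> \<rho>" using \<rho> by simp
        finally show ?thesis by simp
      qed
      show False using w g1 g2 g3' g4 \<rho> by (simp add: good_env_def)
    qed
  next
    \<comment> \<open>The constants are 4 and 640000 (the square of 800) for the averages, their sum
      for the terms sharing the scaled second moment, and 768 = 4 * 192 for the form; 10^6 is a
      common majorant.\<close>
    have \<rho>2: "4 / \<rho>\<^sup>2 \<le> 10 ^ 6 / \<rho>\<^sup>2" "640004 / \<rho>\<^sup>2 \<le> 10 ^ 6 / \<rho>\<^sup>2" "768 / \<rho>\<^sup>2 \<le> 10 ^ 6 / \<rho>\<^sup>2"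
      using \<rho> by (intro divide_right_mono; simp)+
    have "prob (A1 \<union> A2 \<union> A3 \<union> A4) \<le> prob A1 + prob A2 + prob A3 + prob A4"
      using measure_Un_le[of "A1 \<union> A2 \<union> A3" P A4] measure_Un_le[of "A1 \<union> A2" P A3] measure_Un_le[of A1 P A2] ev by auto
    also have "\<dots> \<le> 4 / \<rho>\<^sup>2 * (a / 2 ^ n * r') + 640004 / \<rho>\<^sup>2 * (a / 2 ^ n * q') + 768 / \<rho>\<^sup>2 * (1 / 2 ^ n)"
      using p1 p2 p3 p4 by (simp add: add_divide_distrib distrib_right)
    also have "\<dots> \<le> 10 ^ 6 / \<rho>\<^sup>2 * (a / 2 ^ n * r') + 10 ^ 6 / \<rho>\<^sup>2 * (a / 2 ^ n * q') + 10 ^ 6 / \<rho>\<^sup>2 * (1 / 2 ^ n)"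
      using a r0 q0 by (intro add_mono mult_right_mono \<rho>2) auto
    also have "\<dots> = 10 ^ 6 / \<rho>\<^sup>2 * (a / 2 ^ n * (r' + q') + 1 / 2 ^ n)" by (simp add: distrib_left)
    finally show "prob (A1 \<union> A2 \<union> A3 \<union> A4) \<le> (10 ^ 6 / \<rho>\<^sup>2) * (a / 2 ^ n * (a * gauss_mean n (indicator B)
        + a * gauss_mean n (\<lambda>h. (F h)\<^sup>2) / d\<^sup>2) + 1 / 2 ^ n)"
      unfolding r'_def q'_def v_def .
  qed (use ev in auto)
qed

end

context random_environment
begin

text \<open>The three limits bring the assumptions of \<open>good_env_fail\<close> into force from
  some index on, for any fixed \<rho>. The value of \<rho> then affects only the constant in the
  rate, which \<open>null_rate\<close> leaves free.\<close>

lemma null_rate_good_env: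
  fixes a b d s :: "nat \<Rightarrow> real" and F :: "nat \<Rightarrow> real \<Rightarrow> real" and B :: "nat \<Rightarrow> real set"
  assumes ev: "\<forall>\<^sub>F n in sequentially. 1 \<le> a n \<and> 0 \<le> b n \<and> b n \<le> d n \<and> 0 < d n"
    and F: "\<And>n. F n \<in> borel_measurable borel" "\<forall>\<^sub>F n in sequentially. \<forall>h. 0 \<le> F n h \<and> F n h \<le> b n"
    and B: "\<And>n. B n \<in> sets borel"
    and r: "(\<lambda>n. a n * gauss_mean n (indicator (B n))) \<longlonglongrightarrow> 0"
    and q: "(\<lambda>n. a n * gauss_mean n (\<lambda>h. (F n h)\<^sup>2) / (d n)\<^sup>2) \<longlonglongrightarrow> 0"
    and mean: "(\<lambda>n. a n * gauss_mean n (F n) / d n) \<longlonglongrightarrow> 1"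
    and s: "\<forall>\<^sub>F n in sequentially. a n / 2 ^ n * (a n * gauss_mean n (indicator (B n)) +
        a n * gauss_mean n (\<lambda>h. (F n h)\<^sup>2) / (d n)\<^sup>2) + 1 / 2 ^ n \<le> C * s n"
    and \<rho>: "\<rho> > 0"
  shows "null_rate P s (\<lambda>n w. good_env n (a n) (d n) \<rho> (\<lambda>x. F n (H n x w)) {x. H n x w \<in> B n})"
proof -
  have "\<forall>\<^sub>F n in sequentially. a n * gauss_mean n (indicator (B n)) < \<rho> / 2" using r \<rho> by (intro order_tendstoD) auto
  moreover have "\<forall>\<^sub>F n in sequentially. a n * gauss_mean n (\<lambda>h. (F n h)\<^sup>2) / (d n)\<^sup>2 < min 1 (\<rho> / 800)"
    using q \<rho> by (intro order_tendstoD) auto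
  moreover have "\<forall>\<^sub>F n in sequentially. \<bar>a n * gauss_mean n (F n) / d n - 1\<bar> < \<rho> / 2"
    using tendstoD[OF mean, of "\<rho> / 2"] \<rho> by (simp add: dist_real_def)
  ultimately have "\<forall>\<^sub>F n in sequentially. \<exists>A\<in>events.
      {w \<in> space P. \<not> good_env n (a n) (d n) \<rho> (\<lambda>x. F n (H n x w)) {x. H n x w \<in> B n}} \<subseteq> A \<and>
      prob A \<le> (10 ^ 6 / \<rho>\<^sup>2 * C) * s n"
    using ev F(2) s eventually_ge_at_top[of 1]
  proof eventually_elim
    case (elim n)
    have "\<exists>A\<in>events. {w \<in> space P. \<not> good_env n (a n) (d n) \<rho> (\<lambda>x. F n (H n x w)) {x. H n x w \<in> B n}} \<subseteq> A \<and>
      prob A \<le> (10 ^ 6 / \<rho>\<^sup>2) * (a n / 2 ^ n * (a n * gauss_mean n (indicator (B n)) +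
        a n * gauss_mean n (\<lambda>h. (F n h)\<^sup>2) / (d n)\<^sup>2) + 1 / 2 ^ n)"
      by (rule good_env_fail[where b="b n"]) (use elim F(1) B \<rho> in auto)
    then obtain A where A: "A \<in> events" "{w \<in> space P. \<not> good_env n (a n) (d n) \<rho> (\<lambda>x. F n (H n x w)) {x. H n x w \<in> B n}} \<subseteq> A"
      "prob A \<le> (10 ^ 6 / \<rho>\<^sup>2) * (a n / 2 ^ n * (a n * gauss_mean n (indicator (B n)) +
        a n * gauss_mean n (\<lambda>h. (F n h)\<^sup>2) / (d n)\<^sup>2) + 1 / 2 ^ n)" by blast
    note A(3)
    also have "(10 ^ 6 / \<rho>\<^sup>2) * (a n / 2 ^ n * (a n * gauss_mean n (indicator (B n)) +
        a n * gauss_mean n (\<lambda>h. (F n h)\<^sup>2) / (d n)\<^sup>2) + 1 / 2 ^ n) \<le> (10 ^ 6 / \<rho>\<^sup>2) * (C * s n)"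
      by (intro mult_left_mono) (use elim in auto)
    finally show ?case using A(1,2) by (intro bexI[of _ A]) (auto simp: mult.assoc)
  qed
  then show ?thesis unfolding null_rate_def by blast
qed

end

text \<open>The trap mean behaves like min x 1. The bound x / 2 transfers the divergence of the
  truncated mean to d, and x - \<open>x\<^sup>2\<close> makes truncation and trap mean agree up to a
  second moment. Both come from lower bounds on exp (1 / x), by 2 and by 1 / x.\<close>

lemma trap_mean_bounds:
  fixes x :: real
  assumes x: "x > 0"
  shows "0 \<le> trap_mean x" "trap_mean x \<le> 1" "trap_mean x \<le> x" "x \<le> 1 \<Longrightarrow> x / 2 \<le> trap_mean x" "x - x\<^sup>2 \<le> trap_mean x"
proof -
  show "0 \<le> trap_mean x" "trap_mean x \<le> x" using x by (auto simp: mult_left_le)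
  have "1 + - 1 / x \<le> exp (- 1 / x)" by (rule exp_ge_add_one_self)
  then have "1 - exp (- 1 / x) \<le> 1 / x" by simp
  then have "trap_mean x \<le> x * (1 / x)" using x by (intro mult_left_mono) auto
  then show "trap_mean x \<le> 1" using x by simp
  have "1 / x \<le> exp (1 / x)" using exp_ge_add_one_self[of "1 / x"] by linarith
  then have "inverse (exp (1 / x)) \<le> inverse (1 / x)" using x by (intro le_imp_inverse_le) auto
  then have e: "exp (- 1 / x) \<le> x" by (simp add: exp_minus)
  then have "x * (1 - x) \<le> trap_mean x" using x by (intro mult_left_mono) auto
  then show "x - x\<^sup>2 \<le> trap_mean x" by (simp add: power2_eq_square algebra_simps)
  assume "x \<le> 1"
  then have "1 \<le> 1 / x" using x by simp
  then have "exp 1 \<le> exp (1 / x)" by simp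
  then have "2 \<le> exp (1 / x)" using exp_ge_add_one_self[of 1] by linarith
  then have "inverse (exp (1 / x)) \<le> inverse 2" by (intro le_imp_inverse_le) auto
  then have "exp (- 1 / x) \<le> 1 / 2" by (simp add: exp_minus)
  then have "x * (1 / 2) \<le> trap_mean x" using x by (intro mult_left_mono) auto
  then show "x / 2 \<le> trap_mean x" by simp
qed

section \<open>Critical scale\<close>

text \<open>Isolates the deterministic asymptotics: the environment enters only through Gaussian
  means, and \<open>crit\<close> is alpha = 1 in squared form.\<close>

locale critical_scale =
  fixes \<beta> \<epsilon> :: real and a c :: "nat \<Rightarrow> real"
  assumes \<beta>: "\<beta> > 0" and \<epsilon>: "\<epsilon> > 0" and crit: "\<beta>\<^sup>2 = 2 * \<epsilon> * ln 2"
    and c: "filterlim c at_top sequentially" and a_pos: "\<And>n. n \<ge> 1 \<Longrightarrow> a n > 0"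
    and scale: "\<And>n. n \<ge> 1 \<Longrightarrow> c n > 0 \<Longrightarrow> a n * gauss_mean n (\<lambda>h. indicator {1..} (exp (- \<beta> * h) / c n)) = 1"
    and growth: "(\<lambda>n. ln (a n) / (real n * ln 2)) \<longlonglongrightarrow> \<epsilon>"
begin

definition v :: "nat \<Rightarrow> real" where "v n = real n * \<beta>\<^sup>2"
text \<open>The effective tail index of the rescaled trap depth at level 1, a finite n version of
  alpha; \<open>v\<close> is the variance of the logarithm of the depth.\<close>

definition r :: "nat \<Rightarrow> real" where "r n = ln (c n) / v n"

lemma v_pos: "n \<ge> 1 \<Longrightarrow> v n > 0" using \<beta> by (simp add: v_def)

lemma v_at_top: "filterlim v at_top sequentially"
  unfolding v_def using \<beta> by (intro filterlim_at_top_mult_tendsto_pos[OF tendsto_const _ filterlim_real_sequentially]) auto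

lemma inverse_v_0: "(\<lambda>n. 1 / v n) \<longlonglongrightarrow> 0"
  using tendsto_inverse_0_at_top[OF v_at_top] by (simp add: inverse_eq_divide)

lemma bounded_scale_fun:
  assumes n: "n \<ge> 1" and cn: "c n > 0" and f: "f \<in> borel_measurable borel" "\<And>x. x > 0 \<Longrightarrow> \<bar>f x\<bar> \<le> K"
  shows "gauss_integrable n (\<lambda>h. f (exp (- \<beta> * h) / c n))"
    "integrable lborel (\<lambda>y. f (exp y) * log_density (r n) (v n) y)"
    "gauss_mean n (\<lambda>h. f (exp (- \<beta> * h) / c n)) = log_const (r n) (v n) * (\<integral>y. f (exp y) * log_density (r n) (v n) y \<partial>lborel)"
proof -
  show 1: "gauss_integrable n (\<lambda>h. f (exp (- \<beta> * h) / c n))"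
    by (rule gauss_integrable_bounded[OF n, of _ K]) (use cn f in auto)
  show "integrable lborel (\<lambda>y. f (exp y) * log_density (r n) (v n) y)"
    "gauss_mean n (\<lambda>h. f (exp (- \<beta> * h) / c n)) = log_const (r n) (v n) * (\<integral>y. f (exp y) * log_density (r n) (v n) y \<partial>lborel)"
    using gauss_mean_log_scale[OF n \<beta> cn v_def r_def, of f] 1 by auto
qed

lemma upper_set:
  fixes b y :: real
  shows "b > 0 \<Longrightarrow> indicator {b..} (exp y) = (indicator {ln b..} y :: real)"
  using exp_le_cancel_iff[of "ln b" y] by (simp add: indicator_def del: exp_le_cancel_iff)

lemma c_ge_1: "\<forall>\<^sub>F n in sequentially. n \<ge> 1 \<and> c n \<ge> 1"
  using eventually_ge_at_top[of 1] filterlim_at_top[THEN iffD1, OF c, rule_format, of 1] by eventually_elim simp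

text \<open>All bounds read the normalisation a P(gamma \<ge> 1) = 1 on the logarithmic scale,
  estimating the mass of the half-line from above by Chernoff or by its exponential tail, and from
  below by its first unit interval.\<close>

lemma mass_bounds:
  assumes n: "n \<ge> 1" and cn: "c n \<ge> 1"
  shows "(r n)\<^sup>2 * v n / 2 \<le> ln (a n)"
    "ln (a n) \<le> (r n)\<^sup>2 * v n / 2 + ln (2 * pi * v n) / 2 + r n + 1 / (2 * v n)"
    "a n * log_const (r n) (v n) * exp (- r n - 1 / (2 * v n)) \<le> 1"
    "r n > 0 \<Longrightarrow> 1 \<le> a n * log_const (r n) (v n) * (1 / r n)"
    "r n \<ge> 0"
proof -
  have v0: "v n > 0" by (rule v_pos[OF n])
  show r0: "r n \<ge> 0" using cn v0 by (simp add: r_def)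
  have c0: "c n > 0" using cn by simp
  have lnc: "ln (c n) = r n * v n" using v0 by (simp add: r_def)
  note I = bounded_scale_fun[OF n c0, of "indicator {1..}" 1]
  have ind: "(\<lambda>y. indicator {1..} (exp y) * log_density (r n) (v n) y) = (\<lambda>y. indicator {0..} y * log_density (r n) (v n) y)"
    using upper_set[OF zero_less_one] by simp
  have int: "integrable lborel (\<lambda>y. indicator {0..} y * log_density (r n) (v n) y)" using I(2) by (simp add: ind)
  define D where "D = (\<integral>y. indicator {0..} y * log_density (r n) (v n) y \<partial>lborel)"
  have one: "a n * (log_const (r n) (v n) * D) = 1" using scale[OF n c0] I(3) by (simp add: ind D_def)
  have low: "exp (- r n - 1 / (2 * v n)) \<le> D" unfolding D_def by (rule log_scale_mass_lower[OF v0 r0 int])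
  have L0: "log_const (r n) (v n) > 0" using v0 by (simp add: log_const_def)
  have aL: "a n * log_const (r n) (v n) > 0" using L0 a_pos[OF n] by simp
  show third: "a n * log_const (r n) (v n) * exp (- r n - 1 / (2 * v n)) \<le> 1"
    using mult_left_mono[OF low less_imp_le[OF aL]] one by (simp add: mult.assoc)
  show "1 \<le> a n * log_const (r n) (v n) * (1 / r n)" if "r n > 0"
  proof -
    have "D \<le> 1 / r n" using log_scale_upper_tail[OF v0 that, of 0] int by (simp add: D_def)
    then show ?thesis using mult_left_mono[OF _ less_imp_le[OF aL], of D "1 / r n"] one by (simp add: mult.assoc)
  qed
  \<comment> \<open>Chernoff's bound with the s-th moment gives the exponent
    \<open>s\<^sup>2 * v / 2\<close> - s r v, which is minimal at s = r.\<close>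
  have "gauss_mean n (\<lambda>h. indicator {1..} (exp (- \<beta> * h) / c n)) \<le> gauss_mean n (\<lambda>h. exp ((- \<beta> * r n) * h + - r n * ln (c n)))"
  proof (rule gauss_mean_le[OF I(1) gauss_exp(1)[OF n]])
    fix h
    show "indicator {1..} (exp (- \<beta> * h) / c n) \<le> exp ((- \<beta> * r n) * h + - r n * ln (c n))"
    proof (cases "exp (- \<beta> * h) / c n \<ge> 1")
      case True
      then have "c n \<le> exp (- \<beta> * h)" using c0 by (simp add: le_divide_eq)
      then have "ln (c n) \<le> - \<beta> * h" using c0 by (simp add: ln_ge_iff ln_le_cancel_iff[of "c n" "exp _", symmetric] del: ln_le_cancel_iff)
      then have "r n * ln (c n) \<le> r n * (- \<beta> * h)" using r0 by (rule mult_left_mono)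
      then have "0 \<le> (- \<beta> * r n) * h + - r n * ln (c n)" by (simp add: mult_ac)
      then show ?thesis by (simp add: indicator_def)
    qed simp
  qed auto
  also have "\<dots> = exp ((- \<beta> * r n)\<^sup>2 * n / 2 + - r n * ln (c n))" by (rule gauss_exp(2)[OF n])
  also have "(- \<beta> * r n)\<^sup>2 * n / 2 + - r n * ln (c n) = - ((r n)\<^sup>2 * v n / 2)"
    unfolding lnc by (simp add: v_def power_mult_distrib power2_eq_square)
  finally have "1 \<le> a n * exp (- ((r n)\<^sup>2 * v n / 2))"
    using scale[OF n c0] a_pos[OF n] by (metis mult_left_mono less_imp_le)
  then have "exp ((r n)\<^sup>2 * v n / 2) \<le> a n" by (simp add: exp_minus field_simps)
  then show "(r n)\<^sup>2 * v n / 2 \<le> ln (a n)" using a_pos[OF n] by (simp only: ln_ge_iff)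
  have "ln (a n * log_const (r n) (v n) * exp (- r n - 1 / (2 * v n))) \<le> 0" using third aL by simp
  moreover have "ln (a n * log_const (r n) (v n) * exp (- r n - 1 / (2 * v n)))
     = ln (a n) + ln (log_const (r n) (v n)) + (- r n - 1 / (2 * v n))"
    using a_pos[OF n] L0 by (simp add: ln_mult)
  moreover have "ln (log_const (r n) (v n)) = - (r n)\<^sup>2 * v n / 2 - ln (2 * pi * v n) / 2"
    using v0 by (simp add: log_const_def ln_div ln_sqrt)
  ultimately show "ln (a n) \<le> (r n)\<^sup>2 * v n / 2 + ln (2 * pi * v n) / 2 + r n + 1 / (2 * v n)" by simp
qed

text \<open>By \<open>mass_bounds\<close>, \<open>r\<^sup>2\<close> differs from 2 ln a / v only by
  terms of order ln v / v, and criticality makes the limit of that quotient equal to 1.\<close>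

lemma r_tendsto_1: "r \<longlonglongrightarrow> 1"
proof -
  define x where "x n = 2 * (ln (a n) / v n)" for n
  have x_eq: "x = (\<lambda>n. ln (a n) / (real n * ln 2) * (2 * ln 2 / \<beta>\<^sup>2))"
    by (auto simp: x_def v_def)
  have one: "\<epsilon> * (2 * ln 2 / \<beta>\<^sup>2) = 1" using \<epsilon> unfolding crit by simp
  have "x \<longlonglongrightarrow> \<epsilon> * (2 * ln 2 / \<beta>\<^sup>2)"
    unfolding x_eq by (intro tendsto_mult growth tendsto_const)
  then have x1: "x \<longlonglongrightarrow> 1" unfolding one .
  have lnv: "(\<lambda>n. ln (2 * pi * v n) / v n) \<longlonglongrightarrow> 0"
    unfolding v_def using \<beta> by real_asymp
  have up: "\<forall>\<^sub>F n in sequentially. (r n)\<^sup>2 \<le> x n"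
    using c_ge_1
  proof eventually_elim
    case (elim n)
    then show ?case using mass_bounds(1)[of n] v_pos[of n] by (simp add: x_def field_simps)
  qed
  have r2: "\<forall>\<^sub>F n in sequentially. r n \<le> 2"
    using up order_tendstoD(2)[OF x1, of 4, simplified]
  proof eventually_elim
    case (elim n)
    then have "(r n)\<^sup>2 \<le> 2\<^sup>2" by simp
    then show ?case by (rule power2_le_imp_le) simp
  qed
  have low: "\<forall>\<^sub>F n in sequentially. x n - ln (2 * pi * v n) / v n - 4 * (1 / v n) - (1 / v n)\<^sup>2 \<le> (r n)\<^sup>2"
    using c_ge_1 r2
  proof eventually_elim
    case (elim n)
    have v0: "v n > 0" using elim v_pos by simp
    have "ln (a n) \<le> (r n)\<^sup>2 * v n / 2 + ln (2 * pi * v n) / 2 + r n + 1 / (2 * v n)" using mass_bounds(2) elim by simp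
    then have "2 * ln (a n) \<le> (r n)\<^sup>2 * v n + ln (2 * pi * v n) + 4 + 1 / v n" using elim by simp
    then have "2 * ln (a n) / v n \<le> ((r n)\<^sup>2 * v n + ln (2 * pi * v n) + 4 + 1 / v n) / v n"
      using v0 by (intro divide_right_mono) auto
    also have "\<dots> = (r n)\<^sup>2 + ln (2 * pi * v n) / v n + 4 * (1 / v n) + (1 / v n)\<^sup>2"
      using v0 by (simp add: add_divide_distrib power2_eq_square)
    finally show ?case by (simp add: x_def)
  qed
  have "(\<lambda>n. (r n)\<^sup>2) \<longlonglongrightarrow> 1"
  proof (rule tendsto_sandwich[OF low up _ x1])
    have "(\<lambda>n. x n - ln (2 * pi * v n) / v n - 4 * (1 / v n) - (1 / v n)\<^sup>2) \<longlonglongrightarrow> 1 - 0 - 4 * 0 - 0\<^sup>2"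
      by (intro tendsto_intros x1 lnv inverse_v_0)
    then show "(\<lambda>n. x n - ln (2 * pi * v n) / v n - 4 * (1 / v n) - (1 / v n)\<^sup>2) \<longlonglongrightarrow> 1" by simp
  qed
  then have "(\<lambda>n. sqrt ((r n)\<^sup>2)) \<longlonglongrightarrow> sqrt 1" by (rule tendsto_real_sqrt)
  moreover have "\<forall>\<^sub>F n in sequentially. sqrt ((r n)\<^sup>2) = r n"
    using c_ge_1 by eventually_elim (use mass_bounds(5) in simp)
  ultimately show ?thesis using tendsto_cong by force
qed

lemma eventually_regular: "\<forall>\<^sub>F n in sequentially. n \<ge> 1 \<and> c n \<ge> 1 \<and> v n \<ge> 1 \<and> 1 / 2 \<le> r n \<and> r n \<le> 3 / 2"
proof -
  have "\<forall>\<^sub>F n in sequentially. v n \<ge> 1" using v_at_top by (simp add: filterlim_at_top)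
  moreover have "\<forall>\<^sub>F n in sequentially. r n > 1 / 2" "\<forall>\<^sub>F n in sequentially. r n < 3 / 2"
    by (rule order_tendstoD[OF r_tendsto_1]; simp)+
  ultimately show ?thesis using c_ge_1 by eventually_elim auto
qed

text \<open>With the prefactor between two positive constants, every scaled Gaussian mean is
  comparable to the bare integral on the logarithmic scale. The constants come from 1 / r \<le> 2
  and r + 1 / (2 v) \<le> 2.\<close>

lemma a_log_const_bounds:
  assumes "n \<ge> 1" "c n \<ge> 1" "v n \<ge> 1" "1 / 2 \<le> r n" "r n \<le> 3 / 2"
  shows "1 / 2 \<le> a n * log_const (r n) (v n)" "a n * log_const (r n) (v n) \<le> exp 2"
proof -
  have "1 / (r n) \<le> 2" using assms by (simp add: divide_le_eq)
  moreover have pos: "0 < a n * log_const (r n) (v n)" using a_pos assms by (simp add: log_const_def)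
  ultimately have "a n * log_const (r n) (v n) * (1 / r n) \<le> a n * log_const (r n) (v n) * 2"
    by (intro mult_left_mono) auto
  then show "1 / 2 \<le> a n * log_const (r n) (v n)" using mass_bounds(4)[of n] assms by simp
  have "1 / (2 * v n) \<le> 1 / 2" using assms by (simp add: divide_le_eq)
  then have "- 2 \<le> - r n - 1 / (2 * v n)" using assms(5) by linarith
  then have "exp (- 2) \<le> exp (- r n - 1 / (2 * v n))" by (simp only: exp_le_cancel_iff)
  then have "a n * log_const (r n) (v n) * exp (- 2) \<le> 1"
    using mass_bounds(3)[of n] assms pos by (meson less_imp_le mult_left_mono order_trans)
  then show "a n * log_const (r n) (v n) \<le> exp 2" by (simp add: exp_minus field_simps)
qed

text \<open>The square contributes exp (2 y) against a tail index of at most 3 / 2, so the exponent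
  is at least 1 / 2 and the integral over the negative half-line converges uniformly in n.\<close>

lemma scaled_square_bound:
  assumes "n \<ge> 1" "c n \<ge> 1" "v n \<ge> 1" "1 / 2 \<le> r n" "r n \<le> 3 / 2"
  shows "a n * gauss_mean n (\<lambda>h. indicator {..1} (exp (- \<beta> * h) / c n) * (exp (- \<beta> * h) / c n)\<^sup>2) \<le> exp 2 * 2"
proof -
  have c0: "c n > 0" using assms by simp
  have b: "\<bar>indicator {..1} x * x\<^sup>2\<bar> \<le> 1" if "x > 0" for x :: real
    using that by (auto simp: indicator_def power_le_one)
  note I = bounded_scale_fun[OF assms(1) c0, of "\<lambda>x. indicator {..1} x * x\<^sup>2" 1, OF _ b]
  have ind: "indicator {..1} (exp y) * (exp y)\<^sup>2 = indicator {..0} y * exp (2 * y)" for y :: real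
    by (auto simp: indicator_def exp_double)
  have "(\<integral>y. indicator {..0} y * exp (2 * y) * log_density (r n) (v n) y \<partial>lborel) \<le> 1 / (2 - r n)"
    using I(2) assms by (intro log_scale_square_lower_tail) (auto simp: ind)
  also have "\<dots> \<le> 2" using assms by (simp add: divide_le_eq)
  finally have le: "(\<integral>y. indicator {..0} y * exp (2 * y) * log_density (r n) (v n) y \<partial>lborel) \<le> 2" .
  have "a n * gauss_mean n (\<lambda>h. indicator {..1} (exp (- \<beta> * h) / c n) * (exp (- \<beta> * h) / c n)\<^sup>2)
     = a n * log_const (r n) (v n) * (\<integral>y. indicator {..0} y * exp (2 * y) * log_density (r n) (v n) y \<partial>lborel)"
    using I(3) by (simp add: ind mult.assoc)
  also have "\<dots> \<le> a n * log_const (r n) (v n) * 2"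
    using a_log_const_bounds(1)[OF assms] by (intro mult_left_mono le) auto
  also have "\<dots> \<le> exp 2 * 2" using a_log_const_bounds(2)[OF assms] by (intro mult_right_mono) auto
  finally show ?thesis .
qed

text \<open>A tail index of at least 1 / 2 yields decay like the inverse square root of b, uniformly
  in n.\<close>

lemma scaled_tail_bound:
  assumes "n \<ge> 1" "c n \<ge> 1" "v n \<ge> 1" "1 / 2 \<le> r n" "r n \<le> 3 / 2" and b: "b \<ge> 1"
  shows "a n * gauss_mean n (\<lambda>h. indicator {b..} (exp (- \<beta> * h) / c n)) \<le> exp 2 * (2 * exp (- ln b / 2))"
proof -
  have c0: "c n > 0" using assms by simp
  note I = bounded_scale_fun[OF assms(1) c0, of "indicator {b..}" 1]
  have ind: "(\<lambda>y. indicator {b..} (exp y) * log_density (r n) (v n) y) = (\<lambda>y. indicator {ln b..} y * log_density (r n) (v n) y)"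
    using upper_set[OF less_le_trans[OF zero_less_one b]] by simp
  have "(\<integral>y. indicator {ln b..} y * log_density (r n) (v n) y \<partial>lborel) \<le> exp (- r n * ln b) / r n"
    using I(2) assms by (intro log_scale_upper_tail) (auto simp: ind)
  also have "\<dots> = (1 / r n) * exp (- r n * ln b)" by simp
  also have "\<dots> \<le> 2 * exp (- ln b / 2)"
  proof (rule mult_mono)
    show "1 / r n \<le> 2" using assms by (simp add: divide_le_eq)
    have "1 / 2 * ln b \<le> r n * ln b" using assms b by (intro mult_right_mono) auto
    then show "exp (- r n * ln b) \<le> exp (- ln b / 2)" by simp
  qed auto
  finally have le: "(\<integral>y. indicator {ln b..} y * log_density (r n) (v n) y \<partial>lborel) \<le> 2 * exp (- ln b / 2)" .
  have "a n * gauss_mean n (\<lambda>h. indicator {b..} (exp (- \<beta> * h) / c n))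
     = a n * log_const (r n) (v n) * (\<integral>y. indicator {ln b..} y * log_density (r n) (v n) y \<partial>lborel)"
    using I(3) by (simp add: ind mult.assoc)
  also have "\<dots> \<le> a n * log_const (r n) (v n) * (2 * exp (- ln b / 2))"
    using a_log_const_bounds(1)[OF assms(1-5)] by (intro mult_left_mono le) auto
  also have "\<dots> \<le> exp 2 * (2 * exp (- ln b / 2))" using a_log_const_bounds(2)[OF assms(1-5)] by (intro mult_right_mono) auto
  finally show ?thesis .
qed

lemma scaled_mean_at_top:
  "filterlim (\<lambda>n. a n * gauss_mean n (\<lambda>h. indicator {..1} (exp (- \<beta> * h) / c n) * (exp (- \<beta> * h) / c n))) at_top sequentially"
  unfolding filterlim_at_top_gt[where c=0]
proof (intro allI impI)
  fix Z :: real assume Z: "Z > 0"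
  \<comment> \<open>One factor 2 is lost to the exponential correction on the window and one to the
    lower bound 1 / 2 of the prefactor.\<close>
  define L where "L = 4 * Z"
  have "(\<lambda>n. exp (- L * \<bar>1 - r n\<bar> - L\<^sup>2 / 2 * (1 / v n))) \<longlonglongrightarrow> exp (- L * \<bar>1 - 1\<bar> - L\<^sup>2 / 2 * 0)"
    by (intro tendsto_intros r_tendsto_1 inverse_v_0)
  then have "\<forall>\<^sub>F n in sequentially. exp (- L * \<bar>1 - r n\<bar> - L\<^sup>2 / 2 * (1 / v n)) > 1 / 2"
    by (rule order_tendstoD) simp
  then show "\<forall>\<^sub>F n in sequentially. Z \<le> a n * gauss_mean n (\<lambda>h. indicator {..1} (exp (- \<beta> * h) / c n) * (exp (- \<beta> * h) / c n))"
    using eventually_regular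
  proof eventually_elim
    case (elim n)
    then have n: "n \<ge> 1" and c0: "c n > 0" by auto
    have b: "\<bar>indicator {..1} x * x\<bar> \<le> 1" if "x > 0" for x :: real
      using that by (auto simp: indicator_def)
    note I = bounded_scale_fun[OF n c0, of "\<lambda>x. indicator {..1} x * x" 1, OF _ b]
    have ind: "indicator {..1} (exp y) * exp y = indicator {..0} y * exp y" for y :: real
      by (auto simp: indicator_def)
    have "L * (1 / 2) \<le> L * exp (- L * \<bar>1 - r n\<bar> - L\<^sup>2 / (2 * v n))"
      using elim Z by (intro mult_left_mono) (auto simp: L_def)
    also have "\<dots> \<le> (\<integral>y. indicator {..0} y * exp y * log_density (r n) (v n) y \<partial>lborel)"
      using I(2) elim Z by (intro log_scale_mean_lower) (auto simp: ind L_def)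
    finally have low: "2 * Z \<le> (\<integral>y. indicator {..0} y * exp y * log_density (r n) (v n) y \<partial>lborel)" by (simp add: L_def)
    have "Z = 1 / 2 * (2 * Z)" by simp
    also have "\<dots> \<le> a n * log_const (r n) (v n) * (\<integral>y. indicator {..0} y * exp y * log_density (r n) (v n) y \<partial>lborel)"
      using a_log_const_bounds(1)[of n] elim Z by (intro mult_mono low) auto
    also have "\<dots> = a n * gauss_mean n (\<lambda>h. indicator {..1} (exp (- \<beta> * h) / c n) * (exp (- \<beta> * h) / c n))"
      using I(3) by (simp add: ind mult.assoc)
    finally show ?case .
  qed
qed

end

text \<open>The strict inequality makes \<open>trunc b\<close> the identity exactly on the
  complement of the set of depths at least b, which serves as the forbidden set.\<close>

definition trunc :: "real \<Rightarrow> real \<Rightarrow> real" where "trunc b x = (if x < b then x else 0)"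

lemma measurable_trunc [measurable]: "trunc b \<in> borel_measurable borel"
  unfolding trunc_def by measurable

section \<open>Truncated depths and trap means at the critical scale\<close>

context critical_scale
begin

definition gamma :: "nat \<Rightarrow> real \<Rightarrow> real" where "gamma n h = exp (- \<beta> * h) / c n"

lemma gamma_pos: "c n > 0 \<Longrightarrow> gamma n h > 0"
  by (simp add: gamma_def)

lemma measurable_gamma [measurable]: "gamma n \<in> borel_measurable borel"
  unfolding gamma_def by measurable

context
  fixes n :: nat
  assumes reg: "n \<ge> 1" "c n \<ge> 1" "v n \<ge> 1" "1 / 2 \<le> r n" "r n \<le> 3 / 2"
begin

text \<open>Below 1 the scaled second moment is bounded, above 1 the scaled mass is exactly 1 by the
  choice of a. Functions dominated in this way stay bounded in scaled mean, while d
  diverges.\<close>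

lemma scaled_remainder_bound:
  assumes F: "F \<in> borel_measurable borel" "\<And>x. x > 0 \<Longrightarrow> \<bar>F x\<bar> \<le> indicator {..1} x * x\<^sup>2 + k * indicator {1..} x" and k: "k \<ge> 0"
  shows "\<bar>a n * gauss_mean n (\<lambda>h. F (gamma n h))\<bar> \<le> exp 2 * 2 + k"
    "gauss_integrable n (\<lambda>h. F (gamma n h))"
proof -
  have c0: "c n > 0" using reg by simp
  have b1: "\<bar>indicator {..1} x * x\<^sup>2\<bar> \<le> 1" if "x > 0" for x :: real
    using that by (auto simp: indicator_def power_le_one)
  have b2: "\<bar>k * indicator {1..} x\<bar> \<le> k" for x :: real using k by (simp add: indicator_def)
  have i1: "gauss_integrable n (\<lambda>h. indicator {..1} (gamma n h) * (gamma n h)\<^sup>2)"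
    unfolding gamma_def by (rule bounded_scale_fun(1)[OF reg(1) c0, of "\<lambda>x. indicator {..1} x * x\<^sup>2" 1, OF _ b1]) measurable
  have i2: "gauss_integrable n (\<lambda>h. indicator {1..} (gamma n h))"
    unfolding gamma_def by (rule bounded_scale_fun(1)[OF reg(1) c0, of "indicator {1..}" 1]) auto
  define G where "G h = indicator {..1} (gamma n h) * (gamma n h)\<^sup>2 + k * indicator {1..} (gamma n h)" for h
  have iG: "gauss_integrable n G" unfolding G_def by (intro gauss_integrable_add gauss_integrable_cmult i1 i2)
  have FG: "\<bar>F (gamma n h)\<bar> \<le> G h" for h using F(2)[OF gamma_pos[OF c0]] by (simp add: G_def)
  show iF: "gauss_integrable n (\<lambda>h. F (gamma n h))"
    by (rule gauss_integrable_bound[OF iG _ FG]) (use F(1) in measurable)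
  have "a n * gauss_mean n G = a n * gauss_mean n (\<lambda>h. indicator {..1} (gamma n h) * (gamma n h)\<^sup>2)
      + k * (a n * gauss_mean n (\<lambda>h. indicator {1..} (gamma n h)))"
    unfolding G_def by (subst gauss_mean_add[OF i1 gauss_integrable_cmult[OF i2]]) (simp add: gauss_mean_cmult algebra_simps)
  also have "\<dots> \<le> exp 2 * 2 + k * 1"
    using scaled_square_bound[OF reg] scale[OF reg(1) c0] by (simp add: gamma_def)
  finally have G: "a n * gauss_mean n G \<le> exp 2 * 2 + k" by simp
  have a0: "a n > 0" by (rule a_pos[OF reg(1)])
  have "gauss_mean n (\<lambda>h. F (gamma n h)) \<le> gauss_mean n G"
    by (rule gauss_mean_le[OF iF iG]) (use FG in \<open>auto simp: abs_le_iff\<close>)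
  moreover have "- gauss_mean n (\<lambda>h. F (gamma n h)) \<le> gauss_mean n G"
    using gauss_mean_le[OF gauss_integrable_cmult[OF iF, of "-1"] iG] FG by (simp add: abs_le_iff gauss_mean_cmult[of n "-1", simplified])
  ultimately have "\<bar>gauss_mean n (\<lambda>h. F (gamma n h))\<bar> \<le> gauss_mean n G" by (simp add: abs_le_iff)
  then have "a n * \<bar>gauss_mean n (\<lambda>h. F (gamma n h))\<bar> \<le> a n * gauss_mean n G" using a0 by (intro mult_left_mono) auto
  then have "a n * \<bar>gauss_mean n (\<lambda>h. F (gamma n h))\<bar> \<le> exp 2 * 2 + k" using G by linarith
  then show "\<bar>a n * gauss_mean n (\<lambda>h. F (gamma n h))\<bar> \<le> exp 2 * 2 + k" using a0 by (simp add: abs_mult)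
qed

lemma trap_mean_scaled:
  "a n * gauss_mean n (\<lambda>h. (trap_mean (gamma n h))\<^sup>2) \<le> exp 2 * 2 + 1"
  "a n * gauss_mean n (\<lambda>h. indicator {..1} (gamma n h) * gamma n h) \<le> 2 * (a n * gauss_mean n (\<lambda>h. trap_mean (gamma n h)))"
proof -
  have c0: "c n > 0" using reg by simp
  have "\<bar>(trap_mean x)\<^sup>2\<bar> \<le> indicator {..1} x * x\<^sup>2 + 1 * indicator {1..} x" if x: "x > 0" for x
  proof (cases "x \<le> 1")
    case True
    have "(trap_mean x)\<^sup>2 \<le> x\<^sup>2" using trap_mean_bounds(1,3)[OF x] by (intro power_mono) auto
    then show ?thesis using True by (auto simp: indicator_def)
  next
    case False
    have "(trap_mean x)\<^sup>2 \<le> 1" using trap_mean_bounds(1,2)[OF x] by (intro power_le_one) auto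
    then show ?thesis using False by (auto simp: indicator_def)
  qed
  from scaled_remainder_bound(1)[OF _ this zero_le_one]
  show "a n * gauss_mean n (\<lambda>h. (trap_mean (gamma n h))\<^sup>2) \<le> exp 2 * 2 + 1" by (simp add: abs_le_iff)
  have b: "\<bar>indicator {..1} x * x\<bar> \<le> 1" "\<bar>2 * trap_mean x\<bar> \<le> 2" if "x > 0" for x :: real
    using that trap_mean_bounds(1,2)[OF that] by (auto simp: indicator_def)
  have i1: "gauss_integrable n (\<lambda>h. indicator {..1} (gamma n h) * gamma n h)"
    unfolding gamma_def by (rule bounded_scale_fun(1)[OF reg(1) c0, of "\<lambda>x. indicator {..1} x * x", OF _ b(1)]) measurable
  have i2: "gauss_integrable n (\<lambda>h. 2 * trap_mean (gamma n h))"
    unfolding gamma_def by (rule bounded_scale_fun(1)[OF reg(1) c0, of "\<lambda>x. 2 * trap_mean x", OF _ b(2)]) measurable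
  have "gauss_mean n (\<lambda>h. indicator {..1} (gamma n h) * gamma n h) \<le> gauss_mean n (\<lambda>h. 2 * trap_mean (gamma n h))"
  proof (rule gauss_mean_le[OF i1 i2])
    fix h
    have "gamma n h > 0" by (rule gamma_pos[OF c0])
    from trap_mean_bounds(1,4)[OF this]
    show "indicator {..1} (gamma n h) * gamma n h \<le> 2 * trap_mean (gamma n h)" by (auto simp: indicator_def)
  qed
  also have "\<dots> = 2 * gauss_mean n (\<lambda>h. trap_mean (gamma n h))" by (rule gauss_mean_cmult)
  finally have "gauss_mean n (\<lambda>h. indicator {..1} (gamma n h) * gamma n h) \<le> 2 * gauss_mean n (\<lambda>h. trap_mean (gamma n h))" .
  from mult_left_mono[OF this, of "a n"] a_pos[OF reg(1)]
  show "a n * gauss_mean n (\<lambda>h. indicator {..1} (gamma n h) * gamma n h) \<le> 2 * (a n * gauss_mean n (\<lambda>h. trap_mean (gamma n h)))"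
    by (simp add: mult.left_commute)
qed

text \<open>Below 1 truncation and trap mean differ by at most the square of the depth, above 1 by
  at most b + 1. So truncation changes the normalising mean only by order b.\<close>

lemma trunc_scaled:
  assumes b: "b \<ge> 1"
  shows "a n * gauss_mean n (\<lambda>h. (trunc b (gamma n h))\<^sup>2) \<le> exp 2 * 2 + b\<^sup>2"
    "\<bar>a n * gauss_mean n (\<lambda>h. trunc b (gamma n h)) - a n * gauss_mean n (\<lambda>h. trap_mean (gamma n h))\<bar> \<le> exp 2 * 2 + (b + 1)"
proof -
  have c0: "c n > 0" using reg by simp
  have "\<bar>(trunc b x)\<^sup>2\<bar> \<le> indicator {..1} x * x\<^sup>2 + b\<^sup>2 * indicator {1..} x" if x: "x > 0" for x
  proof (cases "x \<le> 1")
    case True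
    then show ?thesis by (auto simp: indicator_def trunc_def)
  next
    case False
    have "(trunc b x)\<^sup>2 \<le> b\<^sup>2" using x b by (intro power_mono) (auto simp: trunc_def)
    then show ?thesis using False by (auto simp: indicator_def)
  qed
  from scaled_remainder_bound(1)[OF _ this]
  show "a n * gauss_mean n (\<lambda>h. (trunc b (gamma n h))\<^sup>2) \<le> exp 2 * 2 + b\<^sup>2" by (simp add: abs_le_iff)
  have diff: "\<bar>trunc b x - trap_mean x\<bar> \<le> indicator {..1} x * x\<^sup>2 + (b + 1) * indicator {1..} x" if x: "x > 0" for x
  proof (cases "x < 1")
    case True
    then show ?thesis using trap_mean_bounds(3,5)[OF x] b by (auto simp: indicator_def trunc_def abs_le_iff)
  next
    case False
    have "\<bar>trunc b x - trap_mean x\<bar> \<le> b + 1"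
    proof (rule abs_leI)
      have t: "0 \<le> trunc b x" "trunc b x \<le> b" using x b by (auto simp: trunc_def)
      show "trunc b x - trap_mean x \<le> b + 1" "- (trunc b x - trap_mean x) \<le> b + 1"
        using t trap_mean_bounds(1,2)[OF x] b by linarith+
    qed
    then show ?thesis using False by (auto simp: indicator_def)
  qed
  have i1: "gauss_integrable n (\<lambda>h. trunc b (gamma n h))"
    unfolding gamma_def by (rule bounded_scale_fun(1)[OF reg(1) c0, of "trunc b" b]) (use b in \<open>auto simp: trunc_def\<close>)
  have i2: "gauss_integrable n (\<lambda>h. trap_mean (gamma n h))"
    unfolding gamma_def by (rule bounded_scale_fun(1)[OF reg(1) c0, of trap_mean 1]) (use trap_mean_bounds(1,2) in auto)
  show "\<bar>a n * gauss_mean n (\<lambda>h. trunc b (gamma n h)) - a n * gauss_mean n (\<lambda>h. trap_mean (gamma n h))\<bar> \<le> exp 2 * 2 + (b + 1)"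
    using scaled_remainder_bound(1)[OF _ diff] b gauss_mean_diff[OF i1 i2] by (simp add: right_diff_distrib)
qed

end

section \<open>Limits of the scaled averages at the critical scale\<close>

context
  fixes d :: "nat \<Rightarrow> real"
  assumes d: "\<And>n. d n = real (nat \<lfloor>a n\<rfloor>) * gauss_mean n (\<lambda>h. trap_mean (gamma n h))"
    and a_top: "filterlim a at_top sequentially"
begin

lemma floor_ratio: "(\<lambda>n. a n / real (nat \<lfloor>a n\<rfloor>)) \<longlonglongrightarrow> 1"
proof -
  have "((\<lambda>x::real. x / real (nat \<lfloor>x\<rfloor>)) \<longlongrightarrow> 1) at_top"
  proof (rule tendsto_sandwich)
    show "\<forall>\<^sub>F x::real in at_top. 1 \<le> x / real (nat \<lfloor>x\<rfloor>)"
      using eventually_ge_at_top[of 2]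
    proof eventually_elim
      case (elim x)
      then have "0 < real (nat \<lfloor>x\<rfloor>)" "real (nat \<lfloor>x\<rfloor>) \<le> x" by linarith+
      then show ?case by simp
    qed
    show "\<forall>\<^sub>F x::real in at_top. x / real (nat \<lfloor>x\<rfloor>) \<le> x / (x - 1)"
      using eventually_ge_at_top[of 2]
    proof eventually_elim
      case (elim x)
      then have "0 < x - 1" "x - 1 \<le> real (nat \<lfloor>x\<rfloor>)" by linarith+
      then show ?case using elim by (intro divide_left_mono) auto
    qed
    show "((\<lambda>x::real. x / (x - 1)) \<longlongrightarrow> 1) at_top" by real_asymp
  qed auto
  from filterlim_compose[OF this a_top] show ?thesis .
qed

text \<open>The factor 1 / 4 loses one half from rounding a down and one half from x / 2 \<le>
  \<open>trap_mean x\<close> for x \<le> 1.\<close>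

lemma d_at_top: "filterlim d at_top sequentially"
proof (rule filterlim_at_top_mono)
  show "filterlim (\<lambda>n. 1 / 4 * (a n * gauss_mean n (\<lambda>h. indicator {..1} (gamma n h) * gamma n h))) at_top sequentially"
    using scaled_mean_at_top unfolding gamma_def
    by (intro filterlim_tendsto_pos_mult_at_top[OF tendsto_const]) auto
  have "\<forall>\<^sub>F n in sequentially. a n \<ge> 2" using a_top by (simp add: filterlim_at_top)
  then show "\<forall>\<^sub>F n in sequentially. 1 / 4 * (a n * gauss_mean n (\<lambda>h. indicator {..1} (gamma n h) * gamma n h)) \<le> d n"
    using eventually_regular
  proof eventually_elim
    case (elim n)
    then have reg: "n \<ge> 1" "c n \<ge> 1" "v n \<ge> 1" "1 / 2 \<le> r n" "r n \<le> 3 / 2" by auto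
    have c0: "c n > 0" using reg by simp
    have g0: "gauss_mean n (\<lambda>h. trap_mean (gamma n h)) \<ge> 0"
      by (rule gauss_mean_nonneg) (rule trap_mean_bounds(1)[OF gamma_pos[OF c0]])
    have "1 / 4 * (a n * gauss_mean n (\<lambda>h. indicator {..1} (gamma n h) * gamma n h))
       \<le> a n / 2 * gauss_mean n (\<lambda>h. trap_mean (gamma n h))"
      using trap_mean_scaled(2)[OF reg] by simp
    also have "\<dots> \<le> d n"
      unfolding d using elim(1) by (intro mult_right_mono g0) linarith
    finally show ?case .
  qed
qed

lemma inverse_d_0: "(\<lambda>n. 1 / d n) \<longlonglongrightarrow> 0"
  using tendsto_inverse_0_at_top[OF d_at_top] by (simp add: inverse_eq_divide)

lemma inverse_sqrt_d_0: "(\<lambda>n. 1 / sqrt (d n)) \<longlonglongrightarrow> 0"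
  using tendsto_real_sqrt[OF inverse_d_0] by (simp add: real_sqrt_divide)

lemma eventually_d_ge_1: "\<forall>\<^sub>F n in sequentially. d n \<ge> 1"
  using d_at_top by (simp add: filterlim_at_top)

lemma trap_mean_ratio: "(\<lambda>n. a n * gauss_mean n (\<lambda>h. trap_mean (gamma n h)) / d n) \<longlonglongrightarrow> 1"
proof (rule Lim_transform_eventually[OF floor_ratio])
  show "\<forall>\<^sub>F n in sequentially. a n / real (nat \<lfloor>a n\<rfloor>) = a n * gauss_mean n (\<lambda>h. trap_mean (gamma n h)) / d n"
    using eventually_d_ge_1 by eventually_elim (auto simp: d)
qed

lemma trap_mean_square_ratio: "(\<lambda>n. a n * gauss_mean n (\<lambda>h. (trap_mean (gamma n h))\<^sup>2) / (d n)\<^sup>2) \<longlonglongrightarrow> 0"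
proof (rule tendsto_sandwich[of "\<lambda>_. 0" _ _ "\<lambda>n. (exp 2 * 2 + 1) * (1 / d n)\<^sup>2"])
  show "\<forall>\<^sub>F n in sequentially. 0 \<le> a n * gauss_mean n (\<lambda>h. (trap_mean (gamma n h))\<^sup>2) / (d n)\<^sup>2"
    using eventually_ge_at_top[of 1]
    by eventually_elim (auto intro!: divide_nonneg_nonneg mult_nonneg_nonneg gauss_mean_nonneg less_imp_le[OF a_pos])
  show "\<forall>\<^sub>F n in sequentially. a n * gauss_mean n (\<lambda>h. (trap_mean (gamma n h))\<^sup>2) / (d n)\<^sup>2 \<le> (exp 2 * 2 + 1) * (1 / d n)\<^sup>2"
    using eventually_regular
  proof eventually_elim
    case (elim n)
    then have "a n * gauss_mean n (\<lambda>h. (trap_mean (gamma n h))\<^sup>2) / (d n)\<^sup>2 \<le> (exp 2 * 2 + 1) / (d n)\<^sup>2"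
      by (intro divide_right_mono trap_mean_scaled) auto
    then show ?case by (simp add: power_divide)
  qed
  have "(\<lambda>n. (exp 2 * 2 + 1) * (1 / d n)\<^sup>2) \<longlonglongrightarrow> (exp 2 * 2 + 1) * 0\<^sup>2" by (intro tendsto_intros inverse_d_0)
  then show "(\<lambda>n. (exp 2 * 2 + 1) * (1 / d n)\<^sup>2) \<longlonglongrightarrow> 0" by simp
qed auto

text \<open>With level sqrt d the second moment above 1 is at most d, of lower order than the square
  of d. The level has to diverge for \<open>trunc_tail_0\<close> and to be o(d) for
  \<open>trunc_mean_ratio\<close>.\<close>

lemma trunc_square_ratio: "(\<lambda>n. a n * gauss_mean n (\<lambda>h. (trunc (sqrt (d n)) (gamma n h))\<^sup>2) / (d n)\<^sup>2) \<longlonglongrightarrow> 0"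
proof (rule tendsto_sandwich[of "\<lambda>_. 0" _ _ "\<lambda>n. exp 2 * 2 * (1 / d n)\<^sup>2 + 1 / d n"])
  show "\<forall>\<^sub>F n in sequentially. 0 \<le> a n * gauss_mean n (\<lambda>h. (trunc (sqrt (d n)) (gamma n h))\<^sup>2) / (d n)\<^sup>2"
    using eventually_ge_at_top[of 1]
    by eventually_elim (auto intro!: divide_nonneg_nonneg mult_nonneg_nonneg gauss_mean_nonneg less_imp_le[OF a_pos])
  show "\<forall>\<^sub>F n in sequentially. a n * gauss_mean n (\<lambda>h. (trunc (sqrt (d n)) (gamma n h))\<^sup>2) / (d n)\<^sup>2 \<le> exp 2 * 2 * (1 / d n)\<^sup>2 + 1 / d n"
    using eventually_regular eventually_d_ge_1
  proof eventually_elim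
    case (elim n)
    then have "a n * gauss_mean n (\<lambda>h. (trunc (sqrt (d n)) (gamma n h))\<^sup>2) / (d n)\<^sup>2 \<le> (exp 2 * 2 + (sqrt (d n))\<^sup>2) / (d n)\<^sup>2"
      by (intro divide_right_mono trunc_scaled) auto
    then show ?case using elim by (simp add: power_divide add_divide_distrib power2_eq_square)
  qed
  have "(\<lambda>n. exp 2 * 2 * (1 / d n)\<^sup>2 + 1 / d n) \<longlonglongrightarrow> exp 2 * 2 * 0\<^sup>2 + 0" by (intro tendsto_intros inverse_d_0)
  then show "(\<lambda>n. exp 2 * 2 * (1 / d n)\<^sup>2 + 1 / d n) \<longlonglongrightarrow> 0" by simp
qed auto

lemma trunc_mean_ratio: "(\<lambda>n. a n * gauss_mean n (\<lambda>h. trunc (sqrt (d n)) (gamma n h)) / d n) \<longlonglongrightarrow> 1"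
proof -
  let ?diff = "\<lambda>n. a n * gauss_mean n (\<lambda>h. trunc (sqrt (d n)) (gamma n h)) / d n - a n * gauss_mean n (\<lambda>h. trap_mean (gamma n h)) / d n"
  have "?diff \<longlonglongrightarrow> 0"
  proof (rule Lim_null_comparison)
    show "\<forall>\<^sub>F n in sequentially. norm (?diff n) \<le> (exp 2 * 2 + 1) * (1 / d n) + 1 / sqrt (d n)"
      using eventually_regular eventually_d_ge_1
    proof eventually_elim
      case (elim n)
      have "norm (?diff n) = \<bar>a n * gauss_mean n (\<lambda>h. trunc (sqrt (d n)) (gamma n h)) - a n * gauss_mean n (\<lambda>h. trap_mean (gamma n h))\<bar> / d n"
        using elim by (simp add: diff_divide_distrib[symmetric] abs_divide)
      also have "\<dots> \<le> (exp 2 * 2 + (sqrt (d n) + 1)) / d n"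
        using elim by (intro divide_right_mono trunc_scaled) auto
      also have "\<dots> = (exp 2 * 2 + 1) * (1 / d n) + sqrt (d n) / d n" by (simp add: add_divide_distrib)
      also have "sqrt (d n) / d n = 1 / sqrt (d n)" using elim by (simp add: real_div_sqrt field_simps)
      finally show ?case .
    qed
    have "(\<lambda>n. (exp 2 * 2 + 1) * (1 / d n) + 1 / sqrt (d n)) \<longlonglongrightarrow> (exp 2 * 2 + 1) * 0 + 0"
      by (intro tendsto_intros inverse_d_0 inverse_sqrt_d_0)
    then show "(\<lambda>n. (exp 2 * 2 + 1) * (1 / d n) + 1 / sqrt (d n)) \<longlonglongrightarrow> 0" by simp
  qed
  from tendsto_add[OF this trap_mean_ratio] show ?thesis by simp
qed

lemma trunc_tail_0: "(\<lambda>n. a n * gauss_mean n (indicator {h. sqrt (d n) \<le> gamma n h})) \<longlonglongrightarrow> 0"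
proof (rule tendsto_sandwich[of "\<lambda>_. 0" _ _ "\<lambda>n. exp 2 * (2 * exp (- ln (sqrt (d n)) / 2))"])
  show "\<forall>\<^sub>F n in sequentially. 0 \<le> a n * gauss_mean n (indicator {h. sqrt (d n) \<le> gamma n h})"
    using eventually_ge_at_top[of 1]
    by eventually_elim (auto intro!: mult_nonneg_nonneg gauss_mean_nonneg less_imp_le[OF a_pos])
  show "\<forall>\<^sub>F n in sequentially. a n * gauss_mean n (indicator {h. sqrt (d n) \<le> gamma n h}) \<le> exp 2 * (2 * exp (- ln (sqrt (d n)) / 2))"
    using eventually_regular eventually_d_ge_1
  proof eventually_elim
    case (elim n)
    have "(indicator {h. sqrt (d n) \<le> gamma n h} :: real \<Rightarrow> real) = (\<lambda>h. indicator {sqrt (d n)..} (exp (- \<beta> * h) / c n))"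
      by (auto simp: indicator_def gamma_def)
    then show ?case using scaled_tail_bound[of n "sqrt (d n)"] elim by simp
  qed
  have "((\<lambda>x::real. exp 2 * (2 * exp (- ln (sqrt x) / 2))) \<longlongrightarrow> 0) at_top" by real_asymp
  from filterlim_compose[OF this d_at_top]
  show "(\<lambda>n. exp 2 * (2 * exp (- ln (sqrt (d n)) / 2))) \<longlonglongrightarrow> 0" .
qed auto

end

end

section \<open>Subcritical scale\<close>

text \<open>The exponents come from the Chernoff bound with \<open>p\<close>-th moments.\<close>

lemma subcritical_bounds:
  fixes a b c d p \<beta> \<eta> :: real and n :: nat
  assumes n: "n \<ge> 1" and a: "a > 0" and c: "c > 0" and p: "p \<ge> 1" and \<eta>: "\<eta> \<ge> 0"
    and d: "d = a * exp (n * \<beta>\<^sup>2 / 2) / c" and b: "b = d * exp (- \<eta> * n)"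
  shows "a * gauss_mean n (indicator {h. b \<le> exp (- \<beta> * h) / c}) \<le> exp ((1 - p) * ln a + p * (p - 1) * (n * \<beta>\<^sup>2 / 2) + p * \<eta> * n)"
    and "a * gauss_mean n (\<lambda>h. (trunc b (exp (- \<beta> * h) / c))\<^sup>2) / d\<^sup>2 \<le> exp (- \<eta> * n)"
    and "\<bar>a * gauss_mean n (\<lambda>h. trunc b (exp (- \<beta> * h) / c)) / d - 1\<bar> \<le> exp ((1 - p) * ln a + p * (p - 1) * (n * \<beta>\<^sup>2 / 2) + p * \<eta> * n)"
proof -
  define g where "g h = exp (- \<beta> * h) / c" for h
  define l where "l = ln b"
  define V where "V = real n * \<beta>\<^sup>2 / 2"
  have d0: "d > 0" and b0: "b > 0" using a c by (auto simp: d b)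
  have lnd: "ln d = ln a + V - ln c" using a c by (simp add: d V_def ln_mult ln_div)
  have l: "l = ln a + V - ln c - \<eta> * n"
    unfolding l_def b using d0 lnd by (simp add: ln_mult)
  have expl: "b = exp l" using b0 by (simp add: l_def)
  have g: "g h = exp (- \<beta> * h + - ln c)" for h
    unfolding g_def exp_add using c by (simp add: exp_minus divide_inverse)
  have mg: "g \<in> borel_measurable borel" unfolding g_def by measurable
  have ig: "gauss_integrable n g" and gg: "gauss_mean n g = exp (V - ln c)"
    using gauss_exp[OF n, of "- \<beta>" "- ln c"] unfolding g[abs_def] by (simp_all add: V_def mult.commute)
  have ga: "a * gauss_mean n g = d"
    using a c by (simp add: gg d V_def exp_diff)
  define B where "B = {h. b \<le> g h}"
  have mB: "(indicator B :: real \<Rightarrow> real) \<in> borel_measurable borel" unfolding B_def using mg by measurable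
  have tilt: "gauss_mean n (\<lambda>h. exp ((- p * \<beta>) * h + k)) = exp (p\<^sup>2 * V + k)" for k
    using gauss_exp(2)[OF n, of "- p * \<beta>" k] by (simp add: V_def power_mult_distrib mult_ac)
  have inB: "l \<le> - \<beta> * h + - ln c" if "h \<in> B" for h
    using that unfolding B_def g expl by simp
  \<comment> \<open>The indicator of g \<ge> b is at most the p-th power of g / b, and the p-th
    moment of g is an explicit Gaussian exponential.\<close>
  have "gauss_mean n (indicator B) \<le> gauss_mean n (\<lambda>h. exp ((- p * \<beta>) * h + - p * (ln c + l)))"
  proof (rule gauss_mean_le)
    show "gauss_integrable n (indicator B)"
      by (rule gauss_integrable_bounded[OF n mB, of 1]) (simp add: indicator_def)
    fix h
    show "indicator B h \<le> exp ((- p * \<beta>) * h + - p * (ln c + l))"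
    proof (cases "h \<in> B")
      case True
      then have "0 \<le> p * (- \<beta> * h + - ln c - l)" using inB p by (intro mult_nonneg_nonneg) auto
      also have "\<dots> = (- p * \<beta>) * h + - p * (ln c + l)" by (simp add: algebra_simps)
      finally show ?thesis using True by simp
    qed simp
  qed (rule gauss_exp(1)[OF n])
  also have "\<dots> = exp (p\<^sup>2 * V + - p * (ln c + l))" by (rule tilt)
  finally have "a * gauss_mean n (indicator B) \<le> exp (ln a) * exp (p\<^sup>2 * V + - p * (ln c + l))" using a by simp
  also have "\<dots> = exp ((1 - p) * ln a + p * (p - 1) * V + p * \<eta> * n)"
    unfolding exp_add[symmetric] l by (simp add: algebra_simps power2_eq_square)
  finally show "a * gauss_mean n (indicator {h. b \<le> exp (- \<beta> * h) / c}) \<le> exp ((1 - p) * ln a + p * (p - 1) * (n * \<beta>\<^sup>2 / 2) + p * \<eta> * n)"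
    by (simp add: B_def g_def V_def)
  have gpos: "g h > 0" for h using c by (simp add: g_def)
  have it: "gauss_integrable n (\<lambda>h. trunc b (g h))"
    by (rule gauss_integrable_bound[OF ig]) (use mg gpos in \<open>auto simp: trunc_def less_imp_le\<close>)
  \<comment> \<open>Truncation at b trades one factor of g for b. Since a times the mean of g is
    exactly d, the ratio becomes b / d.\<close>
  have "gauss_mean n (\<lambda>h. (trunc b (g h))\<^sup>2) \<le> gauss_mean n (\<lambda>h. b * g h)"
  proof (rule gauss_mean_le)
    have le: "(trunc b (g h))\<^sup>2 \<le> b * g h" for h
      using gpos[of h] b0 by (auto simp: trunc_def power2_eq_square intro: mult_right_mono)
    then show "gauss_integrable n (\<lambda>h. (trunc b (g h))\<^sup>2)"
      by (intro gauss_integrable_bound[OF gauss_integrable_cmult[OF ig, of b]]) (use mg in \<open>auto\<close>)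
    show "gauss_integrable n (\<lambda>h. b * g h)" by (rule gauss_integrable_cmult[OF ig])
    show "(trunc b (g h))\<^sup>2 \<le> b * g h" for h by (rule le)
  qed
  also have "\<dots> = b * gauss_mean n g" by (rule gauss_mean_cmult)
  finally have "a * gauss_mean n (\<lambda>h. (trunc b (g h))\<^sup>2) \<le> a * (b * gauss_mean n g)" using a by (intro mult_left_mono) auto
  also have "\<dots> = b * d" using ga by (simp add: mult_ac)
  finally have "a * gauss_mean n (\<lambda>h. (trunc b (g h))\<^sup>2) / d\<^sup>2 \<le> b * d / d\<^sup>2" by (intro divide_right_mono) auto
  also have "\<dots> = exp (- \<eta> * n)" using d0 by (simp add: b power2_eq_square)
  finally show "a * gauss_mean n (\<lambda>h. (trunc b (exp (- \<beta> * h) / c))\<^sup>2) / d\<^sup>2 \<le> exp (- \<eta> * n)" by (simp add: g_def)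
  define R where "R = gauss_mean n (\<lambda>h. g h - trunc b (g h))"
  have R: "R = gauss_mean n g - gauss_mean n (\<lambda>h. trunc b (g h))"
    unfolding R_def by (rule gauss_mean_diff[OF ig it])
  have R0: "R \<ge> 0" unfolding R_def by (rule gauss_mean_nonneg) (use gpos in \<open>auto simp: trunc_def less_imp_le\<close>)
  \<comment> \<open>The mean removed by truncation is bounded by the same moment: on g \<ge> b, g is
    at most its p-th power times b to the power 1 - p.\<close>
  have "R \<le> gauss_mean n (\<lambda>h. exp ((- p * \<beta>) * h + (- p * ln c + (1 - p) * l)))"
    unfolding R_def
  proof (rule gauss_mean_le)
    show "gauss_integrable n (\<lambda>h. g h - trunc b (g h))"
      by (rule gauss_integrable_bound[OF ig]) (use mg gpos in \<open>auto simp: trunc_def less_imp_le\<close>)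
    fix h
    show "g h - trunc b (g h) \<le> exp ((- p * \<beta>) * h + (- p * ln c + (1 - p) * l))"
    proof (cases "h \<in> B")
      case True
      then have "0 \<le> (p - 1) * (- \<beta> * h + - ln c - l)" using inB p by (intro mult_nonneg_nonneg) auto
      also have "\<dots> = ((- p * \<beta>) * h + (- p * ln c + (1 - p) * l)) - (- \<beta> * h + - ln c)" by (simp add: algebra_simps)
      finally have "g h \<le> exp ((- p * \<beta>) * h + (- p * ln c + (1 - p) * l))" unfolding g by simp
      then show ?thesis using True by (simp add: trunc_def B_def)
    next
      case False
      then show ?thesis by (simp add: trunc_def B_def)
    qed
  qed (rule gauss_exp(1)[OF n])
  also have "\<dots> = exp (p\<^sup>2 * V + (- p * ln c + (1 - p) * l))" by (rule tilt)
  finally have "a * R / d \<le> exp (ln a) * exp (p\<^sup>2 * V + (- p * ln c + (1 - p) * l)) / exp (ln d)"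
    using a d0 by (simp add: divide_right_mono)
  also have "\<dots> = exp ((1 - p) * ln a + p * (p - 1) * V + (p - 1) * \<eta> * n)"
    unfolding exp_add[symmetric] exp_diff[symmetric] l lnd by (simp add: algebra_simps power2_eq_square)
  \<comment> \<open>Replacing p - 1 by p weakens the exponent, so that tail mass and lost mean share
    one rate.\<close>
  also have "\<dots> \<le> exp ((1 - p) * ln a + p * (p - 1) * V + p * \<eta> * n)"
    using \<eta> by (simp add: mult_right_mono)
  finally have "a * R / d \<le> exp ((1 - p) * ln a + p * (p - 1) * V + p * \<eta> * n)" .
  moreover have "a * gauss_mean n (\<lambda>h. trunc b (g h)) / d - 1 = - (a * R / d)"
    unfolding R right_diff_distrib ga using d0 by (simp add: diff_divide_distrib)
  moreover have "a * R / d \<ge> 0" using a R0 d0 by simp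
  ultimately show "\<bar>a * gauss_mean n (\<lambda>h. trunc b (exp (- \<beta> * h) / c)) / d - 1\<bar> \<le> exp ((1 - p) * ln a + p * (p - 1) * (n * \<beta>\<^sup>2 / 2) + p * \<eta> * n)"
    unfolding g_def V_def by (simp only: abs_minus_cancel abs_of_nonneg)
qed

text \<open>Put k = \<epsilon> ln 2, the growth rate of ln a. Subcriticality leaves a gap between
  \<open>\<beta>\<^sup>2 / 2\<close> and k, in which p \<open>\<beta>\<^sup>2 / 2\<close> fits for
  some p above 1; the exponent per unit of n is then (p - 1) times a negative number, with room for
  \<eta>.\<close>

lemma subcritical_rates:
  fixes \<beta> \<epsilon> :: real and a :: "nat \<Rightarrow> real"
  assumes \<beta>: "\<beta> > 0" and sub: "\<beta>\<^sup>2 < 2 * \<epsilon> * ln 2"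
    and growth: "(\<lambda>n. ln (a n) / (real n * ln 2)) \<longlonglongrightarrow> \<epsilon>"
  obtains p \<eta> \<theta> :: real where "p \<ge> 1" "\<eta> > 0" "\<theta> > 0"
    "\<forall>\<^sub>F n in sequentially. exp ((1 - p) * ln (a n) + p * (p - 1) * (n * \<beta>\<^sup>2 / 2) + p * \<eta> * n) \<le> exp (- \<theta> * n)"
proof -
  define k where "k = \<epsilon> * ln 2"
  \<comment> \<open>Chosen so that p \<open>\<beta>\<^sup>2 / 2\<close> is the midpoint
    \<open>k1\<close> of the gap. The number \<open>k2\<close> between \<open>k1\<close> and k
    absorbs the error in the limit of ln a / n.\<close>
  define p where "p = (1 + 2 * k / \<beta>\<^sup>2) / 2"
  define k1 where "k1 = (\<beta>\<^sup>2 / 2 + k) / 2"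
  define k2 where "k2 = (k + k1) / 2"
  \<comment> \<open>The available margin is (p - 1) (k2 - k1) = 2 \<theta>; one \<theta> pays for
    the loss p \<eta> and the other is the rate.\<close>
  define \<theta> where "\<theta> = (p - 1) * (k2 - k1) / 2"
  define \<eta> where "\<eta> = \<theta> / p"
  have bk: "\<beta>\<^sup>2 / 2 < k" using sub by (simp add: k_def)
  have b2: "\<beta>\<^sup>2 > 0" using \<beta> by simp
  have "1 < 2 * k / \<beta>\<^sup>2" using bk b2 by (simp add: less_divide_eq)
  then have p: "p > 1" by (simp add: p_def)
  have pk: "p * (\<beta>\<^sup>2 / 2) = k1" using b2 by (simp add: p_def k1_def field_simps)
  have k12: "k1 < k2" "k2 < k" using bk by (auto simp: k1_def k2_def)
  have \<theta>: "\<theta> > 0" using p k12 by (simp add: \<theta>_def)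
  have \<eta>: "\<eta> > 0" "p * \<eta> = \<theta>" using \<theta> p by (auto simp: \<eta>_def)
  have "k2 / ln 2 < \<epsilon>" using k12 by (simp add: k_def divide_less_eq)
  then have "\<forall>\<^sub>F n in sequentially. k2 / ln 2 < ln (a n) / (real n * ln 2)" using growth by (intro order_tendstoD)
  then have "\<forall>\<^sub>F n in sequentially. exp ((1 - p) * ln (a n) + p * (p - 1) * (n * \<beta>\<^sup>2 / 2) + p * \<eta> * n) \<le> exp (- \<theta> * n)"
    using eventually_ge_at_top[of 1]
  proof eventually_elim
    case (elim n)
    then have "k2 * n < ln (a n)" by (simp add: divide_simps split: if_splits)
    then have "(p - 1) * (k2 * n) \<le> (p - 1) * ln (a n)" using p by (intro mult_left_mono) auto
    moreover have "p * (p - 1) * (n * \<beta>\<^sup>2 / 2) = (p - 1) * (k1 * n)" unfolding pk[symmetric] by simp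
    moreover have "p * \<eta> * n = \<theta> * n" by (simp add: \<eta>(2))
    moreover have "(p - 1) * (k2 * n) - (p - 1) * (k1 * n) = 2 * \<theta> * n" by (simp add: \<theta>_def algebra_simps)
    moreover have "(1 - p) * ln (a n) = - ((p - 1) * ln (a n))" by (simp add: algebra_simps)
    ultimately have "(1 - p) * ln (a n) + p * (p - 1) * (n * \<beta>\<^sup>2 / 2) + p * \<eta> * n \<le> - \<theta> * n" by linarith
    then show ?case by (simp only: exp_le_cancel_iff)
  qed
  with that[of p \<eta> \<theta>] p \<eta> \<theta> show thesis by auto
qed

section \<open>From good environments to the processes\<close>

context random_environment
begin

context
  fixes Q :: "nat \<Rightarrow> 'v measure" and J :: "nat \<Rightarrow> nat \<Rightarrow> 'v \<Rightarrow> vertex" and e :: "nat \<Rightarrow> nat \<Rightarrow> 'v \<Rightarrow> real"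
    and a c d s :: "nat \<Rightarrow> real" and \<beta> T \<delta> \<eta> :: real
  assumes dyn: "\<And>n. n \<ge> 1 \<Longrightarrow> walk_and_clocks n (Q n) (J n) (e n)"
    and a: "filterlim a at_top sequentially" and ev: "\<forall>\<^sub>F n in sequentially. c n > 0 \<and> d n > 0"
    and pos: "T > 0" "\<delta> > 0" "\<eta> > 0"
begin

text \<open>The tolerance \<rho> is fixed from T, \<delta> and \<eta> before n. In a good
  environment \<open>dev_bound\<close> then keeps the deviation probability below \<eta>, so bad
  environments contain all failures.\<close>

lemma null_rate_clock:
  assumes good: "\<And>\<rho>. \<rho> > 0 \<Longrightarrow> null_rate P s (\<lambda>n w. good_env n (a n) (d n) \<rho>
      (\<lambda>x. trunc (b n) (exp (- \<beta> * H n x w) / c n)) {x. H n x w \<in> {h. b n \<le> exp (- \<beta> * h) / c n}})"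
  shows "null_rate P s (\<lambda>n w. \<bar>dev_prob (Q n) (\<lambda>v. clock \<beta> (a n) (c n) (\<lambda>x. H n x w) (\<lambda>k. J n k v) (\<lambda>i. e n i v))
      (d n) T \<delta>\<bar> \<le> \<eta>)"
proof -
  obtain \<rho> where \<rho>: "0 < \<rho>" "\<rho> \<le> 1" "\<rho> * (2 + T + \<delta>) \<le> \<delta> / 8" and le: "dev_bound T \<delta> \<rho> \<le> \<eta>"
    by (rule small_tolerance[OF pos])
  have "\<forall>\<^sub>F n in sequentially. 1 / \<rho> \<le> a n" using a by (simp add: filterlim_at_top)
  then show ?thesis
    using ev eventually_ge_at_top[of 1]
  proof (intro null_rate_mono[OF good[OF \<rho>(1)]], eventually_elim, intro ballI impI)
    fix n w
    assume n: "1 / \<rho> \<le> a n" "c n > 0 \<and> d n > 0" "n \<ge> 1" and g: "good_env n (a n) (d n) \<rho>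
      (\<lambda>x. trunc (b n) (exp (- \<beta> * H n x w) / c n)) {x. H n x w \<in> {h. b n \<le> exp (- \<beta> * h) / c n}}"
    interpret D: walk_and_clocks n "Q n" "J n" "e n" by (rule dyn[OF n(3)])
    from n(2) have "c n > 0" "d n > 0" by auto
    from D.dev_prob_clock_le[OF n(3) pos(1,2) n(1) \<rho> this g, of \<beta> "\<lambda>x. H n x w"] le
    show "\<bar>dev_prob (Q n) (\<lambda>v. clock \<beta> (a n) (c n) (\<lambda>x. H n x w) (\<lambda>k. J n k v) (\<lambda>i. e n i v)) (d n) T \<delta>\<bar> \<le> \<eta>"
      by (auto simp: gam_def tau_def trunc_def)
  qed
qed

lemma null_rate_mean_clock:
  assumes good: "\<And>\<rho>. \<rho> > 0 \<Longrightarrow> null_rate P s (\<lambda>n w. good_env n (a n) (d n) \<rho>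
      (\<lambda>x. trap_mean (exp (- \<beta> * H n x w) / c n)) {x. H n x w \<in> {}})"
  shows "null_rate P s (\<lambda>n w. \<bar>dev_prob (Q n) (\<lambda>v. mean_clock n \<beta> (a n) (c n) (\<lambda>x. H n x w) (\<lambda>k. J n k v)) (d n) T \<delta>\<bar> \<le> \<eta>)"
proof -
  obtain \<rho> where \<rho>: "0 < \<rho>" "\<rho> \<le> 1" "\<rho> * (2 + T + \<delta>) \<le> \<delta> / 8" and le: "dev_bound T \<delta> \<rho> \<le> \<eta>"
    by (rule small_tolerance[OF pos])
  have "\<forall>\<^sub>F n in sequentially. 1 / \<rho> \<le> a n" using a by (simp add: filterlim_at_top)
  then show ?thesis
    using ev eventually_ge_at_top[of 1]
  proof (intro null_rate_mono[OF good[OF \<rho>(1)]], eventually_elim, intro ballI impI)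
    fix n w
    assume n: "1 / \<rho> \<le> a n" "c n > 0 \<and> d n > 0" "n \<ge> 1"
      and "good_env n (a n) (d n) \<rho> (\<lambda>x. trap_mean (exp (- \<beta> * H n x w) / c n)) {x. H n x w \<in> {}}"
    then have g: "good_env n (a n) (d n) \<rho> (\<lambda>x. trap_mean (gam \<beta> (c n) (\<lambda>x. H n x w) x)) {}"
      by (simp add: gam_def tau_def)
    interpret D: walk_and_clocks n "Q n" "J n" "e n" by (rule dyn[OF n(3)])
    from n(2) have "c n > 0" "d n > 0" by auto
    from D.dev_prob_mean_clock_le[OF n(3) pos(1,2) n(1) \<rho> this g] le
    show "\<bar>dev_prob (Q n) (\<lambda>v. mean_clock n \<beta> (a n) (c n) (\<lambda>x. H n x w) (\<lambda>k. J n k v)) (d n) T \<delta>\<bar> \<le> \<eta>"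
      by simp
  qed
qed

end

text \<open>Stationarity makes the inner expectation a number of steps times a cube average, and the
  environment average of the latter is a single Gaussian mean.\<close>

lemma expected_mean_clock:
  assumes dyn: "walk_and_clocks n Q J e" and n: "n \<ge> 1" and c: "c > 0"
  shows "(\<integral>w. (\<integral>v. mean_clock n \<beta> a c (\<lambda>x. H n x w) (\<lambda>k. J k v) 1 \<partial>Q) \<partial>P)
    = real (nat \<lfloor>a\<rfloor>) * gauss_mean n (\<lambda>h. trap_mean (exp (- \<beta> * h) / c))"
proof -
  interpret D: walk_and_clocks n Q J e by (rule dyn)
  have inner: "(\<integral>v. mean_clock n \<beta> a c h (\<lambda>k. J k v) 1 \<partial>Q) = real (nat \<lfloor>a\<rfloor>) * cube_avg n (\<lambda>x. trap_mean (gam \<beta> c h x))" for h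
    unfolding mean_clock_eq_step_mean_sum
    by (subst Bochner_Integration.integral_sum)
       (simp_all add: D.integrable_fun_J1 D.expectation_J[OF n] cube_avg_step_mean[OF n])
  have b: "\<bar>trap_mean (exp (- \<beta> * h) / c)\<bar> \<le> 1" for h
    using trap_mean_bounds(1,2)[of "exp (- \<beta> * h) / c"] c by simp
  have "(\<integral>w. (\<integral>v. mean_clock n \<beta> a c (\<lambda>x. H n x w) (\<lambda>k. J k v) 1 \<partial>Q) \<partial>P)
    = real (nat \<lfloor>a\<rfloor>) * expectation (\<lambda>w. cube_avg n (\<lambda>x. trap_mean (exp (- \<beta> * H n x w) / c)))"
    unfolding inner by (simp add: gam_def tau_def)
  also have "expectation (\<lambda>w. cube_avg n (\<lambda>x. trap_mean (exp (- \<beta> * H n x w) / c))) = gauss_mean n (\<lambda>h. trap_mean (exp (- \<beta> * h) / c))"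
    by (rule expectation_avg_F[OF n _ b]) measurable
  finally show ?thesis .
qed

end

theorem proposition1p9:
  fixes P :: "'w measure" and H :: "nat \<Rightarrow> vertex \<Rightarrow> 'w \<Rightarrow> real"
    and Q :: "nat \<Rightarrow> 'v measure" and J :: "nat \<Rightarrow> nat \<Rightarrow> 'v \<Rightarrow> vertex"
    and e :: "nat \<Rightarrow> nat \<Rightarrow> 'v \<Rightarrow> real"
    and \<beta> \<epsilon> :: real and c a :: "nat \<Rightarrow> real"
    and M S :: "nat \<Rightarrow> 'w \<Rightarrow> 'v \<Rightarrow> real \<Rightarrow> real" and EEM :: "nat \<Rightarrow> real"
  assumes env: "random_environment P H"
    and dyn: "\<And>n. n \<ge> 1 \<Longrightarrow> walk_and_clocks n (Q n) (J n) (e n)"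
    and beta_pos: "0 < \<beta>"
    and scale: "intermediate_time_scale P H \<beta> c a \<epsilon>"
  defines "M \<equiv> \<lambda>n w v t. mean_clock n \<beta> (a n) (c n) (\<lambda>x. H n x w) (\<lambda>k. J n k v) t"
    and "S \<equiv> \<lambda>n w v t. clock \<beta> (a n) (c n) (\<lambda>x. H n x w) (\<lambda>k. J n k v) (\<lambda>i. e n i v) t"
    and "EEM \<equiv> \<lambda>n. (\<integral>w. (\<integral>v. M n w v 1 \<partial>Q n) \<partial>P)"
  shows
    "(alpha \<beta> \<epsilon> = 1 \<longrightarrow> (\<forall>T>0. \<forall>\<delta>>0.
        (summable (\<lambda>n. a n / 2 ^ n) \<longrightarrow>
          (AE w in P. (\<lambda>n. dev_prob (Q n) (M n w) (EEM n) T \<delta>) \<longlonglongrightarrow> 0 \<and>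
                      (\<lambda>n. dev_prob (Q n) (S n w) (EEM n) T \<delta>) \<longlonglongrightarrow> 0)) \<and>
        (\<not> summable (\<lambda>n. a n / 2 ^ n) \<longrightarrow>
          tendsto_in_prob P (\<lambda>n w. dev_prob (Q n) (M n w) (EEM n) T \<delta>) 0 \<and>
          tendsto_in_prob P (\<lambda>n w. dev_prob (Q n) (S n w) (EEM n) T \<delta>) 0))) \<and>
     (alpha \<beta> \<epsilon> > 1 \<longrightarrow> (\<forall>T>0. \<forall>\<delta>>0.
        (AE w in P. (\<lambda>n. dev_prob (Q n) (S n w)
            (a n * exp (real n * \<beta>\<^sup>2 / 2) / c n) T \<delta>) \<longlonglongrightarrow> 0)))"
proof -
  interpret random_environment P H by (rule env)
  have c: "filterlim c at_top sequentially" and sc: "is_scale P H \<beta> c a" and eps: "0 < \<epsilon>" "\<epsilon> \<le> 1"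
    and growth: "(\<lambda>n. ln (a n) / (real n * ln 2)) \<longlonglongrightarrow> \<epsilon>" and a2: "(\<lambda>n. a n / 2 ^ n) \<longlonglongrightarrow> 0"
    using scale by (auto simp: intermediate_time_scale_def)
  have c_pos: "\<forall>\<^sub>F n in sequentially. c n > 0" using c by (simp add: filterlim_at_top_dense)
  \<comment> \<open>Dividing \<open>tau \<ge> c\<close> by c preserves the event only for positive
    c, which is known only for large n.\<close>
  have scale_prob: "a n * gauss_mean n (\<lambda>h. indicator {1..} (exp (- \<beta> * h) / c n)) = 1"
    if n: "n \<ge> 1" and cn: "c n > 0" for n
  proof -
    obtain x where x: "x \<in> cube n" using cube_nonempty by blast

    have "measure P {w \<in> space P. tau \<beta> (\<lambda>y. H n y w) x \<ge> c n}
        = expectation (indicator {w \<in> space P. tau \<beta> (\<lambda>y. H n y w) x \<ge> c n})"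
      by simp (intro arg_cong[where f=prob], auto)
    also have "\<dots> = expectation (\<lambda>w. indicator {1..} (exp (- \<beta> * H n x w) / c n))"
      using cn by (intro Bochner_Integration.integral_cong refl) (auto simp: indicator_def tau_def le_divide_eq)
    also have "\<dots> = gauss_mean n (\<lambda>h. indicator {1..} (exp (- \<beta> * h) / c n))"
      by (rule expectation_fun_H[OF n x]) measurable
    finally have prob_eq: "measure P {w \<in> space P. tau \<beta> (\<lambda>y. H n y w) x \<ge> c n}
        = gauss_mean n (\<lambda>h. indicator {1..} (exp (- \<beta> * h) / c n))" .
    have "a n * measure P {w \<in> space P. tau \<beta> (\<lambda>y. H n y w) x \<ge> c n} = 1"
      using sc n x unfolding is_scale_def by blast
    then show ?thesis unfolding prob_eq .
  qed
  have a_pos: "a n > 0" if n: "n \<ge> 1" for n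
  proof -
    obtain x where x: "x \<in> cube n" using cube_nonempty by blast
    then have "a n * measure P {w \<in> space P. tau \<beta> (\<lambda>y. H n y w) x \<ge> c n} = 1" using sc n by (simp add: is_scale_def)
    then show ?thesis by (smt (verit) measure_nonneg mult_nonpos_nonneg)
  qed
  \<comment> \<open>Since \<epsilon> is positive, ln a grows linearly in n.\<close>
  have a_top: "filterlim a at_top sequentially"
  proof -
    have "filterlim (\<lambda>n. ln (a n) / (real n * ln 2) * (real n * ln 2)) at_top sequentially"
      by (intro filterlim_tendsto_pos_mult_at_top[OF growth eps(1)]) real_asymp
    moreover have "\<forall>\<^sub>F n in sequentially. ln (a n) / (real n * ln 2) * (real n * ln 2) = ln (a n)"
      using eventually_ge_at_top[of 1] by eventually_elim simp
    ultimately have "filterlim (\<lambda>n. ln (a n)) at_top sequentially" by (simp cong: filterlim_cong)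
    from filterlim_compose[OF exp_at_top this]
    have "filterlim (\<lambda>n. exp (ln (a n))) at_top sequentially" .
    moreover have "\<forall>\<^sub>F n in sequentially. exp (ln (a n)) = a n"
      using eventually_ge_at_top[of 1] by eventually_elim (simp add: a_pos)
    ultimately show ?thesis by (simp cong: filterlim_cong)
  qed
  have a_ge_1: "\<forall>\<^sub>F n in sequentially. 1 \<le> a n" using a_top by (simp add: filterlim_at_top)
  have crit_part: "null_rate P (\<lambda>n. a n / 2 ^ n) (\<lambda>n w. \<bar>dev_prob (Q n) (M n w) (EEM n) T \<delta>\<bar> \<le> \<eta>)"
      "null_rate P (\<lambda>n. a n / 2 ^ n) (\<lambda>n w. \<bar>dev_prob (Q n) (S n w) (EEM n) T \<delta>\<bar> \<le> \<eta>)"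
    if al: "alpha \<beta> \<epsilon> = 1" and pos: "T > 0" "\<delta> > 0" "\<eta> > 0" for T \<delta> \<eta>
  proof -
    have "sqrt (2 * \<epsilon> * ln 2) = \<beta>" using al beta_pos by (simp add: alpha_def beta_c_def)
    then have b2: "\<beta>\<^sup>2 = 2 * \<epsilon> * ln 2" using eps by (simp flip: \<open>sqrt (2 * \<epsilon> * ln 2) = \<beta>\<close>)
    interpret C: critical_scale \<beta> \<epsilon> a c
      by unfold_locales (use beta_pos eps b2 c a_pos scale_prob growth in auto)
    define d where "d n = real (nat \<lfloor>a n\<rfloor>) * gauss_mean n (\<lambda>h. trap_mean (C.gamma n h))" for n
    note asym = C.trap_mean_ratio[OF d_def a_top] C.trap_mean_square_ratio[OF d_def a_top]
      C.trunc_mean_ratio[OF d_def a_top] C.trunc_square_ratio[OF d_def a_top] C.trunc_tail_0[OF d_def a_top]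
    have ev: "\<forall>\<^sub>F n in sequentially. n \<ge> 1 \<and> 1 \<le> a n \<and> c n > 0 \<and> d n \<ge> 1"
      using eventually_ge_at_top[of 1] a_ge_1 c_pos C.eventually_d_ge_1[OF d_def a_top] by eventually_elim simp
    have ev': "\<forall>\<^sub>F n in sequentially. c n > 0 \<and> d n > 0" using ev by eventually_elim simp
    \<comment> \<open>Both scaled means are eventually below 1, and a \<ge> 1 absorbs the term 1 / 2
      ^ n; this accounts for the constant 3.\<close>
    have rate3: "\<forall>\<^sub>F n in sequentially. a n / 2 ^ n * (x n + y n) + 1 / 2 ^ n \<le> 3 * (a n / 2 ^ n)"
      if "x \<longlonglongrightarrow> 0" "y \<longlonglongrightarrow> 0" for x y :: "nat \<Rightarrow> real"
      using order_tendstoD(2)[OF that(1) zero_less_one] order_tendstoD(2)[OF that(2) zero_less_one] ev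
    proof eventually_elim
      case (elim n)
      have "a n / 2 ^ n * (x n + y n) \<le> a n / 2 ^ n * 2" using elim by (intro mult_left_mono) auto
      moreover have "1 / 2 ^ n \<le> a n / 2 ^ n" using elim by (intro divide_right_mono) auto
      ultimately show ?case by simp
    qed
    \<comment> \<open>Trap means are bounded by 1, so the mean clock needs no truncation: B is empty
      and the level is 1.\<close>
    have good_M: "null_rate P (\<lambda>n. a n / 2 ^ n) (\<lambda>n w. good_env n (a n) (d n) \<rho>
        (\<lambda>x. trap_mean (exp (- \<beta> * H n x w) / c n)) {x. H n x w \<in> {}})" if "\<rho> > 0" for \<rho>
      unfolding C.gamma_def[symmetric]
    proof (rule null_rate_good_env[where b="\<lambda>_. 1" and C=3 and F="\<lambda>n h. trap_mean (C.gamma n h)" and B="\<lambda>_. {}"])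
      show "\<forall>\<^sub>F n in sequentially. 1 \<le> a n \<and> 0 \<le> (1::real) \<and> 1 \<le> d n \<and> 0 < d n"
        using ev by eventually_elim simp
      show "\<forall>\<^sub>F n in sequentially. \<forall>h. 0 \<le> trap_mean (C.gamma n h) \<and> trap_mean (C.gamma n h) \<le> 1"
        using c_pos by eventually_elim (use trap_mean_bounds(1,2) C.gamma_pos in blast)
      show empty: "(\<lambda>n. a n * gauss_mean n (indicator {})) \<longlonglongrightarrow> 0" by (simp add: gauss_mean_def)
      show "\<forall>\<^sub>F n in sequentially. a n / 2 ^ n * (a n * gauss_mean n (indicator {}) +
          a n * gauss_mean n (\<lambda>h. (trap_mean (C.gamma n h))\<^sup>2) / (d n)\<^sup>2) + 1 / 2 ^ n \<le> 3 * (a n / 2 ^ n)"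
        by (rule rate3[OF empty asym(2)])
    qed (use asym that in \<open>auto\<close>)
    have good_S: "null_rate P (\<lambda>n. a n / 2 ^ n) (\<lambda>n w. good_env n (a n) (d n) \<rho>
        (\<lambda>x. trunc (sqrt (d n)) (exp (- \<beta> * H n x w) / c n)) {x. H n x w \<in> {h. sqrt (d n) \<le> exp (- \<beta> * h) / c n}})"
      if "\<rho> > 0" for \<rho>
      unfolding C.gamma_def[symmetric]
    proof (rule null_rate_good_env[where b="\<lambda>n. sqrt (d n)" and C=3 and F="\<lambda>n h. trunc (sqrt (d n)) (C.gamma n h)"
          and B="\<lambda>n. {h. sqrt (d n) \<le> C.gamma n h}"])
      show "\<forall>\<^sub>F n in sequentially. 1 \<le> a n \<and> 0 \<le> sqrt (d n) \<and> sqrt (d n) \<le> d n \<and> 0 < d n"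
        using ev
      proof eventually_elim
        case (elim n)
        then have "d n \<le> d n * d n" by simp
        then have "sqrt (d n) \<le> d n" using elim by (intro real_le_lsqrt) (auto simp: power2_eq_square)
        then show ?case using elim by simp
      qed
      show "\<forall>\<^sub>F n in sequentially. \<forall>h. 0 \<le> trunc (sqrt (d n)) (C.gamma n h) \<and> trunc (sqrt (d n)) (C.gamma n h) \<le> sqrt (d n)"
        using ev by eventually_elim (auto simp: trunc_def intro: less_imp_le[OF C.gamma_pos])
      show "\<forall>\<^sub>F n in sequentially. a n / 2 ^ n * (a n * gauss_mean n (indicator {h. sqrt (d n) \<le> C.gamma n h}) +
          a n * gauss_mean n (\<lambda>h. (trunc (sqrt (d n)) (C.gamma n h))\<^sup>2) / (d n)\<^sup>2) + 1 / 2 ^ n \<le> 3 * (a n / 2 ^ n)"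
        by (rule rate3[OF asym(5,4)])
      show "{h. sqrt (d n) \<le> C.gamma n h} \<in> sets borel" for n by measurable
    qed (use asym that in \<open>auto\<close>)
    \<comment> \<open>The \<open>d\<close> of the asymptotics is exactly the normalisation of the
      statement, rounding of a included, as soon as c is positive.\<close>
    have EEM: "\<forall>\<^sub>F n in sequentially. EEM n = d n"
      using ev
    proof eventually_elim
      case (elim n)
      then show ?case unfolding EEM_def M_def d_def C.gamma_def by (intro expected_mean_clock[OF dyn]) auto
    qed
    show "null_rate P (\<lambda>n. a n / 2 ^ n) (\<lambda>n w. \<bar>dev_prob (Q n) (M n w) (EEM n) T \<delta>\<bar> \<le> \<eta>)"
      by (rule null_rate_mono[OF null_rate_mean_clock[OF dyn a_top ev' pos good_M]])
         (use EEM in \<open>auto simp: M_def elim: eventually_mono\<close>)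
    show "null_rate P (\<lambda>n. a n / 2 ^ n) (\<lambda>n w. \<bar>dev_prob (Q n) (S n w) (EEM n) T \<delta>\<bar> \<le> \<eta>)"
      by (rule null_rate_mono[OF null_rate_clock[OF dyn a_top ev' pos good_S]])
         (use EEM in \<open>auto simp: S_def elim: eventually_mono\<close>)
  qed
  have sub_part: "\<exists>s. summable s \<and> (\<forall>T>0. \<forall>\<delta>>0. \<forall>\<eta>>0. null_rate P s (\<lambda>n w.
      \<bar>dev_prob (Q n) (S n w) (a n * exp (real n * \<beta>\<^sup>2 / 2) / c n) T \<delta>\<bar> \<le> \<eta>))"
    if al: "alpha \<beta> \<epsilon> > 1"
  proof -
    have "\<beta> < sqrt (2 * \<epsilon> * ln 2)" using al beta_pos by (simp add: alpha_def beta_c_def)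
    then have "\<beta>\<^sup>2 < (sqrt (2 * \<epsilon> * ln 2))\<^sup>2" using beta_pos by (intro power_strict_mono) auto
    also have "\<dots> = 2 * \<epsilon> * ln 2" using eps by simp
    finally have "\<beta>\<^sup>2 < 2 * \<epsilon> * ln 2" .
    from subcritical_rates[OF beta_pos this growth]
    obtain p \<eta> \<theta> :: real where p: "p \<ge> 1" and \<eta>: "\<eta> > 0" and \<theta>: "\<theta> > 0"
      and rate: "\<forall>\<^sub>F n in sequentially. exp ((1 - p) * ln (a n) + p * (p - 1) * (n * \<beta>\<^sup>2 / 2) + p * \<eta> * n) \<le> exp (- \<theta> * n)" .
    define d where "d n = a n * exp (real n * \<beta>\<^sup>2 / 2) / c n" for n
    define b where "b n = d n * exp (- \<eta> * real n)" for n
    define F where "F n h = trunc (b n) (exp (- \<beta> * h) / c n)" for n h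
    define B where "B n = {h. b n \<le> exp (- \<beta> * h) / c n}" for n
    \<comment> \<open>A geometric rate that dominates the failure bound of the environment, so
      Borel-Cantelli applies whether or not a / 2 ^ n is summable.\<close>
    define s where "s n = exp (- \<theta> * real n) + exp (- \<eta> * real n) + 1 / 2 ^ n" for n
    have geom: "summable (\<lambda>n. exp (- x * real n))" if "x > 0" for x :: real
    proof -
      have "(\<lambda>n. exp (- x * real n)) = (\<lambda>n. exp (- x) ^ n)" by (simp add: exp_of_nat_mult[symmetric] mult.commute)
      then show ?thesis using that by (simp add: summable_geometric)
    qed
    have "summable (\<lambda>n. (1 / 2 :: real) ^ n)" by (rule summable_geometric) simp
    then have "summable (\<lambda>n. 1 / 2 ^ n :: real)" by (simp add: power_one_over)
    then have sum_s: "summable s" unfolding s_def using geom[OF \<theta>] geom[OF \<eta>] by (intro summable_add)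
    have lim0: "(\<lambda>n. exp (- x * real n)) \<longlonglongrightarrow> 0" if "x > 0" for x :: real
      using summable_LIMSEQ_zero[OF geom[OF that]] .
    have pos_n: "\<forall>\<^sub>F n in sequentially. n \<ge> 1 \<and> a n > 0 \<and> c n > 0 \<and> d n > 0 \<and> b n > 0"
      using eventually_ge_at_top[of 1] c_pos by eventually_elim (auto simp: d_def b_def a_pos)
    have bounds: "\<forall>\<^sub>F n in sequentially. a n * gauss_mean n (indicator (B n)) \<le> exp (- \<theta> * n) \<and>
        a n * gauss_mean n (\<lambda>h. (F n h)\<^sup>2) / (d n)\<^sup>2 \<le> exp (- \<eta> * n) \<and>
        \<bar>a n * gauss_mean n (F n) / d n - 1\<bar> \<le> exp (- \<theta> * n)"
      using pos_n rate
    proof eventually_elim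
      case (elim n)
      then have n: "n \<ge> 1" and an: "a n > 0" and cn: "c n > 0" by auto
      note sb = subcritical_bounds[OF n an cn p less_imp_le[OF \<eta>] d_def b_def]
      show ?case
        unfolding B_def F_def[abs_def]
        by (intro conjI sb(2) order_trans[OF sb(1) elim(2)] order_trans[OF sb(3) elim(2)])
    qed
    have nonneg: "\<forall>\<^sub>F n in sequentially. 0 \<le> a n * gauss_mean n (indicator (B n)) \<and> 0 \<le> a n * gauss_mean n (\<lambda>h. (F n h)\<^sup>2) / (d n)\<^sup>2"
      using pos_n by eventually_elim (auto intro!: mult_nonneg_nonneg divide_nonneg_nonneg gauss_mean_nonneg)
    have good: "null_rate P s (\<lambda>n w. good_env n (a n) (d n) \<rho> (\<lambda>x. F n (H n x w)) {x. H n x w \<in> B n})" if "\<rho> > 0" for \<rho>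
    proof (rule null_rate_good_env[where b=b and C=1])
      show "\<forall>\<^sub>F n in sequentially. 1 \<le> a n \<and> 0 \<le> b n \<and> b n \<le> d n \<and> 0 < d n"
        using pos_n a_ge_1 by eventually_elim (use \<eta> in \<open>auto simp: b_def mult_le_cancel_left2\<close>)
      show "\<forall>\<^sub>F n in sequentially. \<forall>h. 0 \<le> F n h \<and> F n h \<le> b n"
        using pos_n by eventually_elim (auto simp: F_def trunc_def)
      show "F n \<in> borel_measurable borel" for n unfolding F_def by measurable
      show "B n \<in> sets borel" for n unfolding B_def by measurable
      show "(\<lambda>n. a n * gauss_mean n (indicator (B n))) \<longlonglongrightarrow> 0"
        by (rule tendsto_sandwich[OF _ _ tendsto_const lim0[OF \<theta>]]) (use nonneg bounds in \<open>auto elim: eventually_mono\<close>)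
      show "(\<lambda>n. a n * gauss_mean n (\<lambda>h. (F n h)\<^sup>2) / (d n)\<^sup>2) \<longlonglongrightarrow> 0"
        by (rule tendsto_sandwich[OF _ _ tendsto_const lim0[OF \<eta>]]) (use nonneg bounds in \<open>auto elim: eventually_mono\<close>)
      have "(\<lambda>n. a n * gauss_mean n (F n) / d n - 1) \<longlonglongrightarrow> 0"
        by (rule Lim_null_comparison[OF _ lim0[OF \<theta>]]) (use bounds in \<open>auto elim: eventually_mono\<close>)
      then show "(\<lambda>n. a n * gauss_mean n (F n) / d n) \<longlonglongrightarrow> 1" by (simp add: LIM_zero_iff)
      \<comment> \<open>The scaled means are exponentially small by themselves, so from a / 2 ^ n
        only boundedness is used.\<close>
      have "\<forall>\<^sub>F n in sequentially. a n / 2 ^ n < 1" by (rule order_tendstoD(2)[OF a2]) simp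
      then show "\<forall>\<^sub>F n in sequentially. a n / 2 ^ n * (a n * gauss_mean n (indicator (B n)) +
          a n * gauss_mean n (\<lambda>h. (F n h)\<^sup>2) / (d n)\<^sup>2) + 1 / 2 ^ n \<le> 1 * s n"
        using bounds nonneg pos_n
      proof eventually_elim
        case (elim n)
        have "a n / 2 ^ n * (a n * gauss_mean n (indicator (B n)) + a n * gauss_mean n (\<lambda>h. (F n h)\<^sup>2) / (d n)\<^sup>2)
          \<le> 1 * (exp (- \<theta> * n) + exp (- \<eta> * n))"
          using elim by (intro mult_mono add_mono) auto
        then show ?case by (simp add: s_def)
      qed
    qed (rule that)
    have "\<forall>\<^sub>F n in sequentially. c n > 0 \<and> d n > 0" using pos_n by eventually_elim simp
    from null_rate_clock[OF dyn a_top this _ _ _ good[unfolded F_def B_def]]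
    have "\<forall>T>0. \<forall>\<delta>>0. \<forall>\<eta>>0. null_rate P s (\<lambda>n w. \<bar>dev_prob (Q n) (S n w) (d n) T \<delta>\<bar> \<le> \<eta>)"
      unfolding S_def by blast
    then show ?thesis using sum_s unfolding d_def by blast
  qed
  show ?thesis
  proof (intro conjI impI allI)
    fix T \<delta> :: real assume al: "alpha \<beta> \<epsilon> = 1" and pos: "T > 0" "\<delta> > 0"
    note part = crit_part[OF al pos]
    {
      assume s: "summable (\<lambda>n. a n / 2 ^ n)"
      show "AE w in P. (\<lambda>n. dev_prob (Q n) (M n w) (EEM n) T \<delta>) \<longlonglongrightarrow> 0 \<and> (\<lambda>n. dev_prob (Q n) (S n w) (EEM n) T \<delta>) \<longlonglongrightarrow> 0"
        by (intro AE_conjI null_rate_AE_tendsto[OF _ s] part)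
    }
    show "tendsto_in_prob P (\<lambda>n w. dev_prob (Q n) (M n w) (EEM n) T \<delta>) 0"
      by (rule null_rate_in_prob[OF _ a2]) (rule part(1))
    show "tendsto_in_prob P (\<lambda>n w. dev_prob (Q n) (S n w) (EEM n) T \<delta>) 0"
      by (rule null_rate_in_prob[OF _ a2]) (rule part(2))
  next
    fix T \<delta> :: real assume al: "alpha \<beta> \<epsilon> > 1" and pos: "T > 0" "\<delta> > 0"
    obtain s where s: "summable s" and rate: "\<And>\<eta>. \<eta> > 0 \<Longrightarrow> null_rate P s (\<lambda>n w.
      \<bar>dev_prob (Q n) (S n w) (a n * exp (real n * \<beta>\<^sup>2 / 2) / c n) T \<delta>\<bar> \<le> \<eta>)"
      using sub_part[OF al] pos by blast
    show "AE w in P. (\<lambda>n. dev_prob (Q n) (S n w) (a n * exp (real n * \<beta>\<^sup>2 / 2) / c n) T \<delta>) \<longlonglongrightarrow> 0"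
      by (rule null_rate_AE_tendsto[OF rate s])
  qed
qed

end
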